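(* For integers $p,q\le -2$ and $t\ge 2$, let $G_{pqt}=\langle x_1,x_2,x_3;\ x_1^{p}x_2^{q}=x_3^{t}\rangle$. Then: (i) $\mathrm{Dim}(R(G_{pqt}))=6$ (for all such $p,q,t$). (ii) $R(G_{pqt})$ is a reducible algebraic variety whenever at least one of $|p|,|q|,|t|$ is strictly larger than $2$. (iii) There exists an infinite set $S_2$ of groups $G_{pqt}$, associated with an infinite set $S\subset\mathbb{Z}\times\mathbb{Z}\times\mathbb{Z}$ of triples $(p,q,t)$ of integers with $p\le -2$, $q\le -2$ and $t\ge 2$ (the groups in $S_2$ being the $G_{pqt}$ with $(p,q,t)\in S$), having the property that if $(p,q,t)$ and $(p',q',t')$ are in $S$, then $R(G_{pqt})\not\cong R(G_{p'q't'})$ if $p\ne p'$ and $q\ne q'$ and $t\ne t'$.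
   Context: For a finitely generated group $G$ with generators $x_1,\dots,x_n$, $R(G)=\mathrm{Hom}(G,SL_2\mathbb{C})$ is the representation variety of $G$: the complex affine algebraic set of all $n$-tuples in $(SL_2\mathbb{C})^n$ satisfying the relations of $G$. Up to isomorphism of algebraic varieties it does not depend on the chosen finite generating set. $\mathrm{Dim}$ denotes the (Krull) dimension, "reducible" means not irreducible in the Zariski topology, and $\cong$ between representation varieties means isomorphism of algebraic varieties. *)

theory Defs
  imports "HOL-Analysis.Analysis" "HOL-Algebra.Group"
begin

section \<open>Affine algebraic sets over the complex numbers\<close>

inductive polynomial_fun :: "(complex^'m \<Rightarrow> complex) \<Rightarrow> bool" where
  const: "polynomial_fun (\<lambda>x. c)"
| coord: "polynomial_fun (\<lambda>x. x $ i)"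
| add: "polynomial_fun f \<Longrightarrow> polynomial_fun g \<Longrightarrow> polynomial_fun (\<lambda>x. f x + g x)"
| mult: "polynomial_fun f \<Longrightarrow> polynomial_fun g \<Longrightarrow> polynomial_fun (\<lambda>x. f x * g x)"

definition algebraic_set :: "(complex^'m) set \<Rightarrow> bool" where
  "algebraic_set V \<longleftrightarrow> (\<exists>P. (\<forall>f\<in>P. polynomial_fun f) \<and> V = {x. \<forall>f\<in>P. f x = 0})"

definition zariski :: "(complex^'m) topology" where
  "zariski = topology (\<lambda>U. algebraic_set (- U))"

lemma algebraic_set_Un:
  assumes "algebraic_set V" "algebraic_set W"
  shows "algebraic_set (V \<union> W)"
proof -
  obtain P where P: "\<forall>f\<in>P. polynomial_fun f" "V = {x. \<forall>f\<in>P. f x = 0}"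
    using assms(1) by (auto simp: algebraic_set_def)
  obtain Q where Q: "\<forall>f\<in>Q. polynomial_fun f" "W = {x. \<forall>f\<in>Q. f x = 0}"
    using assms(2) by (auto simp: algebraic_set_def)
  let ?R = "{\<lambda>x. f x * g x | f g. f \<in> P \<and> g \<in> Q}"
  have "\<forall>h\<in>?R. polynomial_fun h" using P(1) Q(1) polynomial_fun.mult by blast
  moreover have "V \<union> W = {x. \<forall>h\<in>?R. h x = 0}"
  proof (rule Set.set_eqI)
    fix x
    show "x \<in> V \<union> W \<longleftrightarrow> x \<in> {x. \<forall>h\<in>?R. h x = 0}"
    proof
      assume "x \<in> V \<union> W"
      then show "x \<in> {x. \<forall>h\<in>?R. h x = 0}" using P(2) Q(2) by auto
    next
      assume *: "x \<in> {x. \<forall>h\<in>?R. h x = 0}"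
      show "x \<in> V \<union> W"
      proof (rule ccontr)
        assume "x \<notin> V \<union> W"
        then obtain f g where "f \<in> P" "g \<in> Q" "f x \<noteq> 0" "g x \<noteq> 0"
          using P(2) Q(2) by auto
        moreover from this have "(\<lambda>x. f x * g x) \<in> ?R" by blast
        ultimately show False using * by fastforce
      qed
    qed
  qed
  ultimately show ?thesis unfolding algebraic_set_def by blast
qed

lemma algebraic_set_Inter:
  assumes "\<And>V. V \<in> \<V> \<Longrightarrow> algebraic_set V"
  shows "algebraic_set (\<Inter>\<V>)"
proof -
  let ?P = "{f. polynomial_fun f \<and> (\<forall>x\<in>\<Inter>\<V>. f x = 0)}"
  have "x \<in> V" if x: "\<forall>f\<in>?P. f x = 0" and V: "V \<in> \<V>" for x V
  proof -
    obtain P where P: "\<forall>f\<in>P. polynomial_fun f" "V = {x. \<forall>f\<in>P. f x = 0}"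
      using assms[OF V] unfolding algebraic_set_def by (elim exE conjE)
    have "f x = 0" if "f \<in> P" for f
    proof -
      have "f y = 0" if "y \<in> \<Inter>\<V>" for y
        using InterD[OF that V] \<open>f \<in> P\<close> P(2) by simp
      then show ?thesis using x P(1) \<open>f \<in> P\<close> by simp
    qed
    then show ?thesis using P(2) by simp
  qed
  then have "\<Inter>\<V> = {x. \<forall>f\<in>?P. f x = 0}" by auto
  then show ?thesis unfolding algebraic_set_def by (intro exI[of _ ?P]) simp
qed

lemma openin_zariski:
  fixes U :: "(complex^'m) set"
  shows "openin zariski U \<longleftrightarrow> algebraic_set (- U)"
proof -
  have "istopology (\<lambda>U. algebraic_set (- (U :: (complex^'m) set)))"
    unfolding istopology_def
  proof (intro conjI allI impI)
    fix S T :: "(complex^'m) set"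
    assume "algebraic_set (- S)" "algebraic_set (- T)"
    then show "algebraic_set (- (S \<inter> T))" by (simp add: algebraic_set_Un)
  next
    fix \<K> :: "(complex^'m) set set"
    assume "\<forall>K\<in>\<K>. algebraic_set (- K)"
    then have "algebraic_set (\<Inter>(uminus ` \<K>))" by (intro algebraic_set_Inter) auto
    then show "algebraic_set (- \<Union>\<K>)" by (simp add: uminus_Sup)
  qed
  then show ?thesis by (simp add: zariski_def)
qed

lemma topspace_zariski [simp]: "topspace zariski = UNIV"
proof -
  have "algebraic_set ({} :: (complex^'m) set)"
    unfolding algebraic_set_def
    by (rule exI[of _ "{\<lambda>x. 1}"]) (auto intro: polynomial_fun.const)
  then have "openin zariski (UNIV :: (complex^'m) set)" by (simp add: openin_zariski)
  then show ?thesis using openin_subset by fastforce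
qed

lemma closedin_zariski: "closedin zariski V \<longleftrightarrow> algebraic_set V"
  by (simp add: closedin_def openin_zariski Compl_eq_Diff_UNIV[symmetric])

definition irreducible_space :: "'a topology \<Rightarrow> bool" where
  "irreducible_space X \<longleftrightarrow> topspace X \<noteq> {} \<and>
     (\<forall>A B. closedin X A \<and> closedin X B \<and> topspace X = A \<union> B \<longrightarrow> A = topspace X \<or> B = topspace X)"

text \<open>The supremum of the lengths of strictly increasing chains of irreducible closed subsets.
  With values in \<^typ>\<open>enat\<close> the empty space gets dimension 0; a representation variety is never
  empty.\<close>

definition krull_dim :: "'a topology \<Rightarrow> enat" where
  "krull_dim X = Sup {enat n | n. \<exists>Z :: nat \<Rightarrow> 'a set.
     (\<forall>i\<le>n. closedin X (Z i) \<and> irreducible_space (subtopology X (Z i))) \<and>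
     (\<forall>i<n. Z i \<subset> Z (Suc i))}"

definition variety_dim :: "(complex^'m) set \<Rightarrow> enat" where
  "variety_dim V = krull_dim (subtopology zariski V)"

definition irreducible_variety :: "(complex^'m) set \<Rightarrow> bool" where
  "irreducible_variety V \<longleftrightarrow> irreducible_space (subtopology zariski V)"

definition polynomial_map :: "(complex^'m \<Rightarrow> complex^'n) \<Rightarrow> bool" where
  "polynomial_map f \<longleftrightarrow> (\<forall>i. polynomial_fun (\<lambda>x. f x $ i))"

definition variety_iso :: "(complex^'m) set \<Rightarrow> (complex^'n) set \<Rightarrow> bool" where
  "variety_iso V W \<longleftrightarrow> (\<exists>f g. polynomial_map f \<and> polynomial_map g \<and>
     f ` V \<subseteq> W \<and> g ` W \<subseteq> V \<and> (\<forall>x\<in>V. g (f x) = x) \<and> (\<forall>y\<in>W. f (g y) = y))"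


section \<open>Group presentations\<close>

text \<open>A letter \<open>(x, True)\<close> stands for the generator \<open>x\<close> and \<open>(x, False)\<close> for its inverse. A
  relation \<open>u = v\<close> is a pair of words; \<open>pres_eq E\<close> is equality of words modulo the relations \<open>E\<close>.\<close>

type_synonym 'x word = "('x \<times> bool) list"

inductive pres_eq :: "('x word \<times> 'x word) set \<Rightarrow> 'x word \<Rightarrow> 'x word \<Rightarrow> bool"
  for E where
  refl: "pres_eq E u u"
| sym: "pres_eq E u v \<Longrightarrow> pres_eq E v u"
| trans: "pres_eq E u v \<Longrightarrow> pres_eq E v w \<Longrightarrow> pres_eq E u w"
| append: "pres_eq E u v \<Longrightarrow> pres_eq E u' v' \<Longrightarrow> pres_eq E (u @ u') (v @ v')"
| cancel: "pres_eq E [(x, b), (x, \<not> b)] []"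
| relation: "(u, v) \<in> E \<Longrightarrow> pres_eq E u v"

definition word_class :: "('x word \<times> 'x word) set \<Rightarrow> 'x word \<Rightarrow> 'x word set" where
  "word_class E u = {v. pres_eq E u v}"

definition presented_group :: "('x word \<times> 'x word) set \<Rightarrow> 'x word set monoid" where
  "presented_group E =
     \<lparr>carrier = range (word_class E),
      monoid.mult = (\<lambda>A B. \<Union>u\<in>A. \<Union>v\<in>B. word_class E (u @ v)),
      one = word_class E []\<rparr>"

definition presented_gen :: "('x word \<times> 'x word) set \<Rightarrow> 'x \<Rightarrow> 'x word set" where
  "presented_gen E x = word_class E [(x, True)]"

definition power_word :: "'x \<Rightarrow> int \<Rightarrow> 'x word" where
  "power_word x k = replicate (nat \<bar>k\<bar>) (x, k \<ge> 0)"

lemma word_class_eq_iff: "word_class E u = word_class E v \<longleftrightarrow> pres_eq E u v"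
proof
  assume "word_class E u = word_class E v"
  then have "v \<in> word_class E u" by (simp add: word_class_def pres_eq.refl)
  then show "pres_eq E u v" by (simp add: word_class_def)
next
  assume "pres_eq E u v"
  then show "word_class E u = word_class E v"
    unfolding word_class_def by (intro Collect_cong iffI) (metis pres_eq.sym pres_eq.trans)+
qed

lemma presented_group_mult:
  "word_class E u \<otimes>\<^bsub>presented_group E\<^esub> word_class E v = word_class E (u @ v)"
proof -
  have *: "word_class E (u' @ v') = word_class E (u @ v)"
    if "u' \<in> word_class E u" "v' \<in> word_class E v" for u' v'
    unfolding word_class_eq_iff
    by (rule pres_eq.sym, rule pres_eq.append) (use that in \<open>simp_all add: word_class_def\<close>)
  have mem: "w \<in> word_class E w" for w
    by (simp add: word_class_def pres_eq.refl)
  have "(\<Union>u'\<in>word_class E u. \<Union>v'\<in>word_class E v. word_class E (u' @ v')) =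
      (\<Union>u'\<in>word_class E u. \<Union>v'\<in>word_class E v. word_class E (u @ v))"
    by (intro SUP_cong HOL.refl *)
  also have "\<dots> = word_class E (u @ v)" using mem by blast
  finally show ?thesis by (simp add: presented_group_def)
qed

lemma group_presented_group: "group (presented_group E)"
proof (rule groupI)
  let ?inv = "\<lambda>w :: 'a word. rev (map (\<lambda>(x, b). (x, \<not> b)) w)"
  have inv: "pres_eq E (?inv w @ w) []" for w
  proof (induction w)
    case Nil
    show ?case by (simp add: pres_eq.refl)
  next
    case (Cons a w)
    obtain x b where a: "a = (x, b)" by force
    have "pres_eq E ([(x, \<not> b), (x, b)] @ w) ([] @ w)"
      using pres_eq.cancel[of E x "\<not> b"] by (intro pres_eq.append pres_eq.refl) simp
    then have "pres_eq E (?inv w @ [(x, \<not> b), (x, b)] @ w) (?inv w @ w)"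
      by (intro pres_eq.append pres_eq.refl) simp
    then have "pres_eq E (?inv w @ [(x, \<not> b), (x, b)] @ w) []"
      using Cons.IH by (rule pres_eq.trans)
    then show ?case by (simp add: a)
  qed
  fix A
  assume "A \<in> carrier (presented_group E)"
  then obtain u where "A = word_class E u" by (auto simp: presented_group_def)
  then have "word_class E (?inv u) \<otimes>\<^bsub>presented_group E\<^esub> A = \<one>\<^bsub>presented_group E\<^esub>"
    using inv[of u] by (simp add: presented_group_mult word_class_eq_iff)
      (simp add: presented_group_def word_class_eq_iff)
  then show "\<exists>B\<in>carrier (presented_group E). B \<otimes>\<^bsub>presented_group E\<^esub> A = \<one>\<^bsub>presented_group E\<^esub>"
    by (rule bexI) (simp add: presented_group_def)
next
  show "\<one>\<^bsub>presented_group E\<^esub> \<in> carrier (presented_group E)" by (simp add: presented_group_def)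
next
  fix A B assume "A \<in> carrier (presented_group E)" "B \<in> carrier (presented_group E)"
  then obtain u v where "A = word_class E u" "B = word_class E v"
    by (auto simp: presented_group_def)
  then show "A \<otimes>\<^bsub>presented_group E\<^esub> B \<in> carrier (presented_group E)"
    by (simp add: presented_group_mult) (simp add: presented_group_def)
next
  fix A B C
  assume "A \<in> carrier (presented_group E)" "B \<in> carrier (presented_group E)"
    "C \<in> carrier (presented_group E)"
  then obtain u v w where "A = word_class E u" "B = word_class E v" "C = word_class E w"
    by (auto simp: presented_group_def)
  then show "A \<otimes>\<^bsub>presented_group E\<^esub> B \<otimes>\<^bsub>presented_group E\<^esub> C =
      A \<otimes>\<^bsub>presented_group E\<^esub> (B \<otimes>\<^bsub>presented_group E\<^esub> C)"
    by (simp add: presented_group_mult)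
next
  fix A assume "A \<in> carrier (presented_group E)"
  then obtain u where "A = word_class E u" by (auto simp: presented_group_def)
  moreover have "\<one>\<^bsub>presented_group E\<^esub> = word_class E []" by (simp add: presented_group_def)
  ultimately show "\<one>\<^bsub>presented_group E\<^esub> \<otimes>\<^bsub>presented_group E\<^esub> A = A"
    by (simp add: presented_group_mult)
qed


section \<open>Representation varieties\<close>

definition SL2C :: "(complex^2^2) monoid" where
  "SL2C = \<lparr>carrier = {A. det A = 1}, monoid.mult = (**), one = mat 1\<rparr>"

text \<open>For generators \<open>x\<close> of \<open>G\<close>, indexed by the finite type \<^typ>\<open>'n\<close>, a homomorphism \<open>\<rho>\<close> is
  identified with the tuple of the matrices \<open>\<rho> (x k)\<close>, hence with a point of affine space whose
  coordinates \<open>(k, i, j)\<close> are the entries of these matrices.\<close>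

definition tuple_coords :: "('n::finite \<Rightarrow> complex^2^2) \<Rightarrow> complex^('n \<times> 2 \<times> 2)" where
  "tuple_coords A = vec_lambda (\<lambda>(k, i, j). A k $ i $ j)"

definition rep_variety ::
    "('g, 'b) monoid_scheme \<Rightarrow> ('n::finite \<Rightarrow> 'g) \<Rightarrow> (complex^('n \<times> 2 \<times> 2)) set" where
  "rep_variety G x = (\<lambda>\<rho>. tuple_coords (\<lambda>k. \<rho> (x k))) ` hom G SL2C"


section \<open>The groups \<open>G\<^sub>p\<^sub>q\<^sub>t\<close>\<close>

definition Gpqt_relations :: "int \<Rightarrow> int \<Rightarrow> int \<Rightarrow> (3 word \<times> 3 word) set" where
  "Gpqt_relations p q t = {(power_word 1 p @ power_word 2 q, power_word 3 t)}"

definition Gpqt :: "int \<Rightarrow> int \<Rightarrow> int \<Rightarrow> 3 word set monoid" where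
  "Gpqt p q t = presented_group (Gpqt_relations p q t)"

definition R_Gpqt :: "int \<Rightarrow> int \<Rightarrow> int \<Rightarrow> (complex^(3 \<times> 2 \<times> 2)) set" where
  "R_Gpqt p q t = rep_variety (Gpqt p q t) (presented_gen (Gpqt_relations p q t))"

text \<open>Concretely, \<open>R_Gpqt p q t\<close> consists of the triples of matrices in \<open>SL2C\<close> satisfying
  the defining relation.\<close>

lemma group_SL2C: "group SL2C"
proof (rule groupI)
  fix A assume "A \<in> carrier SL2C"
  then have A: "det A = 1" by (simp add: SL2C_def)
  then have "invertible A" by (simp add: invertible_det_nz)
  then obtain B where B: "B ** A = mat 1" unfolding invertible_def by blast
  then have "det B * det A = 1" by (metis det_mul det_I)
  then have "det B = 1" using A by simp
  then show "\<exists>B\<in>carrier SL2C. B \<otimes>\<^bsub>SL2C\<^esub> A = \<one>\<^bsub>SL2C\<^esub>"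
    using B by (intro bexI[of _ B]) (simp_all add: SL2C_def)
qed (simp_all add: SL2C_def det_mul matrix_mul_assoc)

definition word_eval :: "('g, 'b) monoid_scheme \<Rightarrow> ('x \<Rightarrow> 'g) \<Rightarrow> 'x word \<Rightarrow> 'g" where
  "word_eval H a w =
     foldr (\<lambda>(x, b) h. (if b then a x else inv\<^bsub>H\<^esub> (a x)) \<otimes>\<^bsub>H\<^esub> h) w \<one>\<^bsub>H\<^esub>"

lemma word_eval_Nil [simp]: "word_eval H a [] = \<one>\<^bsub>H\<^esub>"
  by (simp add: word_eval_def)

lemma word_eval_Cons [simp]:
  "word_eval H a ((x, b) # w) = (if b then a x else inv\<^bsub>H\<^esub> (a x)) \<otimes>\<^bsub>H\<^esub> word_eval H a w"
  by (simp add: word_eval_def)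

context group
begin

lemma word_eval_closed: "range a \<subseteq> carrier G \<Longrightarrow> word_eval G a w \<in> carrier G"
proof (induction w)
  case (Cons c w)
  moreover have "a x \<in> carrier G" for x using Cons.prems by blast
  ultimately show ?case by (cases c) auto
qed simp

lemma word_eval_append:
  assumes "range a \<subseteq> carrier G"
  shows "word_eval G a (u @ v) = word_eval G a u \<otimes> word_eval G a v"
proof (induction u)
  case (Cons c u)
  have "a x \<in> carrier G" for x using assms by blast
  with Cons show ?case
    by (cases c) (auto simp: m_assoc word_eval_closed[OF assms])
qed (simp add: word_eval_closed[OF assms])

lemma word_eval_pres_eq:
  assumes "range a \<subseteq> carrier G" "\<forall>(u, v)\<in>E. word_eval G a u = word_eval G a v"
    and "pres_eq E u v"
  shows "word_eval G a u = word_eval G a v"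
  using assms(3)
proof (induction rule: pres_eq.induct)
  case (cancel x b)
  have "a x \<in> carrier G" using assms(1) by blast
  then show ?case by simp
qed (use assms(2) in \<open>auto simp: word_eval_append[OF assms(1)]\<close>)

lemma word_eval_power_word:
  assumes "range a \<subseteq> carrier G"
  shows "word_eval G a (power_word x k) = a x [^] k"
proof -
  have a: "a x \<in> carrier G" using assms by blast
  have *: "word_eval G a (replicate n (x, b)) = (if b then a x else inv (a x)) [^] n" for n b
  proof (induction n)
    case (Suc n)
    have "(if b then a x else inv (a x)) \<in> carrier G" using a by simp
    from nat_pow_Suc2[OF this] Suc show ?case by (simp only: replicate.simps word_eval_Cons)
  qed simp
  show ?thesis
  proof (cases "k \<ge> 0")
    case True
    then have "power_word x k = replicate (nat k) (x, True)" by (simp add: power_word_def)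
    then have "word_eval G a (power_word x k) = a x [^] nat k" by (simp only: * if_True)
    moreover have "a x [^] k = a x [^] nat k"
      using True by (simp only: int_pow_def2[of G "a x" k] if_False not_less[symmetric])
    ultimately show ?thesis by (rule HOL.trans[OF _ HOL.sym])
  next
    case False
    then have "power_word x k = replicate (nat (- k)) (x, False)" by (simp add: power_word_def)
    then have "word_eval G a (power_word x k) = inv (a x) [^] nat (- k)" by (simp only: * if_False)
    also have "\<dots> = inv (a x [^] nat (- k))" by (rule nat_pow_inv[OF a])
    also have "\<dots> = a x [^] k"
      using False by (simp only: int_pow_def2[of G "a x" k] if_P not_le)
    finally show ?thesis .
  qed
qed

lemma hom_presented_group:
  assumes "\<rho> \<in> hom (presented_group E) G"
  shows "\<rho> (word_class E w) = word_eval G (\<lambda>x. \<rho> (presented_gen E x)) w"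
proof -
  interpret P: group "presented_group E" by (rule group_presented_group)
  interpret \<rho>: group_hom "presented_group E" G \<rho>
    using assms by unfold_locales
  have mem: "word_class E u \<in> carrier (presented_group E)" for u
    by (simp add: presented_group_def)
  have one: "\<one>\<^bsub>presented_group E\<^esub> = word_class E []" by (simp add: presented_group_def)
  have app: "\<rho> (word_class E (u @ v)) = \<rho> (word_class E u) \<otimes> \<rho> (word_class E v)" for u v
    using \<rho>.hom_mult[OF mem mem] by (simp add: presented_group_mult)
  have inv: "\<rho> (word_class E [(x, False)]) = inv (\<rho> (word_class E [(x, True)]))" for x
  proof -
    have "\<rho> (word_class E [(x, False)]) \<otimes> \<rho> (word_class E [(x, True)]) = \<rho> (word_class E [])"
      using pres_eq.cancel[of E x False] by (simp add: app[symmetric] word_class_eq_iff[symmetric])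
    then have "\<rho> (word_class E [(x, False)]) \<otimes> \<rho> (word_class E [(x, True)]) = \<one>"
      using \<rho>.hom_one by (simp add: one)
    then show ?thesis using inv_equality \<rho>.hom_closed[OF mem] by metis
  qed
  show ?thesis
  proof (induction w)
    case Nil
    show ?case using \<rho>.hom_one by (simp add: one)
  next
    case (Cons c w)
    show ?case
    proof (cases c)
      case (Pair x b)
      then show ?thesis
        using app[of "[c]" w] Cons.IH by (cases b) (simp_all add: presented_gen_def inv)
    qed
  qed
qed

lemma presented_group_hom_exists:
  assumes "range a \<subseteq> carrier G" "\<forall>(u, v)\<in>E. word_eval G a u = word_eval G a v"
  obtains \<rho> where "\<rho> \<in> hom (presented_group E) G" "\<And>x. \<rho> (presented_gen E x) = a x"
proof -
  define \<rho> where "\<rho> A = word_eval G a (SOME u. A = word_class E u)" for A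
  have \<rho>: "\<rho> (word_class E u) = word_eval G a u" for u
  proof -
    have "word_class E u = word_class E (SOME v. word_class E u = word_class E v)"
      by (rule someI) (rule HOL.refl)
    then have "pres_eq E u (SOME v. word_class E u = word_class E v)"
      by (simp only: word_class_eq_iff)
    then show ?thesis unfolding \<rho>_def using word_eval_pres_eq[OF assms] by metis
  qed
  have "\<rho> \<in> hom (presented_group E) G"
  proof (rule homI)
    fix A assume "A \<in> carrier (presented_group E)"
    then obtain u where "A = word_class E u" by (auto simp: presented_group_def)
    then show "\<rho> A \<in> carrier G" by (simp add: \<rho> word_eval_closed[OF assms(1)])
  next
    fix A B assume "A \<in> carrier (presented_group E)" "B \<in> carrier (presented_group E)"
    then obtain u v where "A = word_class E u" "B = word_class E v"
      by (auto simp: presented_group_def)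
    then show "\<rho> (A \<otimes>\<^bsub>presented_group E\<^esub> B) = \<rho> A \<otimes> \<rho> B"
      by (simp add: presented_group_mult \<rho> word_eval_append[OF assms(1)])
  qed
  moreover have "\<rho> (presented_gen E x) = a x" for x
  proof -
    have "a x \<in> carrier G" using assms(1) by blast
    then show ?thesis by (simp add: presented_gen_def \<rho>)
  qed
  ultimately show ?thesis using that by blast
qed

end

lemma rep_variety_presented_group:
  "rep_variety (presented_group E) (presented_gen E) =
     tuple_coords ` {A. range A \<subseteq> carrier SL2C \<and>
       (\<forall>(u, v)\<in>E. word_eval SL2C A u = word_eval SL2C A v)}"
proof -
  interpret group SL2C by (rule group_SL2C)
  have sat: "(\<lambda>k. \<rho> (presented_gen E k)) \<in> {A. range A \<subseteq> carrier SL2C \<and>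
       (\<forall>(u, v)\<in>E. word_eval SL2C A u = word_eval SL2C A v)}"
    if \<rho>: "\<rho> \<in> hom (presented_group E) SL2C" for \<rho>
  proof -
    have "\<rho> (presented_gen E k) \<in> carrier SL2C" for k
      by (rule hom_in_carrier[OF \<rho>]) (simp add: presented_gen_def presented_group_def)
    moreover have "word_class E u = word_class E v" if "(u, v) \<in> E" for u v
      using that by (simp add: word_class_eq_iff pres_eq.relation)
    ultimately show ?thesis by (auto simp: hom_presented_group[OF \<rho>, symmetric])
  qed
  have ex: "\<exists>\<rho>\<in>hom (presented_group E) SL2C. A = (\<lambda>k. \<rho> (presented_gen E k))"
    if "range A \<subseteq> carrier SL2C" "\<forall>(u, v)\<in>E. word_eval SL2C A u = word_eval SL2C A v" for A
    using presented_group_hom_exists[OF that] by metis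
  have "(\<lambda>\<rho> k. \<rho> (presented_gen E k)) ` hom (presented_group E) SL2C =
      {A. range A \<subseteq> carrier SL2C \<and> (\<forall>(u, v)\<in>E. word_eval SL2C A u = word_eval SL2C A v)}"
    (is "_ = ?C")
  proof (intro equalityI image_subsetI subsetI)
    fix A assume "A \<in> ?C"
    then obtain \<rho> where "\<rho> \<in> hom (presented_group E) SL2C" "A = (\<lambda>k. \<rho> (presented_gen E k))"
      using ex unfolding mem_Collect_eq by metis
    then show "A \<in> (\<lambda>\<rho> k. \<rho> (presented_gen E k)) ` hom (presented_group E) SL2C"
      by (intro image_eqI)
  qed (rule sat)
  from arg_cong[OF this, of "image tuple_coords"] show ?thesis
    by (simp only: rep_variety_def image_image)
qed

lemma R_Gpqt_eq:
  "R_Gpqt p q t = tuple_coords ` {A. (\<forall>k. det (A k) = 1) \<and>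
     (A 1 [^]\<^bsub>SL2C\<^esub> p) ** (A 2 [^]\<^bsub>SL2C\<^esub> q) = A 3 [^]\<^bsub>SL2C\<^esub> t}"
proof -
  interpret group SL2C by (rule group_SL2C)
  have "(range A \<subseteq> carrier SL2C \<and>
       (\<forall>(u, v)\<in>Gpqt_relations p q t. word_eval SL2C A u = word_eval SL2C A v)) \<longleftrightarrow>
     ((\<forall>k. det (A k) = 1) \<and>
     (A 1 [^]\<^bsub>SL2C\<^esub> p) ** (A 2 [^]\<^bsub>SL2C\<^esub> q) = A 3 [^]\<^bsub>SL2C\<^esub> t)" for A
  proof -
    have "range A \<subseteq> carrier SL2C \<longleftrightarrow> (\<forall>k. det (A k) = 1)" by (auto simp: SL2C_def)
    moreover have "x \<otimes>\<^bsub>SL2C\<^esub> y = x ** y" for x y by (simp add: SL2C_def)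
    ultimately show ?thesis
      by (auto simp: Gpqt_relations_def word_eval_append word_eval_power_word)
  qed
  then show ?thesis
    by (simp add: R_Gpqt_def Gpqt_def rep_variety_presented_group)
qed

end

theory Submission
  imports Defs "HOL-Complex_Analysis.Conformal_Mappings" "HOL-Algebra.Elementary_Groups"
begin

text \<open>Put \<open>P = \<bar>p\<bar>\<close>, \<open>Q = \<bar>q\<bar>\<close>, \<open>T = t\<close>. A representation is a triple of matrices \<open>A, B, C\<close> of
  determinant 1 with \<open>B\<^sup>Q A\<^sup>P C\<^sup>T = 1\<close>, so any one of the three powers is a polynomial in the other two
  matrices. By Cayley--Hamilton \<open>X\<^sup>n = u\<^sub>n(tr X) X - u\<^sub>n\<^sub>-\<^sub>1(tr X)\<close> with Chebyshev polynomials \<open>u\<^sub>n\<close>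
  (\<open>cheb\<close>). Hence where \<open>u\<^sub>P(tr A) \<noteq> 0\<close> the matrix \<open>A\<close> is determined by \<open>B\<close> and \<open>C\<close> up to
  finitely many choices of its trace, and there are only 6 degrees of freedom; the same holds
  for \<open>B\<close> and \<open>C\<close>. Where all three Chebyshev values vanish, each matrix lies in one of
  finitely many conjugacy classes, and each of the three classes has dimension 2: again 6.

  To turn this count into a bound on Krull dimension, say that functions on a set have growth \<open>k\<close>
  if the polynomials of degree at most \<open>d\<close> in them are spanned by \<open>O(d\<^sup>k)\<close> functions. Growth
  goes up by one when a function is adjoined freely and is unchanged when an integral element or
  the inverse of a nowhere vanishing element is adjoined, so the representation variety has growth
  6 (\<open>growth_relation_set\<close>). A chain of irreducible closed sets of length \<open>n\<close> yields \<open>n\<close>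
  algebraically independent polynomials on its top member (\<open>chain_top_alg_indep\<close>), which growth 6
  allows only for \<open>n \<le> 6\<close> (\<open>growth_alg_indep_length\<close>).

  Chains of length 6 come from parametrizations by polydiscs. The Zariski closure of the image of
  a holomorphic map is irreducible by the identity theorem on complex lines, and switching on the
  parameters one at a time gives a chain (\<open>chain_top_parametrization\<close>). If one of \<open>P, Q, T\<close>
  exceeds 2, then three non-central conjugacy classes on which the powers are \<open>\<plusminus> 1\<close> with product
  1 can be parametrized (\<open>chain_top_proper\<close>). The top of this chain misses the trivial
  representation, so an irreducible variety would extend it to a chain of length 7; this is the
  reducibility statement. For \<open>P = Q = T = 2\<close> the variety is parametrized near the trivial
  representation by \<open>A\<close>, \<open>B\<close> and a square root (\<open>chain_top_trivial_component\<close>).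

  For the infinite family take the triples \<open>(-n, -n, n)\<close>. The number of tops of 6-chains, that is,
  of components of dimension 6, is an isomorphism invariant. It is finite
  (\<open>finite_chain_tops\<close>) and, since the trace of \<open>A\<close> takes more and more values on
  products of classes, unbounded as \<open>n\<close> grows (\<open>card_chain_tops_unbounded\<close>); so infinitely
  many \<open>n\<close> have pairwise different invariants. The groups themselves are told apart by the number
  of their homomorphisms to finite cyclic groups (\<open>Gpqt_not_iso\<close>).\<close>

section \<open>Growth of rings of functions\<close>

inductive poly_deg_le :: "('a \<Rightarrow> complex) set \<Rightarrow> nat \<Rightarrow> ('a \<Rightarrow> complex) \<Rightarrow> bool" for F where
  const: "poly_deg_le F d (\<lambda>x. c)"
| gen: "f \<in> F \<Longrightarrow> poly_deg_le F (Suc d) f"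
| add: "poly_deg_le F d f \<Longrightarrow> poly_deg_le F d g \<Longrightarrow> poly_deg_le F d (\<lambda>x. f x + g x)"
| mult: "poly_deg_le F d f \<Longrightarrow> poly_deg_le F e g \<Longrightarrow> poly_deg_le F (d + e) (\<lambda>x. f x * g x)"

lemma poly_deg_le_mono:
  assumes "poly_deg_le F d f" "d \<le> e" "F \<subseteq> G"
  shows "poly_deg_le G e f"
  using assms
proof (induction arbitrary: e)
  case (gen f d)
  then obtain e' where "e = Suc e'" by (cases e) auto
  then show ?case using gen by (auto intro: poly_deg_le.gen)
next
  case (mult d f d' g)
  have "poly_deg_le G d f" "poly_deg_le G (e - d) g" using mult by auto
  then have "poly_deg_le G (d + (e - d)) (\<lambda>x. f x * g x)" by (rule poly_deg_le.mult)
  then show ?case using mult.prems by simp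
qed (auto intro: poly_deg_le.intros)

lemma poly_deg_le_sum:
  assumes "\<And>i. i \<in> I \<Longrightarrow> poly_deg_le F d (f i)"
  shows "poly_deg_le F d (\<lambda>x. \<Sum>i\<in>I. f i x)"
  using assms by (induction I rule: infinite_finite_induct) (auto intro: poly_deg_le.const poly_deg_le.add)

lemma poly_deg_le_power: "poly_deg_le F d f \<Longrightarrow> poly_deg_le F (n * d) (\<lambda>x. f x ^ n)"
  by (induction n) (auto intro: poly_deg_le.const poly_deg_le.mult)

lemma poly_deg_le_diff:
  assumes "poly_deg_le F d f" "poly_deg_le F d g"
  shows "poly_deg_le F d (\<lambda>x. f x - g x)"
proof -
  have "poly_deg_le F (0 + d) (\<lambda>x. -1 * g x)"
    by (intro poly_deg_le.mult poly_deg_le.const assms)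
  from poly_deg_le.add[OF assms(1)] this show ?thesis by fastforce
qed

lemma poly_deg_le_poly:
  assumes "poly_deg_le F d f"
  shows "poly_deg_le F (degree p * d) (\<lambda>x. poly p (f x))"
  unfolding poly_altdef
proof (rule poly_deg_le_sum)
  fix i assume i: "i \<in> {..degree p}"
  have "poly_deg_le F (0 + i * d) (\<lambda>x. coeff p i * f x ^ i)"
    by (intro poly_deg_le.mult poly_deg_le.const poly_deg_le_power assms)
  then show "poly_deg_le F (degree p * d) (\<lambda>x. coeff p i * f x ^ i)"
    using i by (auto elim!: poly_deg_le_mono)
qed

text \<open>The coefficient functions are kept below the same degree bound and vanish beyond it, so that
  Cauchy products can be formed.\<close>

lemma poly_deg_le_insert_expand:
  assumes "poly_deg_le (insert g F) d f"
  shows "\<exists>h. (\<forall>j. poly_deg_le F d (h j)) \<and> (\<forall>j>d. h j = (\<lambda>x. 0)) \<and>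
    (\<forall>x. f x = (\<Sum>j\<le>d. h j x * g x ^ j))"
  using assms
proof induction
  case (const d c)
  have "(\<Sum>j\<le>d. (if j = 0 then (\<lambda>x. c) else (\<lambda>x. 0)) x * g x ^ j) = c" for x
    by (subst sum.remove[of _ 0]) auto
  then show ?case
    by (intro exI[of _ "\<lambda>j. if j = 0 then (\<lambda>x. c) else (\<lambda>x. 0)"]) (auto intro: poly_deg_le.const)
next
  case (gen f d)
  show ?case
  proof (cases "f = g")
    case True
    have "(\<Sum>j\<le>Suc d. (if j = 1 then (\<lambda>x. 1) else (\<lambda>x. 0)) x * g x ^ j) = g x" for x
      by (subst sum.remove[of _ 1]) auto
    then show ?thesis using True
      by (intro exI[of _ "\<lambda>j. if j = 1 then (\<lambda>x. 1) else (\<lambda>x. 0)"]) (auto intro: poly_deg_le.const)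
  next
    case False
    have "(\<Sum>j\<le>Suc d. (if j = 0 then f else (\<lambda>x. 0)) x * g x ^ j) = f x" for x
      by (subst sum.remove[of _ 0]) auto
    then show ?thesis using False gen
      by (intro exI[of _ "\<lambda>j. if j = 0 then f else (\<lambda>x. 0)"])
        (auto intro: poly_deg_le.const poly_deg_le.gen)
  qed
next
  case (add d f f')
  then obtain h h' where "\<forall>j. poly_deg_le F d (h j)" "\<forall>j>d. h j = (\<lambda>x. 0)"
      "\<forall>x. f x = (\<Sum>j\<le>d. h j x * g x ^ j)" "\<forall>j. poly_deg_le F d (h' j)" "\<forall>j>d. h' j = (\<lambda>x. 0)"
      "\<forall>x. f' x = (\<Sum>j\<le>d. h' j x * g x ^ j)"
    by blast
  then show ?case
    by (intro exI[of _ "\<lambda>j x. h j x + h' j x"])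
      (auto simp: sum.distrib algebra_simps intro: poly_deg_le.add)
next
  case (mult d f e f')
  then obtain h h' where h: "\<forall>j. poly_deg_le F d (h j)" "\<forall>j>d. h j = (\<lambda>x. 0)"
      "\<forall>x. f x = (\<Sum>j\<le>d. h j x * g x ^ j)" "\<forall>j. poly_deg_le F e (h' j)" "\<forall>j>e. h' j = (\<lambda>x. 0)"
      "\<forall>x. f' x = (\<Sum>j\<le>e. h' j x * g x ^ j)"
    by blast
  have "f x * f' x = (\<Sum>r\<le>d+e. (\<Sum>k\<le>r. h k x * h' (r - k) x) * g x ^ r)" for x
    unfolding h(3)[rule_format] h(6)[rule_format]
    by (rule polynomial_product) (use h(2,5) in auto)
  moreover have "(\<lambda>x. \<Sum>k\<le>r. h k x * h' (r - k) x) = (\<lambda>x. 0)" if "r > d + e" for r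
  proof (rule ext, rule sum.neutral, rule ballI)
    fix x k assume "k \<in> {..r}"
    show "h k x * h' (r - k) x = 0"
    proof (cases "k > d")
      case False
      then have "r - k > e" using that by linarith
      then show ?thesis using h(5) by simp
    qed (use h(2) in simp)
  qed
  moreover have "poly_deg_le F (d + e) (\<lambda>x. \<Sum>k\<le>r. h k x * h' (r - k) x)" for r
    by (intro poly_deg_le_sum poly_deg_le.mult) (use h in auto)
  ultimately show ?case
    by (intro exI[of _ "\<lambda>r x. \<Sum>k\<le>r. h k x * h' (r - k) x"]) blast
qed

definition spanned_on :: "'a set \<Rightarrow> ('a \<Rightarrow> complex) set \<Rightarrow> ('a \<Rightarrow> complex) \<Rightarrow> bool" where
  "spanned_on V B f \<longleftrightarrow> (\<exists>c. \<forall>x\<in>V. f x = (\<Sum>b\<in>B. c b * b x))"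

text \<open>The image in the functions on \<open>V\<close> of the polynomials of degree at most \<open>d\<close> in \<open>F\<close> has
  dimension \<open>O(d\<^sup>k)\<close>. Spanning sets replace dimensions, and they may consist of arbitrary functions;
  this is what makes growth behave well under unions of point sets.\<close>

definition growth :: "'a set \<Rightarrow> ('a \<Rightarrow> complex) set \<Rightarrow> nat \<Rightarrow> bool" where
  "growth V F k \<longleftrightarrow> (\<exists>K. \<forall>d. \<exists>B. finite B \<and> card B \<le> K * (d + 1) ^ k \<and>
     (\<forall>f. poly_deg_le F d f \<longrightarrow> spanned_on V B f))"

lemma spanned_on_image:
  assumes "finite I" "\<And>x. x \<in> V \<Longrightarrow> f x = (\<Sum>i\<in>I. c i * b i x)"
  shows "spanned_on V (b ` I) f"
proof -
  have "f x = (\<Sum>v\<in>b ` I. (\<Sum>i | i \<in> I \<and> b i = v. c i) * v x)" if "x \<in> V" for x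
  proof -
    have "f x = (\<Sum>i\<in>I. c i * b i x)" by (rule assms(2)[OF that])
    also have "\<dots> = (\<Sum>v\<in>b ` I. \<Sum>i | i \<in> I \<and> b i = v. c i * b i x)"
      using assms(1) by (rule sum.image_gen)
    also have "\<dots> = (\<Sum>v\<in>b ` I. (\<Sum>i | i \<in> I \<and> b i = v. c i) * v x)"
      by (intro sum.cong HOL.refl) (auto simp: sum_distrib_right)
    finally show ?thesis .
  qed
  then show ?thesis
    unfolding spanned_on_def
    by (intro exI[of _ "\<lambda>v. \<Sum>i | i \<in> I \<and> b i = v. c i"] ballI)
qed

lemma spanned_on_subset: "spanned_on V B f \<Longrightarrow> W \<subseteq> V \<Longrightarrow> spanned_on W B f"
  unfolding spanned_on_def by blast

lemma spanned_on_combination: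
  assumes "finite B" "finite J" "\<And>j. j \<in> J \<Longrightarrow> spanned_on V B (h j)"
    and "\<And>x. x \<in> V \<Longrightarrow> f x = (\<Sum>j\<in>J. h j x * m j x)"
  shows "spanned_on V ((\<lambda>(b, j) x. b x * m j x) ` (B \<times> J)) f"
proof -
  obtain c where c: "\<And>j x. j \<in> J \<Longrightarrow> x \<in> V \<Longrightarrow> h j x = (\<Sum>b\<in>B. c j b * b x)"
    using assms(3) unfolding spanned_on_def by metis
  have "f x = (\<Sum>i\<in>B \<times> J. (case i of (b, j) \<Rightarrow> c j b) * (case i of (b, j) \<Rightarrow> \<lambda>x. b x * m j x) x)"
    if x: "x \<in> V" for x
  proof -
    have "f x = (\<Sum>j\<in>J. \<Sum>b\<in>B. c j b * (b x * m j x))"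
      unfolding assms(4)[OF x]
      by (intro sum.cong HOL.refl) (use c x in \<open>simp add: sum_distrib_right mult.assoc\<close>)
    also have "\<dots> = (\<Sum>b\<in>B. \<Sum>j\<in>J. c j b * (b x * m j x))" by (rule sum.swap)
    also have "\<dots> = (\<Sum>(b, j)\<in>B \<times> J. c j b * (b x * m j x))" by (rule sum.cartesian_product)
    finally show ?thesis by (simp add: case_prod_unfold)
  qed
  then show ?thesis by (intro spanned_on_image) (use assms in auto)
qed

text \<open>The common pattern of all adjunctions: a polynomial of degree \<open>d\<close> in the new generators \<open>F'\<close>
  is a combination of few fixed functions \<open>m d j\<close>, with coefficients of degree \<open>O(d)\<close> in the old
  generators \<open>F\<close>. The number of the functions \<open>m d j\<close> decides how much the exponent grows.\<close>

lemma growth_step: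
  assumes "growth V F k"
    and "\<And>d. finite (J d)" "\<And>d. card (J d) \<le> M * (d + 1) ^ l"
    and "\<And>d f. poly_deg_le F' d f \<Longrightarrow>
      \<exists>h. (\<forall>j\<in>J d. poly_deg_le F (e * d) (h j)) \<and> (\<forall>x\<in>V. f x = (\<Sum>j\<in>J d. h j x * m d j x))"
  shows "growth V F' (k + l)"
proof -
  obtain K where K: "\<forall>d. \<exists>B. finite B \<and> card B \<le> K * (d + 1) ^ k \<and>
     (\<forall>f. poly_deg_le F d f \<longrightarrow> spanned_on V B f)"
    using assms(1) unfolding growth_def by blast
  show ?thesis unfolding growth_def
  proof (intro exI[of _ "K * (e + 1) ^ k * M"] allI)
    fix d
    obtain B where B: "finite B" "card B \<le> K * (e * d + 1) ^ k"
        "\<And>f. poly_deg_le F (e * d) f \<Longrightarrow> spanned_on V B f"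
      using K by blast
    let ?B = "(\<lambda>(b, j) x. b x * m d j x) ` (B \<times> J d)"
    have "card ?B \<le> card (B \<times> J d)" by (rule card_image_le) (use B assms in auto)
    also have "\<dots> \<le> (K * (e * d + 1) ^ k) * (M * (d + 1) ^ l)"
      unfolding card_cartesian_product by (intro mult_le_mono B assms)
    also have "\<dots> \<le> (K * ((e + 1) * (d + 1)) ^ k) * (M * (d + 1) ^ l)"
      by (intro mult_le_mono power_mono) auto
    also have "\<dots> = K * (e + 1) ^ k * M * (d + 1) ^ (k + l)"
      by (simp only: power_mult_distrib power_add mult_ac)
    finally have card: "card ?B \<le> K * (e + 1) ^ k * M * (d + 1) ^ (k + l)" .
    have "spanned_on V ?B f" if "poly_deg_le F' d f" for f
    proof -
      obtain h where h: "\<forall>j\<in>J d. poly_deg_le F (e * d) (h j)"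
          "\<forall>x\<in>V. f x = (\<Sum>j\<in>J d. h j x * m d j x)"
        using assms(4)[OF \<open>poly_deg_le F' d f\<close>] by blast
      show ?thesis
        by (rule spanned_on_combination[where h = h]) (use B assms(2) h in auto)
    qed
    then show "\<exists>B. finite B \<and> card B \<le> K * (e + 1) ^ k * M * (d + 1) ^ (k + l) \<and>
        (\<forall>f. poly_deg_le F' d f \<longrightarrow> spanned_on V B f)"
      using card B assms(2) by (intro exI[of _ ?B]) auto
  qed
qed

lemma growth_empty: "growth V {} 0"
proof -
  have "\<exists>c. \<forall>x. f x = c" if "poly_deg_le {} d f" for f :: "'a \<Rightarrow> complex" and d
    using that
  proof induction
    case (add d f g)
    then obtain a b where "\<forall>x. f x = a" "\<forall>x. g x = b" by blast
    then show ?case by auto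
  next
    case (mult d f e g)
    then obtain a b where "\<forall>x. f x = a" "\<forall>x. g x = b" by blast
    then show ?case by auto
  qed auto
  then have "spanned_on V {\<lambda>x. 1} f" if "poly_deg_le {} d f" for f :: "'a \<Rightarrow> complex" and d
    using that unfolding spanned_on_def by fastforce
  then show ?thesis
    unfolding growth_def by (intro exI[of _ 1] allI exI[of _ "{\<lambda>x. 1}"]) auto
qed

lemma growth_mono:
  assumes "growth V F k" "W \<subseteq> V" "F' \<subseteq> F" "k \<le> l"
  shows "growth W F' l"
proof -
  obtain K where K: "\<forall>d. \<exists>B. finite B \<and> card B \<le> K * (d + 1) ^ k \<and>
     (\<forall>f. poly_deg_le F d f \<longrightarrow> spanned_on V B f)"
    using assms(1) unfolding growth_def by blast
  show ?thesis unfolding growth_def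
  proof (intro exI[of _ K] allI)
    fix d
    obtain B where B: "finite B" "card B \<le> K * (d + 1) ^ k"
        "\<And>f. poly_deg_le F d f \<Longrightarrow> spanned_on V B f"
      using K by blast
    have "(d + 1) ^ k \<le> (d + 1) ^ l" using assms by (intro power_increasing) auto
    then have "card B \<le> K * (d + 1) ^ l" using B(2) by (meson le_trans mult_le_mono2)
    then show "\<exists>B. finite B \<and> card B \<le> K * (d + 1) ^ l \<and>
        (\<forall>f. poly_deg_le F' d f \<longrightarrow> spanned_on W B f)"
      using B assms by (meson spanned_on_subset poly_deg_le_mono order_refl)
  qed
qed

lemma growth_insert_free:
  assumes "growth V F k"
  shows "growth V (insert g F) (Suc k)"
proof -
  have "growth V (insert g F) (k + 1)"
  proof (rule growth_step[where J = "\<lambda>d. {..d}" and e = 1 and M = 1 and m = "\<lambda>d j x. g x ^ j"])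
    fix d f assume "poly_deg_le (insert g F) d f"
    from poly_deg_le_insert_expand[OF this]
    show "\<exists>h. (\<forall>j\<in>{..d}. poly_deg_le F (1 * d) (h j)) \<and>
        (\<forall>x\<in>V. f x = (\<Sum>j\<in>{..d}. h j x * g x ^ j))"
      by auto
  qed (use assms in auto)
  then show ?thesis by simp
qed

text \<open>Multiplying by \<open>h\<^sup>d\<close> clears the denominators of a polynomial of degree \<open>d\<close> in \<open>y = 1/h\<close>.\<close>

lemma growth_insert_inverse:
  assumes "growth V F k" "poly_deg_le F e h" "\<And>x. x \<in> V \<Longrightarrow> h x * y x = 1"
  shows "growth V (insert y F) k"
proof -
  have "growth V (insert y F) (k + 0)"
  proof (rule growth_step[where J = "\<lambda>d. {0::nat}" and e = "e + 1" and M = 1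
        and m = "\<lambda>d j x. y x ^ d"])
    fix d f assume "poly_deg_le (insert y F) d f"
    from poly_deg_le_insert_expand[OF this] obtain u where u: "\<forall>j. poly_deg_le F d (u j)"
        "\<forall>x. f x = (\<Sum>j\<le>d. u j x * y x ^ j)"
      by blast
    define v where "v x = (\<Sum>j\<le>d. u j x * h x ^ (d - j))" for x
    have "poly_deg_le F ((e + 1) * d) v" unfolding v_def
    proof (rule poly_deg_le_sum)
      fix j assume "j \<in> {..d}"
      have "d + (d - j) * e \<le> d + d * e" by (intro add_left_mono mult_le_mono1) auto
      then have "d + (d - j) * e \<le> (e + 1) * d" by (simp add: mult.commute)
      moreover have "poly_deg_le F (d + (d - j) * e) (\<lambda>x. u j x * h x ^ (d - j))"
        by (intro poly_deg_le.mult poly_deg_le_power assms) (use u in auto)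
      ultimately show "poly_deg_le F ((e + 1) * d) (\<lambda>x. u j x * h x ^ (d - j))"
        by (metis poly_deg_le_mono order_refl)
    qed
    moreover have "f x = v x * y x ^ d" if "x \<in> V" for x
    proof -
      have eq: "u j x * y x ^ j = u j x * h x ^ (d - j) * y x ^ d" if "j \<le> d" for j
      proof -
        have "y x ^ d = y x ^ (d - j) * y x ^ j"
          using that by (simp add: power_add[symmetric])
        then have "h x ^ (d - j) * y x ^ d = (h x * y x) ^ (d - j) * y x ^ j"
          by (simp add: power_mult_distrib)
        then show ?thesis using assms(3)[OF \<open>x \<in> V\<close>] by (simp add: mult.assoc)
      qed
      show ?thesis
        unfolding u(2)[rule_format] v_def sum_distrib_right by (intro sum.cong HOL.refl eq) simp
    qed
    ultimately show "\<exists>h. (\<forall>j\<in>{0::nat}. poly_deg_le F ((e + 1) * d) (h j)) \<and>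
        (\<forall>x\<in>V. f x = (\<Sum>j\<in>{0::nat}. h j x * y x ^ d))"
      by (intro exI[of _ "\<lambda>_. v"]) auto
  qed (use assms in auto)
  then show ?thesis by simp
qed

text \<open>All powers of \<open>z\<close> reduce to the first \<open>n\<close> ones, and the degrees of the coefficients grow only
  linearly with the exponent.\<close>

lemma growth_insert_integral:
  assumes "growth V F k" "\<And>j. j < n \<Longrightarrow> poly_deg_le F e (a j)"
    and "\<And>x. x \<in> V \<Longrightarrow> z x ^ n = (\<Sum>j<n. a j x * z x ^ j)"
  shows "growth V (insert z F) k"
proof -
  have red: "\<exists>c. (\<forall>i<n. poly_deg_le F (r * e) (c i)) \<and> (\<forall>x\<in>V. z x ^ r = (\<Sum>i<n. c i x * z x ^ i))"
    for r
  proof (induction r)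
    case 0
    show ?case
    proof (cases n)
      case 0
      then have "V = {}" using assms(3) by auto
      then show ?thesis using 0 by simp
    next
      case (Suc n')
      have "(\<Sum>i<n. (if i = 0 then (\<lambda>x. 1) else (\<lambda>x. 0)) x * z x ^ i) = 1" for x
        unfolding Suc by (subst sum.remove[of _ 0]) auto
      then show ?thesis
        by (intro exI[of _ "\<lambda>i. if i = 0 then (\<lambda>x. 1) else (\<lambda>x. 0)"]) (auto intro: poly_deg_le.const)
    qed
  next
    case (Suc r)
    then obtain c where c: "\<forall>i<n. poly_deg_le F (r * e) (c i)"
        "\<forall>x\<in>V. z x ^ r = (\<Sum>i<n. c i x * z x ^ i)" by blast
    show ?case
    proof (cases n)
      case 0
      then have "V = {}" using assms(3) by auto
      then show ?thesis using 0 by simp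
    next
      case (Suc m)
      define c' where "c' i x = (if i = 0 then 0 else c (i - 1) x) + c m x * a i x" for i x
      have "poly_deg_le F (Suc r * e) (c' i)" if "i < n" for i
      proof -
        have "poly_deg_le F (Suc r * e) (c (i - 1))"
          by (rule poly_deg_le_mono[of _ "r * e"]) (use c that in auto)
        then have "poly_deg_le F (Suc r * e) (\<lambda>x. if i = 0 then 0 else c (i - 1) x)"
          by (cases "i = 0") (auto intro: poly_deg_le.const)
        moreover have "poly_deg_le F (r * e + e) (\<lambda>x. c m x * a i x)"
          by (intro poly_deg_le.mult) (use c assms that Suc in auto)
        ultimately show ?thesis unfolding c'_def by (intro poly_deg_le.add) (auto simp: add.commute)
      qed
      moreover have "z x ^ Suc r = (\<Sum>i<n. c' i x * z x ^ i)" if x: "x \<in> V" for x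
      proof -
        have "z x ^ Suc r = z x * (\<Sum>i<n. c i x * z x ^ i)" using c x by simp
        also have "\<dots> = (\<Sum>i<n. c i x * z x ^ Suc i)"
          by (simp add: sum_distrib_left algebra_simps)
        also have "\<dots> = (\<Sum>i<m. c i x * z x ^ Suc i) + c m x * z x ^ n"
          by (simp add: Suc)
        also have "(\<Sum>i<m. c i x * z x ^ Suc i) = (\<Sum>i<n. (if i = 0 then 0 else c (i - 1) x) * z x ^ i)"
          unfolding Suc by (subst sum.lessThan_Suc_shift) simp
        also have "c m x * z x ^ n = (\<Sum>i<n. c m x * a i x * z x ^ i)"
          by (subst assms(3)[OF x]) (simp add: sum_distrib_left mult.assoc)
        finally show ?thesis by (simp add: c'_def sum.distrib distrib_right)
      qed
      ultimately show ?thesis by (intro exI[of _ c']) auto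
    qed
  qed
  then obtain c where c: "\<And>r i. i < n \<Longrightarrow> poly_deg_le F (r * e) (c r i)"
      "\<And>r x. x \<in> V \<Longrightarrow> z x ^ r = (\<Sum>i<n. c r i x * z x ^ i)" by metis
  have "growth V (insert z F) (k + 0)"
  proof (rule growth_step[where J = "\<lambda>d. {..<n}" and e = "e + 1" and M = n
        and m = "\<lambda>d j x. z x ^ j"])
    fix d f assume "poly_deg_le (insert z F) d f"
    from poly_deg_le_insert_expand[OF this] obtain u where u: "\<forall>j. poly_deg_le F d (u j)"
        "\<forall>x. f x = (\<Sum>j\<le>d. u j x * z x ^ j)"
      by blast
    define v where "v i x = (\<Sum>j\<le>d. u j x * c j i x)" for i x
    have "poly_deg_le F ((e + 1) * d) (v i)" if "i < n" for i unfolding v_def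
    proof (rule poly_deg_le_sum)
      fix j assume "j \<in> {..d}"
      then have "d + j * e \<le> d + d * e" by (intro add_left_mono mult_le_mono1) auto
      then have "d + j * e \<le> (e + 1) * d" by (simp add: mult.commute)
      moreover have "poly_deg_le F (d + j * e) (\<lambda>x. u j x * c j i x)"
        by (intro poly_deg_le.mult c that) (use u in auto)
      ultimately show "poly_deg_le F ((e + 1) * d) (\<lambda>x. u j x * c j i x)"
        by (metis poly_deg_le_mono order_refl)
    qed
    moreover have "f x = (\<Sum>i<n. v i x * z x ^ i)" if "x \<in> V" for x
    proof -
      have "f x = (\<Sum>j\<le>d. \<Sum>i<n. u j x * c j i x * z x ^ i)"
        unfolding u(2)[rule_format]
        by (intro sum.cong HOL.refl, subst c(2)[OF that]) (simp add: sum_distrib_left mult.assoc)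
      also have "\<dots> = (\<Sum>i<n. \<Sum>j\<le>d. u j x * c j i x * z x ^ i)" by (rule sum.swap)
      finally show ?thesis by (simp add: v_def sum_distrib_right)
    qed
    ultimately show "\<exists>h. (\<forall>j\<in>{..<n}. poly_deg_le F ((e + 1) * d) (h j)) \<and>
        (\<forall>x\<in>V. f x = (\<Sum>j\<in>{..<n}. h j x * z x ^ j))"
      by (intro exI[of _ v]) auto
  qed (use assms in auto)
  then show ?thesis by simp
qed

lemma growth_insert_root:
  assumes "growth V F k" "poly_deg_le F e r" "lead_coeff p = 1" "degree p > 0"
    and "\<And>x. x \<in> V \<Longrightarrow> poly p (z x) = r x"
  shows "growth V (insert z F) k"
proof (rule growth_insert_integral[OF assms(1)])
  let ?a = "\<lambda>j x. (if j = 0 then r x else 0) - coeff p j"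
  show "poly_deg_le F e (?a j)" if "j < degree p" for j
    by (cases "j = 0") (auto intro!: poly_deg_le_diff assms poly_deg_le.const)
  fix x assume "x \<in> V"
  have "r x = (\<Sum>j\<le>degree p. coeff p j * z x ^ j)"
    using assms(5)[OF \<open>x \<in> V\<close>] by (simp add: poly_altdef)
  also have "\<dots> = (\<Sum>j<degree p. coeff p j * z x ^ j) + z x ^ degree p"
    using assms(3) by (simp add: lessThan_Suc_atMost[symmetric])
  finally have "z x ^ degree p = r x - (\<Sum>j<degree p. coeff p j * z x ^ j)" by simp
  also have "r x = (\<Sum>j<degree p. (if j = 0 then r x else 0) * z x ^ j)"
    using assms(4) by (subst sum.remove[of _ 0]) auto
  finally show "z x ^ degree p = (\<Sum>j<degree p. ?a j x * z x ^ j)"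
    by (simp only: left_diff_distrib sum_subtractf)
qed

lemma growth_insert_poly:
  assumes "growth V F k" "poly_deg_le F e r" "\<And>x. x \<in> V \<Longrightarrow> z x = r x"
  shows "growth V (insert z F) k"
  by (rule growth_insert_root[OF assms(1,2), of "[:0, 1:]"]) (use assms(3) in auto)

text \<open>Spanning functions on the two sets are extended by 0, to \<open>V\<close> and to \<open>W - V\<close> respectively.\<close>

lemma growth_Un:
  assumes "growth V F k" "growth W F k"
  shows "growth (V \<union> W) F k"
proof -
  obtain K where K: "\<forall>d. \<exists>B. finite B \<and> card B \<le> K * (d + 1) ^ k \<and>
     (\<forall>f. poly_deg_le F d f \<longrightarrow> spanned_on V B f)"
    using assms(1) unfolding growth_def by blast
  obtain L where L: "\<forall>d. \<exists>B. finite B \<and> card B \<le> L * (d + 1) ^ k \<and>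
     (\<forall>f. poly_deg_le F d f \<longrightarrow> spanned_on W B f)"
    using assms(2) unfolding growth_def by blast
  show ?thesis unfolding growth_def
  proof (intro exI[of _ "K + L"] allI)
    fix d
    obtain B where B: "finite B" "card B \<le> K * (d + 1) ^ k"
        "\<And>f. poly_deg_le F d f \<Longrightarrow> spanned_on V B f"
      using K by blast
    obtain C where C: "finite C" "card C \<le> L * (d + 1) ^ k"
        "\<And>f. poly_deg_le F d f \<Longrightarrow> spanned_on W C f"
      using L by blast
    let ?b = "case_sum (\<lambda>b x. if x \<in> V then b x else 0) (\<lambda>b x. if x \<in> V then 0 else b x)"
    let ?D = "?b ` (B <+> C)"
    have "card ?D \<le> card (B <+> C)" by (rule card_image_le) (use B C in auto)
    also have "\<dots> \<le> (K + L) * (d + 1) ^ k"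
      using B C by (simp add: card_Plus distrib_right)
    finally have card: "card ?D \<le> (K + L) * (d + 1) ^ k" .
    have "spanned_on (V \<union> W) ?D f" if f: "poly_deg_le F d f" for f
    proof -
      obtain b where b: "\<forall>x\<in>V. f x = (\<Sum>v\<in>B. b v * v x)"
        using B(3)[OF f] unfolding spanned_on_def by blast
      obtain c where c: "\<forall>x\<in>W. f x = (\<Sum>v\<in>C. c v * v x)"
        using C(3)[OF f] unfolding spanned_on_def by blast
      have "f x = (\<Sum>i\<in>B <+> C. case_sum b c i * ?b i x)" if "x \<in> V \<union> W" for x
        using that b c B C by (cases "x \<in> V") (auto simp: sum.Plus)
      then show ?thesis by (rule spanned_on_image[rotated]) (use B C in auto)
    qed
    then show "\<exists>B. finite B \<and> card B \<le> (K + L) * (d + 1) ^ k \<and>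
        (\<forall>f. poly_deg_le F d f \<longrightarrow> spanned_on (V \<union> W) B f)"
      using card B C by (intro exI[of _ ?D]) auto
  qed
qed

section \<open>Algebraic independence\<close>

text \<open>A homogeneous linear system with more unknowns than equations has a nonzero solution, by
  Gaussian elimination of one unknown and one equation at a time.\<close>

lemma linear_dependence:
  fixes M :: "'i \<Rightarrow> 'b \<Rightarrow> complex"
  assumes "finite B" "finite I" "card B < card I"
  shows "\<exists>c. (\<exists>i\<in>I. c i \<noteq> 0) \<and> (\<forall>b\<in>B. (\<Sum>i\<in>I. c i * M i b) = 0)"
  using assms
proof (induction B arbitrary: I M rule: finite_induct)
  case empty
  then obtain i where "i \<in> I" by (metis card.empty card_gt_0_iff ex_in_conv)
  then show ?case by (intro exI[of _ "\<lambda>_. 1"]) auto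
next
  case (insert b B)
  show ?case
  proof (cases "\<forall>i\<in>I. M i b = 0")
    case True
    have "card B < card I" using insert by simp
    from insert.IH[OF insert.prems(1) this, of M] show ?thesis using True by auto
  next
    case False
    then obtain k where k: "k \<in> I" "M k b \<noteq> 0" by blast
    let ?J = "I - {k}"
    have J: "finite ?J" "card B < card ?J" using insert k by auto
    obtain c where c: "\<exists>i\<in>?J. c i \<noteq> 0"
        "\<forall>v\<in>B. (\<Sum>i\<in>?J. c i * (M i v - M i b / M k b * M k v)) = 0"
      using insert.IH[OF J, of "\<lambda>i v. M i v - M i b / M k b * M k v"] by blast
    define s where "s = (\<Sum>i\<in>?J. c i * M i b) / M k b"
    define c' where "c' = c(k := - s)"
    have split: "(\<Sum>i\<in>I. c' i * M i v) = - s * M k v + (\<Sum>i\<in>?J. c i * M i v)" for v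
      using k(1) insert.prems(1) by (subst sum.remove[of _ k]) (auto simp: c'_def intro!: sum.cong)
    have "(\<Sum>i\<in>I. c' i * M i v) = 0" if "v \<in> B" for v
    proof -
      have "(\<Sum>i\<in>?J. c i * (M i v - M i b / M k b * M k v)) =
          (\<Sum>i\<in>?J. c i * M i v) - s * M k v"
        unfolding s_def sum_divide_distrib sum_distrib_right
        by (simp add: right_diff_distrib sum_subtractf mult.assoc)
      then show ?thesis using c(2) that by (simp add: split)
    qed
    moreover have "(\<Sum>i\<in>I. c' i * M i b) = 0" using k by (simp add: split s_def)
    moreover have "\<exists>i\<in>I. c' i \<noteq> 0" using c(1) by (auto simp: c'_def)
    ultimately show ?thesis by (intro exI[of _ c']) blast
  qed
qed

lemma spanned_on_dependence:
  assumes "finite B" "finite I" "card B < card I" "\<And>i. i \<in> I \<Longrightarrow> spanned_on V B (f i)"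
  shows "\<exists>c. (\<exists>i\<in>I. c i \<noteq> 0) \<and> (\<forall>x\<in>V. (\<Sum>i\<in>I. c i * f i x) = 0)"
proof -
  obtain M where M: "\<And>i x. i \<in> I \<Longrightarrow> x \<in> V \<Longrightarrow> f i x = (\<Sum>b\<in>B. M i b * b x)"
    using assms(4) unfolding spanned_on_def by metis
  obtain c where c: "\<exists>i\<in>I. c i \<noteq> 0" "\<forall>b\<in>B. (\<Sum>i\<in>I. c i * M i b) = 0"
    using linear_dependence[OF assms(1-3), of M] by blast
  have "(\<Sum>i\<in>I. c i * f i x) = 0" if x: "x \<in> V" for x
  proof -
    have "(\<Sum>i\<in>I. c i * f i x) = (\<Sum>i\<in>I. \<Sum>b\<in>B. c i * M i b * b x)"
      by (intro sum.cong HOL.refl) (use M x in \<open>simp add: sum_distrib_left mult.assoc\<close>)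
    also have "\<dots> = (\<Sum>b\<in>B. (\<Sum>i\<in>I. c i * M i b) * b x)"
      unfolding sum_distrib_right by (rule sum.swap)
    finally show ?thesis using c by simp
  qed
  then show ?thesis using c by blast
qed

primrec power_product :: "('a \<Rightarrow> complex) list \<Rightarrow> nat list \<Rightarrow> 'a \<Rightarrow> complex" where
  "power_product [] \<alpha> x = 1"
| "power_product (f # fs) \<alpha> x = f x ^ hd \<alpha> * power_product fs (tl \<alpha>) x"

text \<open>Exponent vectors are lists, so that the first function of a list can be split off together with
  its exponent. Repeated entries in the list are thereby dependent.\<close>

definition alg_indep :: "'a set \<Rightarrow> ('a \<Rightarrow> complex) list \<Rightarrow> bool" where
  "alg_indep Z fs \<longleftrightarrow> (\<forall>S c. finite S \<longrightarrow> (\<forall>\<alpha>\<in>S. length \<alpha> = length fs) \<longrightarrow>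
     (\<forall>x\<in>Z. (\<Sum>\<alpha>\<in>S. c \<alpha> * power_product fs \<alpha> x) = 0) \<longrightarrow> (\<forall>\<alpha>\<in>S. c \<alpha> = 0))"

lemma alg_indepD:
  assumes "alg_indep Z fs" "finite S" "\<And>\<alpha>. \<alpha> \<in> S \<Longrightarrow> length \<alpha> = length fs"
    "\<And>x. x \<in> Z \<Longrightarrow> (\<Sum>\<alpha>\<in>S. c \<alpha> * power_product fs \<alpha> x) = 0" "\<alpha> \<in> S"
  shows "c \<alpha> = 0"
  using assms unfolding alg_indep_def by blast

lemma alg_indep_Nil:
  assumes "Z \<noteq> {}"
  shows "alg_indep Z []"
  unfolding alg_indep_def
proof (intro allI impI ballI)
  fix S :: "nat list set" and c \<alpha>
  assume "finite S" and S: "\<forall>\<alpha>\<in>S. length \<alpha> = length ([] :: ('a \<Rightarrow> complex) list)"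
    and *: "\<forall>x\<in>Z. (\<Sum>\<alpha>\<in>S. c \<alpha> * power_product [] \<alpha> x) = (0::complex)" and "\<alpha> \<in> S"
  then have "S = {[]}" "\<alpha> = []" by auto
  then show "c \<alpha> = 0" using * assms by auto
qed

lemma poly_deg_le_power_product:
  assumes "\<And>f. f \<in> set fs \<Longrightarrow> poly_deg_le F e f" "length \<alpha> = length fs" "set \<alpha> \<subseteq> {..m}"
  shows "poly_deg_le F (length fs * (m * e)) (power_product fs \<alpha>)"
  using assms
proof (induction fs arbitrary: \<alpha>)
  case Nil
  have "power_product [] \<alpha> = (\<lambda>x. 1)" by auto
  then show ?case by (auto intro: poly_deg_le.const)
next
  case (Cons f fs)
  then obtain a \<beta> where a: "\<alpha> = a # \<beta>" by (cases \<alpha>) auto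
  have "poly_deg_le F (a * e) (\<lambda>x. f x ^ a)" by (intro poly_deg_le_power Cons) auto
  then have "poly_deg_le F (m * e) (\<lambda>x. f x ^ a)" using Cons.prems a by (auto elim!: poly_deg_le_mono)
  moreover have "poly_deg_le F (length fs * (m * e)) (power_product fs \<beta>)"
    using Cons a by auto
  ultimately have "poly_deg_le F (m * e + length fs * (m * e)) (\<lambda>x. f x ^ a * power_product fs \<beta> x)"
    by (rule poly_deg_le.mult)
  moreover have "power_product (f # fs) \<alpha> = (\<lambda>x. f x ^ a * power_product fs \<beta> x)"
    by (simp add: a fun_eq_iff)
  ultimately show ?case by simp
qed

definition exponents :: "nat \<Rightarrow> nat \<Rightarrow> nat list set" where
  "exponents n m = {\<alpha>. set \<alpha> \<subseteq> {..m} \<and> length \<alpha> = n}"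

lemma finite_exponents [simp]: "finite (exponents n m)"
  unfolding exponents_def by (rule finite_lists_length_eq) simp

lemma card_exponents: "card (exponents n m) = (m + 1) ^ n"
  unfolding exponents_def by (subst card_lists_length_eq) auto

text \<open>There are \<open>(m + 1)\<^sup>n\<close> power products of \<open>n\<close> functions with exponents up to \<open>m\<close>, which for
  \<open>n > k\<close> and large \<open>m\<close> is more than the \<open>O(m\<^sup>k)\<close> functions that span them.\<close>

lemma growth_alg_indep_length:
  assumes "growth V F k" "alg_indep V fs" "\<And>f. f \<in> set fs \<Longrightarrow> poly_deg_le F e f"
  shows "length fs \<le> k"
proof (rule ccontr)
  assume "\<not> length fs \<le> k"
  let ?n = "length fs"
  obtain K where K: "\<forall>d. \<exists>B. finite B \<and> card B \<le> K * (d + 1) ^ k \<and>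
     (\<forall>f. poly_deg_le F d f \<longrightarrow> spanned_on V B f)"
    using assms(1) unfolding growth_def by blast
  \<comment> \<open>large enough that \<open>m + 1\<close> beats all the constants that occur in the bound on \<open>card B\<close>\<close>
  define m where "m = K * (?n * e + 1) ^ k"
  obtain B where B: "finite B" "card B \<le> K * (?n * (m * e) + 1) ^ k"
      "\<And>f. poly_deg_le F (?n * (m * e)) f \<Longrightarrow> spanned_on V B f"
    using K by blast
  have "?n * (m * e) + 1 \<le> (?n * e + 1) * (m + 1)" by (simp add: algebra_simps)
  then have "(?n * (m * e) + 1) ^ k \<le> ((?n * e + 1) * (m + 1)) ^ k" by (rule power_mono) simp
  then have "card B \<le> K * ((?n * e + 1) * (m + 1)) ^ k"
    using B(2) by (meson le_trans mult_le_mono2)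
  also have "\<dots> = m * (m + 1) ^ k" by (simp only: m_def power_mult_distrib mult_ac)
  also have "\<dots> < (m + 1) ^ Suc k" unfolding power_Suc by (intro mult_strict_right_mono) auto
  also have "\<dots> \<le> (m + 1) ^ ?n" using \<open>\<not> ?n \<le> k\<close> by (intro power_increasing) auto
  finally have card: "card B < card (exponents ?n m)" by (simp only: card_exponents)
  have "spanned_on V B (power_product fs \<alpha>)" if "\<alpha> \<in> exponents ?n m" for \<alpha>
    by (rule B(3), rule poly_deg_le_power_product) (use that assms(3) in \<open>auto simp: exponents_def\<close>)
  from spanned_on_dependence[OF B(1) finite_exponents card this]
  obtain c where "(\<exists>\<alpha>\<in>exponents ?n m. c \<alpha> \<noteq> 0) \<and>
      (\<forall>x\<in>V. (\<Sum>\<alpha>\<in>exponents ?n m. c \<alpha> * power_product fs \<alpha> x) = 0)"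
    by (rule exE)
  then have c: "\<exists>\<alpha>\<in>exponents ?n m. c \<alpha> \<noteq> 0"
      "\<forall>x\<in>V. (\<Sum>\<alpha>\<in>exponents ?n m. c \<alpha> * power_product fs \<alpha> x) = 0"
    by simp_all
  then obtain \<alpha> where \<alpha>: "\<alpha> \<in> exponents ?n m" "c \<alpha> \<noteq> 0" by blast
  have "\<And>\<alpha>. \<alpha> \<in> exponents ?n m \<Longrightarrow> length \<alpha> = ?n" by (simp add: exponents_def)
  from alg_indepD[OF assms(2) finite_exponents this c(2)[rule_format] \<alpha>(1)] have "c \<alpha> = 0" .
  with \<alpha> show False by simp
qed

section \<open>Irreducible sets and chains\<close>

abbreviation coordinates :: "((complex^'m) \<Rightarrow> complex) set" where
  "coordinates \<equiv> range (\<lambda>i x. x $ i)"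

lemma polynomial_fun_imp_poly_deg_le: "polynomial_fun f \<Longrightarrow> \<exists>d. poly_deg_le coordinates d f"
proof (induction rule: polynomial_fun.induct)
  case (coord i)
  then show ?case using poly_deg_le.gen[of "\<lambda>x. x $ i" coordinates 0] by blast
next
  case (add f g)
  then obtain d e where "poly_deg_le coordinates d f" "poly_deg_le coordinates e g" by blast
  then have "poly_deg_le coordinates (max d e) f" "poly_deg_le coordinates (max d e) g"
    by (auto elim: poly_deg_le_mono)
  then show ?case by (blast intro: poly_deg_le.add)
qed (blast intro: poly_deg_le.intros)+

lemma poly_deg_le_imp_polynomial_fun: "poly_deg_le F d f \<Longrightarrow> (\<And>g. g \<in> F \<Longrightarrow> polynomial_fun g) \<Longrightarrow> polynomial_fun f"
  by (induction rule: poly_deg_le.induct) (auto intro: polynomial_fun.intros)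

lemma polynomial_fun_power: "polynomial_fun f \<Longrightarrow> polynomial_fun (\<lambda>x. f x ^ n)"
  by (induction n) (auto intro: polynomial_fun.intros)

lemma polynomial_fun_sum: "(\<And>i. i \<in> I \<Longrightarrow> polynomial_fun (f i)) \<Longrightarrow> polynomial_fun (\<lambda>x. \<Sum>i\<in>I. f i x)"
  by (induction I rule: infinite_finite_induct) (auto intro: polynomial_fun.intros)

lemma polynomial_fun_prod: "(\<And>i. i \<in> I \<Longrightarrow> polynomial_fun (f i)) \<Longrightarrow> polynomial_fun (\<lambda>x. \<Prod>i\<in>I. f i x)"
  by (induction I rule: infinite_finite_induct) (auto intro: polynomial_fun.intros)

lemma polynomial_fun_diff: "polynomial_fun f \<Longrightarrow> polynomial_fun g \<Longrightarrow> polynomial_fun (\<lambda>x. f x - g x)"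
  using polynomial_fun.add[OF _ polynomial_fun.mult[OF polynomial_fun.const[of "-1"]]] by fastforce

lemma polynomial_fun_power_product:
  "(\<And>f. f \<in> set fs \<Longrightarrow> polynomial_fun f) \<Longrightarrow> polynomial_fun (power_product fs \<alpha>)"
proof (induction fs arbitrary: \<alpha>)
  case Nil
  have "power_product [] \<alpha> = (\<lambda>x. 1)" by auto
  then show ?case by (auto intro: polynomial_fun.const)
next
  case (Cons f fs)
  have "power_product (f # fs) \<alpha> = (\<lambda>x. f x ^ hd \<alpha> * power_product fs (tl \<alpha>) x)" by auto
  then show ?case using Cons by (auto intro!: polynomial_fun.mult polynomial_fun_power)
qed

definition irreducible_set :: "(complex^'m) set \<Rightarrow> bool" where
  "irreducible_set Z \<longleftrightarrow> Z \<noteq> {} \<and> (\<forall>f g. polynomial_fun f \<longrightarrow> polynomial_fun g \<longrightarrow>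
     (\<forall>x\<in>Z. f x * g x = 0) \<longrightarrow> (\<forall>x\<in>Z. f x = 0) \<or> (\<forall>x\<in>Z. g x = 0))"

lemma irreducible_setD:
  assumes "irreducible_set Z" "polynomial_fun f" "polynomial_fun g" "\<And>x. x \<in> Z \<Longrightarrow> f x * g x = 0"
    "y \<in> Z" "f y \<noteq> 0" "x \<in> Z"
  shows "g x = 0"
  using assms unfolding irreducible_set_def by blast

lemma algebraic_set_zeros: "polynomial_fun f \<Longrightarrow> algebraic_set {x. f x = 0}"
  unfolding algebraic_set_def by (intro exI[of _ "{f}"]) auto

lemma algebraic_set_separate:
  assumes "algebraic_set V" "x \<notin> V"
  obtains f where "polynomial_fun f" "\<And>y. y \<in> V \<Longrightarrow> f y = 0" "f x \<noteq> 0"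
  using assms unfolding algebraic_set_def by auto

text \<open>Irreducibility is primality of the vanishing ideal. In this form it can be checked on any set,
  for instance on the image of a parametrization.\<close>

lemma irreducible_space_zariski_iff:
  "irreducible_space (subtopology zariski Z) \<longleftrightarrow> irreducible_set Z"
proof
  assume *: "irreducible_space (subtopology zariski Z)"
  show "irreducible_set Z" unfolding irreducible_set_def
  proof (intro conjI allI impI)
    show "Z \<noteq> {}" using * by (auto simp: irreducible_space_def)
    fix f g :: "complex^'a \<Rightarrow> complex"
    assume fg: "polynomial_fun f" "polynomial_fun g" "\<forall>x\<in>Z. f x * g x = 0"
    have cl: "closedin (subtopology zariski Z) (Z \<inter> {x. h x = 0})" if "polynomial_fun h"
      for h :: "complex^'a \<Rightarrow> complex"
      by (intro closedin_subtopology_Int_closed) (simp add: closedin_zariski algebraic_set_zeros that)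
    have "topspace (subtopology zariski Z) = (Z \<inter> {x. f x = 0}) \<union> (Z \<inter> {x. g x = 0})"
      using fg by auto
    then have "Z \<inter> {x. f x = 0} = topspace (subtopology zariski Z) \<or>
        Z \<inter> {x. g x = 0} = topspace (subtopology zariski Z)"
      using * cl[OF fg(1)] cl[OF fg(2)] unfolding irreducible_space_def by blast
    then show "(\<forall>x\<in>Z. f x = 0) \<or> (\<forall>x\<in>Z. g x = 0)" by auto
  qed
next
  assume Z: "irreducible_set Z"
  show "irreducible_space (subtopology zariski Z)" unfolding irreducible_space_def
  proof (intro conjI allI impI)
    show "topspace (subtopology zariski Z) \<noteq> {}" using Z by (auto simp: irreducible_set_def)
    fix A B
    assume *: "closedin (subtopology zariski Z) A \<and> closedin (subtopology zariski Z) B \<and>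
      topspace (subtopology zariski Z) = A \<union> B"
    obtain A' where A: "algebraic_set A'" "A = A' \<inter> Z"
      using * unfolding closedin_subtopology closedin_zariski by blast
    obtain B' where B: "algebraic_set B'" "B = B' \<inter> Z"
      using * unfolding closedin_subtopology closedin_zariski by blast
    have AB: "Z = A \<union> B" using * by simp
    show "A = topspace (subtopology zariski Z) \<or> B = topspace (subtopology zariski Z)"
    proof (rule ccontr)
      assume "\<not> ?thesis"
      then obtain a b where ab: "a \<in> Z" "a \<notin> A'" "b \<in> Z" "b \<notin> B'" using A B by auto
      obtain f where f: "polynomial_fun f" "\<And>y. y \<in> A' \<Longrightarrow> f y = 0" "f a \<noteq> 0"
        using algebraic_set_separate[OF A(1) ab(2)] by blast
      obtain g where g: "polynomial_fun g" "\<And>y. y \<in> B' \<Longrightarrow> g y = 0" "g b \<noteq> 0"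
        using algebraic_set_separate[OF B(1) ab(4)] by blast
      have "f x * g x = 0" if "x \<in> Z" for x
      proof -
        have "x \<in> A' \<or> x \<in> B'" using that AB A(2) B(2) by blast
        then show ?thesis using f(2) g(2) by auto
      qed
      from irreducible_setD[OF Z f(1) g(1) this ab(1) f(3) ab(3)] have "g b = 0" by simp
      with g show False by simp
    qed
  qed
qed

definition zariski_closure :: "(complex^'m) set \<Rightarrow> (complex^'m) set \<Rightarrow> (complex^'m) set" where
  "zariski_closure V W = {x\<in>V. \<forall>f. polynomial_fun f \<longrightarrow> (\<forall>w\<in>W. f w = 0) \<longrightarrow> f x = 0}"

lemma closedin_zariski_iff:
  "closedin (subtopology zariski V) Z \<longleftrightarrow> zariski_closure V Z = Z"
proof
  assume "closedin (subtopology zariski V) Z"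
  then obtain Z' where Z': "algebraic_set Z'" "Z = Z' \<inter> V"
    by (auto simp: closedin_subtopology closedin_zariski)
  have "x \<in> Z'" if "x \<in> zariski_closure V Z" for x
  proof (rule ccontr)
    assume "x \<notin> Z'"
    from algebraic_set_separate[OF Z'(1) this] obtain f
      where "polynomial_fun f" "\<And>y. y \<in> Z' \<Longrightarrow> f y = 0" "f x \<noteq> 0" by blast
    then show False using that Z' by (auto simp: zariski_closure_def)
  qed
  then show "zariski_closure V Z = Z" using Z' by (auto simp: zariski_closure_def)
next
  assume *: "zariski_closure V Z = Z"
  have "algebraic_set {x. \<forall>f\<in>{f. polynomial_fun f \<and> (\<forall>w\<in>Z. f w = 0)}. f x = 0}"
    unfolding algebraic_set_def by (intro exI[of _ "{f. polynomial_fun f \<and> (\<forall>w\<in>Z. f w = 0)}"]) auto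
  moreover have "Z = {x. \<forall>f\<in>{f. polynomial_fun f \<and> (\<forall>w\<in>Z. f w = 0)}. f x = 0} \<inter> V"
    using * by (auto simp: zariski_closure_def)
  ultimately show "closedin (subtopology zariski V) Z"
    unfolding closedin_subtopology closedin_zariski by blast
qed

lemma zariski_closure_idem: "zariski_closure V (zariski_closure V W) = zariski_closure V W"
  by (auto simp: zariski_closure_def)

lemma zariski_closure_superset: "W \<subseteq> V \<Longrightarrow> W \<subseteq> zariski_closure V W"
  by (auto simp: zariski_closure_def)

lemma zariski_closure_vanish:
  "polynomial_fun f \<Longrightarrow> (\<And>w. w \<in> W \<Longrightarrow> f w = 0) \<Longrightarrow> x \<in> zariski_closure V W \<Longrightarrow> f x = 0"
  by (auto simp: zariski_closure_def)

lemma irreducible_set_zariski_closure: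
  assumes "irreducible_set W" "W \<subseteq> V"
  shows "irreducible_set (zariski_closure V W)"
  unfolding irreducible_set_def
proof (intro conjI allI impI)
  show "zariski_closure V W \<noteq> {}"
    using assms zariski_closure_superset[OF assms(2)] by (auto simp: irreducible_set_def)
  fix f g :: "complex^'a \<Rightarrow> complex"
  assume fg: "polynomial_fun f" "polynomial_fun g" "\<forall>x\<in>zariski_closure V W. f x * g x = 0"
  then have "\<forall>x\<in>W. f x * g x = 0" using zariski_closure_superset[OF assms(2)] by blast
  then have "(\<forall>x\<in>W. f x = 0) \<or> (\<forall>x\<in>W. g x = 0)" using assms(1) fg unfolding irreducible_set_def by blast
  then show "(\<forall>x\<in>zariski_closure V W. f x = 0) \<or> (\<forall>x\<in>zariski_closure V W. g x = 0)"
    using fg by (blast intro: zariski_closure_vanish)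
qed

text \<open>Irreducible relatively closed sets of height at least \<open>n\<close>. Everything below about dimension is
  phrased with these, as they are what isomorphisms transport.\<close>

definition chain_top :: "(complex^'m) set \<Rightarrow> nat \<Rightarrow> (complex^'m) set \<Rightarrow> bool" where
  "chain_top V n W \<longleftrightarrow> (\<exists>Z. (\<forall>i\<le>n. zariski_closure V (Z i) = Z i \<and> irreducible_set (Z i)) \<and>
     (\<forall>i<n. Z i \<subset> Z (Suc i)) \<and> Z n = W)"

lemma chain_topD:
  assumes "chain_top V n W"
  shows "irreducible_set W" "zariski_closure V W = W" "W \<subseteq> V"
  using assms unfolding chain_top_def by (auto simp: zariski_closure_def)

lemma chain_top_Suc:
  assumes "chain_top V n W" "W \<subset> W'" "irreducible_set W'" "zariski_closure V W' = W'"
  shows "chain_top V (Suc n) W'"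
proof -
  obtain Z where "\<forall>i\<le>n. zariski_closure V (Z i) = Z i \<and> irreducible_set (Z i)"
     "\<forall>i<n. Z i \<subset> Z (Suc i)" "Z n = W"
    using assms(1) unfolding chain_top_def by blast
  then show ?thesis using assms unfolding chain_top_def
    by (intro exI[of _ "\<lambda>i. if i \<le> n then Z i else W'"]) (auto simp: le_Suc_eq less_Suc_eq)
qed

lemma chain_top_cases:
  assumes "chain_top V (Suc n) W"
  obtains W' where "chain_top V n W'" "W' \<subset> W"
  using assms unfolding chain_top_def by (metis le_SucI lessI less_SucI)

lemma variety_dim_eq: "variety_dim V = Sup {enat n | n. \<exists>W. chain_top V n W}"
proof -
  have "closedin (subtopology zariski V) Z \<and>
      irreducible_space (subtopology (subtopology zariski V) Z) \<longleftrightarrow>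
      zariski_closure V Z = Z \<and> irreducible_set Z" for Z
  proof (cases "Z \<subseteq> V")
    case True
    then have "subtopology (subtopology zariski V) Z = subtopology zariski Z"
      by (simp add: subtopology_subtopology inf_absorb2)
    then show ?thesis by (simp add: closedin_zariski_iff irreducible_space_zariski_iff)
  next
    case False
    moreover have "zariski_closure V Z \<subseteq> V" by (auto simp: zariski_closure_def)
    moreover have "Z \<subseteq> V" if "closedin (subtopology zariski V) Z"
      using closedin_subset[OF that] by simp
    ultimately show ?thesis by auto
  qed
  then show ?thesis unfolding variety_dim_def krull_dim_def chain_top_def by simp
qed

text \<open>The step behind the dimension bound. In a nontrivial relation on \<open>Z\<close>, cancel the largest
  common power of \<open>f\<close>, which irreducibility permits because \<open>f\<close> is not identically 0 on \<open>Z\<close>. On \<open>W\<close>,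
  where \<open>f\<close> does vanish, only the terms without \<open>f\<close> survive, and they form a nontrivial relation
  between the independent functions \<open>fs\<close>.\<close>

lemma alg_indep_Cons:
  assumes Z: "irreducible_set Z" and W: "W \<subseteq> Z" "alg_indep W fs" "\<And>g. g \<in> set fs \<Longrightarrow> polynomial_fun g"
    and f: "polynomial_fun f" "\<And>x. x \<in> W \<Longrightarrow> f x = 0" "y \<in> Z" "f y \<noteq> 0"
  shows "alg_indep Z (f # fs)"
proof (rule ccontr)
  assume "\<not> alg_indep Z (f # fs)"
  then obtain S c \<alpha>\<^sub>0 where S: "finite S" "\<forall>\<alpha>\<in>S. length \<alpha> = Suc (length fs)"
      "\<forall>x\<in>Z. (\<Sum>\<alpha>\<in>S. c \<alpha> * power_product (f # fs) \<alpha> x) = 0" "\<alpha>\<^sub>0 \<in> S" "c \<alpha>\<^sub>0 \<noteq> 0"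
    unfolding alg_indep_def by auto
  define T where "T = {\<alpha>\<in>S. c \<alpha> \<noteq> 0}"
  have T: "finite T" "T \<noteq> {}" using S by (auto simp: T_def)
  define m where "m = Min (hd ` T)"
  have m: "m \<le> hd \<alpha>" if "\<alpha> \<in> T" for \<alpha> using T that by (simp add: m_def)
  have "m \<in> hd ` T" unfolding m_def using T by (intro Min_in) auto
  then obtain \<beta> where \<beta>: "\<beta> \<in> T" "hd \<beta> = m" by blast
  \<comment> \<open>the relation divided by \<open>f ^ m\<close>\<close>
  define g where "g x = (\<Sum>\<alpha>\<in>T. c \<alpha> * (f x ^ (hd \<alpha> - m) * power_product fs (tl \<alpha>) x))" for x
  have g: "polynomial_fun g" unfolding g_def
    by (intro polynomial_fun_sum polynomial_fun.mult polynomial_fun.const polynomial_fun_power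
        polynomial_fun_power_product W f)
  have "f x ^ m * g x = 0" if "x \<in> Z" for x
  proof -
    have "f x ^ m * g x = (\<Sum>\<alpha>\<in>T. c \<alpha> * power_product (f # fs) \<alpha> x)"
      unfolding g_def sum_distrib_left
    proof (intro sum.cong HOL.refl)
      fix \<alpha> assume "\<alpha> \<in> T"
      then have "f x ^ hd \<alpha> = f x ^ m * f x ^ (hd \<alpha> - m)" using m by (simp add: power_add[symmetric])
      then show "f x ^ m * (c \<alpha> * (f x ^ (hd \<alpha> - m) * power_product fs (tl \<alpha>) x)) =
          c \<alpha> * power_product (f # fs) \<alpha> x" by simp
    qed
    also have "\<dots> = (\<Sum>\<alpha>\<in>S. c \<alpha> * power_product (f # fs) \<alpha> x)"
      using S(1) by (intro sum.mono_neutral_left) (auto simp: T_def)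
    finally show ?thesis using S(3) that by simp
  qed
  then have g0: "g x = 0" if "x \<in> Z" for x
    by (rule irreducible_setD[OF Z polynomial_fun_power[OF f(1)] g _ f(3) _ that]) (use f in auto)
  define T' where "T' = {\<alpha>\<in>T. hd \<alpha> = m}"
  have T'S: "\<alpha> = m # tl \<alpha> \<and> length (tl \<alpha>) = length fs" if "\<alpha> \<in> T'" for \<alpha>
    using that S(2) by (cases \<alpha>) (auto simp: T'_def T_def)
  have "c (m # tl \<beta>) = 0"
  proof (rule alg_indepD[OF W(2), where S = "tl ` T'" and c = "\<lambda>\<gamma>. c (m # \<gamma>)"])
    show "tl \<beta> \<in> tl ` T'" using \<beta> by (auto simp: T'_def)
    show "finite (tl ` T')" using T by (auto simp: T'_def)
    show "length \<gamma> = length fs" if "\<gamma> \<in> tl ` T'" for \<gamma> using that T'S by blast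
    fix x assume x: "x \<in> W"
    have inj: "inj_on tl T'" using T'S by (metis inj_onI)
    have "(\<Sum>\<gamma>\<in>tl ` T'. c (m # \<gamma>) * power_product fs \<gamma> x) =
        (\<Sum>\<alpha>\<in>T'. c (m # tl \<alpha>) * power_product fs (tl \<alpha>) x)"
      by (rule sum.reindex_cong[OF inj]) auto
    also have "\<dots> = (\<Sum>\<alpha>\<in>T'. c \<alpha> * power_product fs (tl \<alpha>) x)"
      using T'S by (intro sum.cong HOL.refl) metis
    also have "\<dots> = g x" unfolding g_def
    proof (rule sum.mono_neutral_cong_left)
      show "\<forall>\<alpha>\<in>T - T'. c \<alpha> * (f x ^ (hd \<alpha> - m) * power_product fs (tl \<alpha>) x) = 0"
      proof
        fix \<alpha> assume "\<alpha> \<in> T - T'"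
        then have "hd \<alpha> > m" using m by (fastforce simp: T'_def)
        then show "c \<alpha> * (f x ^ (hd \<alpha> - m) * power_product fs (tl \<alpha>) x) = 0"
          using f(2)[OF x] by (simp add: power_0_left)
      qed
    qed (use T in \<open>auto simp: T'_def\<close>)
    finally show "(\<Sum>\<gamma>\<in>tl ` T'. c (m # \<gamma>) * power_product fs \<gamma> x) = 0" using g0 x W by auto
  qed
  moreover have "m # tl \<beta> = \<beta>" using T'S[of \<beta>] \<beta> by (auto simp: T'_def)
  ultimately show False using \<beta> by (auto simp: T_def)
qed

lemma chain_top_alg_indep:
  assumes "chain_top V n W"
  shows "\<exists>fs. length fs = n \<and> (\<forall>f\<in>set fs. polynomial_fun f) \<and> alg_indep W fs"
  using assms
proof (induction n arbitrary: W)
  case 0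
  then have "W \<noteq> {}" using chain_topD(1) by (auto simp: irreducible_set_def)
  then have "alg_indep W []" by (rule alg_indep_Nil)
  then show ?case by (intro exI[of _ "[]"]) auto
next
  case (Suc n)
  obtain W' where W': "chain_top V n W'" "W' \<subset> W" using chain_top_cases[OF Suc.prems] .
  obtain fs where fs: "length fs = n" "\<forall>f\<in>set fs. polynomial_fun f" "alg_indep W' fs"
    using Suc.IH[OF W'(1)] by blast
  obtain y where y: "y \<in> W" "y \<notin> W'" using W' by blast
  then have "y \<notin> zariski_closure V W'" "y \<in> V"
    using chain_topD[OF W'(1)] chain_topD[OF Suc.prems] by auto
  then obtain f where f: "polynomial_fun f" "\<And>x. x \<in> W' \<Longrightarrow> f x = 0" "f y \<noteq> 0"
    by (auto simp: zariski_closure_def)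
  have "alg_indep W (f # fs)"
    by (rule alg_indep_Cons[where W = W' and y = y])
      (use W' fs f y chain_topD[OF Suc.prems] in auto)
  then show ?case using fs f by (intro exI[of _ "f # fs"]) auto
qed

lemma alg_indep_superset: "alg_indep W fs \<Longrightarrow> W \<subseteq> V \<Longrightarrow> alg_indep V fs"
  unfolding alg_indep_def by blast

lemma finite_common_degree:
  assumes "finite G" "\<And>f. f \<in> G \<Longrightarrow> polynomial_fun f"
  obtains e where "\<And>f. f \<in> G \<Longrightarrow> poly_deg_le coordinates e f"
proof -
  obtain d where d: "\<And>f. f \<in> G \<Longrightarrow> poly_deg_le coordinates (d f) f"
    using polynomial_fun_imp_poly_deg_le assms(2) by metis
  have "poly_deg_le coordinates (\<Sum>f\<in>G. d f) f" if "f \<in> G" for f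
    using d[OF that] by (rule poly_deg_le_mono) (use member_le_sum[OF that, of d] assms(1) in auto)
  then show ?thesis using that by blast
qed

lemma growth_chain_top_le:
  assumes "growth V coordinates k" "chain_top V n W"
  shows "n \<le> k"
proof -
  obtain fs where fs: "length fs = n" "\<forall>f\<in>set fs. polynomial_fun f" "alg_indep W fs"
    using chain_top_alg_indep[OF assms(2)] by blast
  obtain e where "\<And>f. f \<in> set fs \<Longrightarrow> poly_deg_le coordinates e f"
    using finite_common_degree[of "set fs"] fs by auto
  then show ?thesis
    using growth_alg_indep_length[OF assms(1) alg_indep_superset[OF fs(3)]] fs
      chain_topD(3)[OF assms(2)] by blast
qed

lemma variety_dim_eqI:
  assumes "growth V coordinates k" "chain_top V k W"
  shows "variety_dim V = k"
  unfolding variety_dim_eq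
proof (rule antisym)
  show "Sup {enat n |n. \<exists>W. chain_top V n W} \<le> enat k"
    by (rule Sup_least) (use growth_chain_top_le[OF assms(1)] in auto)
  show "enat k \<le> Sup {enat n |n. \<exists>W. chain_top V n W}"
    by (rule Sup_upper) (use assms in auto)
qed

lemma not_irreducible_varietyI:
  assumes "growth V coordinates k" "chain_top V k W" "W \<noteq> V"
  shows "\<not> irreducible_variety V"
proof
  assume "irreducible_variety V"
  then have "irreducible_set V" by (simp add: irreducible_variety_def irreducible_space_zariski_iff)
  moreover have "zariski_closure V V = V" by (auto simp: zariski_closure_def)
  moreover have "W \<subset> V" using chain_topD(3)[OF assms(2)] assms(3) by blast
  ultimately have "chain_top V (Suc k) V" using chain_top_Suc[OF assms(2)] by blast
  then show False using growth_chain_top_le[OF assms(1)] by fastforce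
qed

section \<open>Powers in \<open>SL\<^sub>2(\<complex>)\<close>\<close>

lemma matrix_mult_2_nth:
  fixes A B :: "complex^2^2"
  shows "(A ** B) $ i $ j = A $ i $ 1 * B $ 1 $ j + A $ i $ 2 * B $ 2 $ j"
  by (simp add: matrix_matrix_mult_def sum_2)

lemma trace_2: "trace (A :: complex^2^2) = A $ 1 $ 1 + A $ 2 $ 2"
  by (simp add: trace_def sum_2)

lemma mat_1_2_nth:
  "(mat 1 :: complex^2^2) $ 1 $ 1 = 1" "(mat 1 :: complex^2^2) $ 1 $ 2 = 0"
  "(mat 1 :: complex^2^2) $ 2 $ 1 = 0" "(mat 1 :: complex^2^2) $ 2 $ 2 = 1"
  by (simp_all add: mat_def)

lemma matrix_2_eq_iff:
  fixes A B :: "complex^2^2"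
  shows "A = B \<longleftrightarrow> A $ 1 $ 1 = B $ 1 $ 1 \<and> A $ 1 $ 2 = B $ 1 $ 2 \<and> A $ 2 $ 1 = B $ 2 $ 1 \<and> A $ 2 $ 2 = B $ 2 $ 2"
  by (auto simp: vec_eq_iff forall_2)

text \<open>The Chebyshev polynomials of the second kind with rescaled variable and shifted index,
  \<open>cheb n (2 x) = U\<^sub>n\<^sub>-\<^sub>1(x)\<close>. Thus \<open>cheb n\<close> takes \<open>\<mu> + 1/\<mu>\<close> to \<open>(\<mu>\<^sup>n - \<mu>\<^sup>-\<^sup>n) / (\<mu> - \<mu>\<^sup>-\<^sup>1)\<close>.\<close>

fun cheb :: "nat \<Rightarrow> complex poly" where
  "cheb 0 = 0"
| "cheb (Suc 0) = 1"
| "cheb (Suc (Suc n)) = pCons 0 (cheb (Suc n)) - cheb n"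

lemma cheb_coeff:
  "(\<forall>i\<ge>n. coeff (cheb n) i = 0) \<and> (n > 0 \<longrightarrow> coeff (cheb n) (n - 1) = 1)"
proof (induction n rule: cheb.induct)
  case (3 n)
  then show ?case by (auto simp: coeff_pCons split: nat.splits)
qed auto

lemma degree_cheb: "degree (cheb (Suc n)) = n" and lead_coeff_cheb: "lead_coeff (cheb (Suc n)) = 1"
proof -
  show *: "degree (cheb (Suc n)) = n"
    by (rule antisym)
      (use cheb_coeff[of "Suc n"] in \<open>auto intro!: degree_le le_degree\<close>)
  show "lead_coeff (cheb (Suc n)) = 1" using cheb_coeff[of "Suc n"] by (simp add: *)
qed

text \<open>The trace of the power with exponent \<open>n + 1\<close> as a monic polynomial in the trace of the matrix.\<close>

definition cheb_trace :: "nat \<Rightarrow> complex poly" where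
  "cheb_trace n = pCons 0 (cheb (Suc n)) - smult 2 (cheb n)"

lemma degree_cheb_trace: "degree (cheb_trace n) = Suc n"
  and lead_coeff_cheb_trace: "lead_coeff (cheb_trace n) = 1"
proof -
  have 1: "coeff (cheb_trace n) (Suc n) = 1"
    using cheb_coeff[of n] cheb_coeff[of "Suc n"] by (simp add: cheb_trace_def)
  show *: "degree (cheb_trace n) = Suc n"
  proof (rule antisym)
    show "degree (cheb_trace n) \<le> Suc n"
      using cheb_coeff[of n] cheb_coeff[of "Suc n"]
      by (intro degree_le) (auto simp: cheb_trace_def coeff_pCons split: nat.splits)
  qed (use 1 in \<open>auto intro: le_degree\<close>)
  show "lead_coeff (cheb_trace n) = 1" using 1 by (simp add: *)
qed

lemma SL2C_simps: "carrier SL2C = {A. det A = 1}" "A \<otimes>\<^bsub>SL2C\<^esub> B = A ** B" "\<one>\<^bsub>SL2C\<^esub> = mat 1"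
  by (simp_all add: SL2C_def)

lemma SL2C_pow_Suc: "A [^]\<^bsub>SL2C\<^esub> Suc n = (A [^]\<^bsub>SL2C\<^esub> n) ** A"
  by (simp add: SL2C_simps)

lemma SL2C_pow_0: "A [^]\<^bsub>SL2C\<^esub> (0::nat) = mat 1"
  by (simp add: SL2C_simps)

text \<open>Iterating Cayley--Hamilton, \<open>A\<^sup>2 = (tr A) A - 1\<close>.\<close>

lemma SL2C_pow_nth:
  assumes "det A = 1"
  shows "(A [^]\<^bsub>SL2C\<^esub> Suc n) $ i $ j =
    poly (cheb (Suc n)) (trace A) * A $ i $ j - poly (cheb n) (trace A) * mat 1 $ i $ j"
proof (induction n arbitrary: i j)
  case 0
  show ?case unfolding SL2C_pow_Suc SL2C_pow_0 by simp
next
  case (Suc n)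
  let ?u = "poly (cheb (Suc n)) (A $ 1 $ 1 + A $ 2 $ 2)" and ?v = "poly (cheb n) (A $ 1 $ 1 + A $ 2 $ 2)"
  have det: "?u * (A $ 1 $ 1 * A $ 2 $ 2) = ?u + ?u * (A $ 1 $ 2 * A $ 2 $ 1)"
    using assms by (simp add: det_2 algebra_simps)
  have "(i = 1 \<or> i = 2) \<and> (j = 1 \<or> j = 2)" using exhaust_2 by auto
  then have "(?u * A $ i $ 1 - ?v * mat 1 $ i $ 1) * A $ 1 $ j + (?u * A $ i $ 2 - ?v * mat 1 $ i $ 2) * A $ 2 $ j =
      ((A $ 1 $ 1 + A $ 2 $ 2) * ?u - ?v) * A $ i $ j - ?u * mat 1 $ i $ j"
    using det by (elim conjE disjE) (simp_all add: mat_1_2_nth ring_distribs mult_ac)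
  then show ?case
    unfolding SL2C_pow_Suc[of _ "Suc n"] matrix_mult_2_nth Suc.IH trace_2 cheb.simps by simp
qed

lemma trace_SL2C_pow:
  assumes "det A = 1"
  shows "trace (A [^]\<^bsub>SL2C\<^esub> Suc n) = poly (cheb_trace n) (trace A)"
  unfolding trace_2[of "A [^]\<^bsub>SL2C\<^esub> Suc n"] SL2C_pow_nth[OF assms]
  by (simp add: mat_1_2_nth cheb_trace_def trace_2 algebra_simps)

lemma cheb_eigenvalue:
  assumes "\<mu> \<noteq> 0"
  shows "poly (cheb n) (\<mu> + 1 / \<mu>) * (\<mu> - 1 / \<mu>) = \<mu> ^ n - 1 / \<mu> ^ n"
proof (induction n rule: cheb.induct)
  case (3 n)
  have "poly (cheb (Suc (Suc n))) (\<mu> + 1 / \<mu>) * (\<mu> - 1 / \<mu>) =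
     (\<mu> + 1 / \<mu>) * (\<mu> ^ Suc n - 1 / \<mu> ^ Suc n) - (\<mu> ^ n - 1 / \<mu> ^ n)"
    using 3 by (simp add: left_diff_distrib mult.assoc)
  also have "\<dots> = \<mu> ^ Suc (Suc n) - 1 / \<mu> ^ Suc (Suc n)"
    using assms by (simp add: field_simps)
  finally show ?case .
qed auto

text \<open>If \<open>\<mu>\<^sup>n = \<plusminus> 1\<close>, then \<open>\<mu>\<^sup>n = \<mu>\<^sup>-\<^sup>n\<close>, so the Chebyshev coefficient of \<open>A\<close> in \<open>A\<^sup>n\<close> vanishes.
  The condition \<open>\<mu>\<^sup>2 \<noteq> 1\<close> makes the eigenvalues \<open>\<mu>\<close> and \<open>1/\<mu>\<close> of \<open>A\<close> distinct.\<close>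

lemma SL2C_pow_scalar:
  assumes "det A = 1" "trace A = \<mu> + 1 / \<mu>" "\<mu> \<noteq> 0" "\<mu>^2 \<noteq> 1" "\<mu> ^ n = \<epsilon>" "\<epsilon>^2 = 1" "n > 0"
  shows "A [^]\<^bsub>SL2C\<^esub> n = mat \<epsilon>"
proof -
  obtain m where n: "n = Suc m" using assms(7) by (cases n) auto
  have \<epsilon>: "\<epsilon> \<noteq> 0" "1 / \<epsilon> = \<epsilon>" using assms(6) by (auto simp: power2_eq_square divide_eq_eq)
  have ne: "\<mu> - 1 / \<mu> \<noteq> 0" using assms(3,4) by (auto simp: field_simps power2_eq_square)
  have "poly (cheb n) (\<mu> + 1 / \<mu>) * (\<mu> - 1 / \<mu>) = 0"
    using cheb_eigenvalue[OF assms(3), of n] assms(5) \<epsilon> by simp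
  then have 1: "poly (cheb n) (\<mu> + 1 / \<mu>) = 0" using ne by simp
  have "\<mu> ^ m = \<epsilon> / \<mu>" using assms(3,5) n by (simp add: field_simps)
  then have "poly (cheb m) (\<mu> + 1 / \<mu>) * (\<mu> - 1 / \<mu>) = \<epsilon> / \<mu> - \<mu> * (1 / \<epsilon>)"
    using cheb_eigenvalue[OF assms(3), of m] by simp
  also have "\<dots> = - \<epsilon> * (\<mu> - 1 / \<mu>)" by (simp only: \<epsilon>) (simp add: algebra_simps)
  finally have 2: "poly (cheb m) (\<mu> + 1 / \<mu>) = - \<epsilon>" using ne by (metis mult_right_cancel)
  show ?thesis unfolding n
    by (simp only: vec_eq_iff SL2C_pow_nth[OF assms(1)] assms(2) 1[unfolded n] 2)
      (simp add: mat_def)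
qed

section \<open>The representation variety in coordinates\<close>

definition gen_mat :: "3 \<Rightarrow> complex^(3 \<times> 2 \<times> 2) \<Rightarrow> complex^2^2" where
  "gen_mat k x = (\<chi> i j. x $ (k, i, j))"

lemma gen_mat_nth [simp]: "gen_mat k x $ i $ j = x $ (k, i, j)"
  by (simp add: gen_mat_def)

lemma gen_mat_tuple_coords [simp]: "gen_mat k (tuple_coords A) = A k"
  by (simp add: vec_eq_iff tuple_coords_def)

lemma tuple_coords_gen_mat [simp]: "tuple_coords (\<lambda>k. gen_mat k x) = x"
  by (simp add: vec_eq_iff tuple_coords_def)

lemma det_SL2C_pow: "det A = 1 \<Longrightarrow> det (A [^]\<^bsub>SL2C\<^esub> (n::nat)) = 1"
  using monoid.nat_pow_closed[OF group.is_monoid[OF group_SL2C], of A n] by (simp add: SL2C_simps)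

text \<open>Inverting both sides of \<open>A\<^sup>-\<^sup>P B\<^sup>-\<^sup>Q = C\<^sup>T\<close> gives a relation with positive exponents that is
  invariant under cyclic permutation.\<close>

definition relation_set :: "nat \<Rightarrow> nat \<Rightarrow> nat \<Rightarrow> (complex^(3 \<times> 2 \<times> 2)) set" where
  "relation_set P Q T = {x. (\<forall>k. det (gen_mat k x) = 1) \<and>
    (gen_mat 2 x [^]\<^bsub>SL2C\<^esub> Q) ** (gen_mat 1 x [^]\<^bsub>SL2C\<^esub> P) ** (gen_mat 3 x [^]\<^bsub>SL2C\<^esub> T) = mat 1}"

lemma R_Gpqt_eq_relation_set:
  assumes "p < 0" "q < 0" "t > 0"
  shows "R_Gpqt p q t = relation_set (nat (- p)) (nat (- q)) (nat t)"
proof -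
  interpret group SL2C by (rule group_SL2C)
  let ?P = "nat (- p)" and ?Q = "nat (- q)" and ?T = "nat t"
  have "x \<in> R_Gpqt p q t \<longleftrightarrow> (\<lambda>k. gen_mat k x) \<in> {A. (\<forall>k. det (A k) = 1) \<and>
     (A 1 [^]\<^bsub>SL2C\<^esub> p) ** (A 2 [^]\<^bsub>SL2C\<^esub> q) = A 3 [^]\<^bsub>SL2C\<^esub> t}" for x
    unfolding R_Gpqt_eq by (metis (no_types, lifting) gen_mat_tuple_coords image_iff tuple_coords_gen_mat ext)
  moreover have "a [^]\<^bsub>SL2C\<^esub> p \<otimes>\<^bsub>SL2C\<^esub> b [^]\<^bsub>SL2C\<^esub> q = c [^]\<^bsub>SL2C\<^esub> t \<longleftrightarrow>
      b [^]\<^bsub>SL2C\<^esub> ?Q \<otimes>\<^bsub>SL2C\<^esub> a [^]\<^bsub>SL2C\<^esub> ?P \<otimes>\<^bsub>SL2C\<^esub> c [^]\<^bsub>SL2C\<^esub> ?T = \<one>\<^bsub>SL2C\<^esub>"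
    if abc: "a \<in> carrier SL2C" "b \<in> carrier SL2C" "c \<in> carrier SL2C" for a b c
  proof -
    have neg: "y [^]\<^bsub>SL2C\<^esub> r = inv\<^bsub>SL2C\<^esub> (y [^]\<^bsub>SL2C\<^esub> nat (- r))" if "r < 0" for y and r :: int
      unfolding int_pow_def2[of SL2C y r] using that by simp
    have pos: "c [^]\<^bsub>SL2C\<^esub> t = c [^]\<^bsub>SL2C\<^esub> ?T"
      unfolding int_pow_def2[of SL2C c t] using assms by simp
    have cl: "a [^]\<^bsub>SL2C\<^esub> ?P \<in> carrier SL2C" "b [^]\<^bsub>SL2C\<^esub> ?Q \<in> carrier SL2C"
        "c [^]\<^bsub>SL2C\<^esub> ?T \<in> carrier SL2C" using abc by simp_all
    have "a [^]\<^bsub>SL2C\<^esub> p \<otimes>\<^bsub>SL2C\<^esub> b [^]\<^bsub>SL2C\<^esub> q =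
        inv\<^bsub>SL2C\<^esub> (b [^]\<^bsub>SL2C\<^esub> ?Q \<otimes>\<^bsub>SL2C\<^esub> a [^]\<^bsub>SL2C\<^esub> ?P)"
      using cl by (simp only: neg[OF assms(1)] neg[OF assms(2)] inv_mult_group)
    then show ?thesis unfolding pos
      using cl by (metis inv_equality inv_inv m_closed r_inv inv_closed)
  qed
  ultimately show ?thesis
    unfolding SL2C_simps relation_set_def set_eq_iff mem_Collect_eq by blast
qed

text \<open>In \<open>SL\<^sub>2\<close> the inverse is \<open>tr A - A\<close>; its entries are thus polynomials in those of \<open>A\<close>.\<close>

lemma SL2C_inverse:
  fixes A :: "complex^2^2"
  assumes "det A = 1"
  shows "A ** (mat (trace A) - A) = mat 1" "(mat (trace A) - A) ** A = mat 1"
  using assms by (auto simp: matrix_2_eq_iff matrix_mult_2_nth mat_def trace_2 det_2 algebra_simps)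

section \<open>Growth of the representation variety\<close>

definition entries :: "('a \<Rightarrow> complex^2^2) \<Rightarrow> ('a \<Rightarrow> complex) set" where
  "entries X = {\<lambda>x. X x $ 1 $ 1, \<lambda>x. X x $ 1 $ 2, \<lambda>x. X x $ 2 $ 1, \<lambda>x. X x $ 2 $ 2}"

definition poly_matrix :: "('a \<Rightarrow> complex) set \<Rightarrow> ('a \<Rightarrow> complex^2^2) \<Rightarrow> bool" where
  "poly_matrix F X \<longleftrightarrow> (\<exists>e. \<forall>i j. poly_deg_le F e (\<lambda>x. X x $ i $ j))"

lemma poly_matrix_entries: "entries X \<subseteq> F \<Longrightarrow> poly_matrix F X"
  unfolding poly_matrix_def entries_def forall_2
  using poly_deg_le.gen[of _ F 0] by (intro exI[of _ "Suc 0"]) auto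

lemma poly_matrix_const: "poly_matrix F (\<lambda>x. A)"
  unfolding poly_matrix_def by (auto intro: poly_deg_le.const)

lemma poly_matrix_mult:
  assumes "poly_matrix F X" "poly_matrix F Y"
  shows "poly_matrix F (\<lambda>x. X x ** Y x)"
proof -
  obtain d where "\<And>i j. poly_deg_le F d (\<lambda>x. X x $ i $ j)" using assms(1) poly_matrix_def by metis
  moreover obtain e where "\<And>i j. poly_deg_le F e (\<lambda>x. Y x $ i $ j)" using assms(2) poly_matrix_def by metis
  ultimately have "poly_deg_le F (d + e) (\<lambda>x. (X x ** Y x) $ i $ j)" for i j
    unfolding matrix_mult_2_nth by (intro poly_deg_le.add poly_deg_le.mult) auto
  then show ?thesis unfolding poly_matrix_def by blast
qed

lemma poly_matrix_pow:
  assumes "poly_matrix F X"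
  shows "poly_matrix F (\<lambda>x. X x [^]\<^bsub>SL2C\<^esub> (n::nat))"
proof (induction n)
  case 0
  then show ?case by (simp add: SL2C_pow_0 poly_matrix_const)
next
  case (Suc n)
  then show ?case unfolding SL2C_pow_Suc by (intro poly_matrix_mult assms)
qed

lemma poly_matrix_inverse:
  assumes "poly_matrix F X"
  shows "poly_matrix F (\<lambda>x. mat (trace (X x)) - X x)"
proof -
  obtain d where d: "\<And>i j. poly_deg_le F d (\<lambda>x. X x $ i $ j)" using assms(1) poly_matrix_def by metis
  have "poly_deg_le F d (\<lambda>x. (mat (trace (X x)) - X x) $ i $ j)" for i j
  proof -
    have "poly_deg_le F d (\<lambda>x. (mat (trace (X x)) :: complex^2^2) $ i $ j)"
      by (cases "i = j") (auto simp: mat_def trace_2 intro!: poly_deg_le.add poly_deg_le.const d)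
    from poly_deg_le_diff[OF this d] show ?thesis by simp
  qed
  then show ?thesis unfolding poly_matrix_def by blast
qed

text \<open>Once the trace is given, the off-diagonal entries are the only free ones: the first diagonal
  entry is a root of \<open>a\<^sup>2 - (tr X) a + 1 + b c\<close>.\<close>

lemma growth_entries_of_trace:
  assumes "growth V (insert (\<lambda>x. trace (X x)) F) k" "\<And>x. x \<in> V \<Longrightarrow> det (X x) = 1"
  shows "growth V (F \<union> entries X) (k + 2)"
proof -
  let ?s = "\<lambda>x. trace (X x)" and ?a = "\<lambda>x. X x $ 1 $ 1" and ?b = "\<lambda>x. X x $ 1 $ 2"
    and ?c = "\<lambda>x. X x $ 2 $ 1" and ?d = "\<lambda>x. X x $ 2 $ 2"
  let ?G = "insert ?c (insert ?b (insert ?s F))"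
  have G: "growth V ?G (Suc (Suc k))" by (intro growth_insert_free assms)
  have gen: "poly_deg_le ?G 1 ?s" "poly_deg_le ?G 1 ?b" "poly_deg_le ?G 1 ?c"
    using poly_deg_le.gen[of _ ?G 0] by auto
  have bc: "poly_deg_le ?G 2 (\<lambda>x. ?b x * ?c x)" using poly_deg_le.mult[OF gen(2,3)] by (simp add: numeral_2_eq_2)
  have Ga: "growth V (insert ?a ?G) (Suc (Suc k))"
  proof (rule growth_insert_integral[OF G, where n = 2])
    show "poly_deg_le ?G 2 (if j = 0 then (\<lambda>x. -1 - ?b x * ?c x) else ?s)" for j :: nat
      using bc poly_deg_le_mono[OF gen(1), of 2 ?G]
      by (auto intro!: poly_deg_le_diff poly_deg_le.const)
    show "?a x ^ 2 = (\<Sum>j<2. (if j = 0 then (\<lambda>x. -1 - ?b x * ?c x) else ?s) x * ?a x ^ j)"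
      if "x \<in> V" for x
      using assms(2)[OF that] by (simp add: numeral_2_eq_2 det_2 trace_2 algebra_simps)
  qed
  have "growth V (insert ?d (insert ?a ?G)) (Suc (Suc k))"
  proof (rule growth_insert_poly[OF Ga])
    show "poly_deg_le (insert ?a ?G) 1 (\<lambda>x. ?s x - ?a x)"
      using poly_deg_le.gen[of _ "insert ?a ?G" 0] by (intro poly_deg_le_diff) auto
  qed (simp add: trace_2)
  then show ?thesis by (rule growth_mono) (auto simp: entries_def)
qed

lemma growth_entries_free:
  assumes "growth V F k" "\<And>x. x \<in> V \<Longrightarrow> det (X x) = 1"
  shows "growth V (F \<union> entries X) (k + 3)"
  using growth_entries_of_trace[OF growth_insert_free[OF assms(1)] assms(2)]
  by (simp add: eval_nat_numeral)

text \<open>Here the trace is a root of a fixed monic polynomial, so only the two dimensions of a conjugacy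
  class are added.\<close>

lemma growth_entries_finite_order:
  assumes "growth V F k" "\<And>x. x \<in> V \<Longrightarrow> det (X x) = 1"
    and "\<And>x. x \<in> V \<Longrightarrow> poly (cheb n) (trace (X x)) = 0" "n \<ge> 2"
  shows "growth V (F \<union> entries X) (k + 2)"
proof (rule growth_entries_of_trace[OF _ assms(2)])
  obtain m where n: "n = Suc m" "m > 0" using assms(4) by (cases n) auto
  show "growth V (insert (\<lambda>x. trace (X x)) F) k"
  proof (rule growth_insert_root[OF assms(1)])
    show "poly_deg_le F 0 (\<lambda>x. 0)" by (rule poly_deg_le.const)
    show "lead_coeff (cheb n) = 1" "degree (cheb n) > 0"
      using n lead_coeff_cheb[of m] degree_cheb[of m] by simp_all
  qed (use assms in auto)
qed

text \<open>A matrix root costs nothing: the trace of \<open>X\<close> is integral over the trace of \<open>N = X\<^sup>n\<close>, and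
  \<open>X = (N + u\<^sub>n\<^sub>-\<^sub>1(tr X)) / u\<^sub>n(tr X)\<close> where the denominator does not vanish.\<close>

lemma growth_entries_root:
  assumes "growth V F k" "\<And>x. x \<in> V \<Longrightarrow> det (X x) = 1"
    and "\<And>x. x \<in> V \<Longrightarrow> poly (cheb n) (trace (X x)) \<noteq> 0" "n \<ge> 1"
    and "\<And>x. x \<in> V \<Longrightarrow> X x [^]\<^bsub>SL2C\<^esub> n = N x" "poly_matrix F N"
  shows "growth V (F \<union> entries X) k"
proof -
  obtain m where n: "n = Suc m" using assms(4) by (cases n) auto
  let ?s = "\<lambda>x. trace (X x)" and ?y = "\<lambda>x. inverse (poly (cheb n) (trace (X x)))"
  obtain e where e: "\<And>i j. poly_deg_le F e (\<lambda>x. N x $ i $ j)" using assms(6) poly_matrix_def by metis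
  have s: "growth V (insert ?s F) k"
  proof (rule growth_insert_root[OF assms(1)])
    show "poly_deg_le F e (\<lambda>x. trace (N x))" unfolding trace_2 by (intro poly_deg_le.add e)
    show "lead_coeff (cheb_trace m) = 1" by (rule lead_coeff_cheb_trace)
    show "degree (cheb_trace m) > 0" by (simp add: degree_cheb_trace)
    show "poly (cheb_trace m) (?s x) = trace (N x)" if "x \<in> V" for x
      using assms(5)[OF that] trace_SL2C_pow[OF assms(2)[OF that]] n by metis
  qed
  have gen: "poly_deg_le G 1 ?s" if "?s \<in> G" for G
    using poly_deg_le.gen[OF that, of 0] by simp
  have base: "growth V (insert ?y (insert ?s F)) k" (is "growth V ?G k")
  proof (rule growth_insert_inverse[OF s])
    show "poly_deg_le (insert ?s F) (degree (cheb n) * 1) (\<lambda>x. poly (cheb n) (?s x))"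
      by (intro poly_deg_le_poly gen) auto
  qed (use assms(3) in auto)
  have ins: "growth V (insert (\<lambda>x. X x $ i $ j) G) k" if G: "growth V G k" "?G \<subseteq> G" for G i j
  proof (rule growth_insert_poly[OF G(1)])
    let ?d = "e + degree (cheb m)"
    have "poly_deg_le G (degree (cheb m) * 1) (\<lambda>x. poly (cheb m) (?s x))"
      by (intro poly_deg_le_poly gen) (use G in auto)
    then have "poly_deg_le G ?d (\<lambda>x. poly (cheb m) (?s x))" by (rule poly_deg_le_mono) auto
    from poly_deg_le.mult[OF this poly_deg_le.const[of G 0 "mat 1 $ i $ j"]]
    have 1: "poly_deg_le G ?d (\<lambda>x. poly (cheb m) (?s x) * mat 1 $ i $ j)" by simp
    have 2: "poly_deg_le G ?d (\<lambda>x. N x $ i $ j)" using e[of i j] by (rule poly_deg_le_mono) (use G in auto)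
    show "poly_deg_le G (?d + 1) (\<lambda>x. (N x $ i $ j + poly (cheb m) (?s x) * mat 1 $ i $ j) * ?y x)"
      by (intro poly_deg_le.mult poly_deg_le.add 1 2) (use poly_deg_le.gen[of ?y G 0] G in auto)
    show "X x $ i $ j = (N x $ i $ j + poly (cheb m) (?s x) * mat 1 $ i $ j) * ?y x" if "x \<in> V" for x
      using SL2C_pow_nth[OF assms(2)[OF that], of m i j] assms(3)[OF that] assms(5)[OF that]
      unfolding n by (simp add: field_simps)
  qed
  have "growth V (insert (\<lambda>x. X x $ 1 $ 1) (insert (\<lambda>x. X x $ 1 $ 2)
      (insert (\<lambda>x. X x $ 2 $ 1) (insert (\<lambda>x. X x $ 2 $ 2) ?G)))) k"
    by (intro base ins) auto
  then show ?thesis by (rule growth_mono) (auto simp: entries_def)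
qed

lemma SL2C_cyclic:
  fixes A B C :: "complex^2^2"
  assumes "det A = 1" "det B = 1" "det C = 1" "B ** A ** C = mat 1"
  shows "A = (mat (trace B) - B) ** (mat (trace C) - C)"
    "B = (mat (trace C) - C) ** (mat (trace A) - A)"
    "C = (mat (trace A) - A) ** (mat (trace B) - B)"
proof -
  interpret group SL2C by (rule group_SL2C)
  have inv: "inv\<^bsub>SL2C\<^esub> X = mat (trace X) - X" if "det X = 1" for X
  proof (rule inv_equality)
    show "(mat (trace X) - X) \<otimes>\<^bsub>SL2C\<^esub> X = \<one>\<^bsub>SL2C\<^esub>" using SL2C_inverse(2)[OF that] by (simp add: SL2C_simps)
    have "det (mat (trace X) - X) * det X = 1"
      using SL2C_inverse(2)[OF that] by (metis det_mul det_I)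
    then show "mat (trace X) - X \<in> carrier SL2C" using that by (simp add: SL2C_simps)
  qed (use that in \<open>simp add: SL2C_simps\<close>)
  have c: "A \<in> carrier SL2C" "B \<in> carrier SL2C" "C \<in> carrier SL2C" using assms by (simp_all add: SL2C_simps)
  have rel: "B \<otimes>\<^bsub>SL2C\<^esub> A \<otimes>\<^bsub>SL2C\<^esub> C = \<one>\<^bsub>SL2C\<^esub>" using assms by (simp add: SL2C_simps)
  have BA: "B \<otimes>\<^bsub>SL2C\<^esub> A = inv\<^bsub>SL2C\<^esub> C" using rel c by (metis inv_equality m_closed)
  have "A = inv\<^bsub>SL2C\<^esub> B \<otimes>\<^bsub>SL2C\<^esub> inv\<^bsub>SL2C\<^esub> C" using BA c by (metis inv_closed inv_solve_left)
  then show "A = (mat (trace B) - B) ** (mat (trace C) - C)" using assms inv by (simp add: SL2C_simps)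
  have "B = inv\<^bsub>SL2C\<^esub> C \<otimes>\<^bsub>SL2C\<^esub> inv\<^bsub>SL2C\<^esub> A" using BA c by (metis inv_closed inv_solve_right)
  then show "B = (mat (trace C) - C) ** (mat (trace A) - A)" using assms inv by (simp add: SL2C_simps)
  have "C = inv\<^bsub>SL2C\<^esub> A \<otimes>\<^bsub>SL2C\<^esub> inv\<^bsub>SL2C\<^esub> B"
    using BA c by (metis inv_inv inv_mult_group)
  then show "C = (mat (trace A) - A) ** (mat (trace B) - B)" using assms inv by (simp add: SL2C_simps)
qed

lemma coordinates_eq_entries:
  "coordinates = entries (gen_mat 1) \<union> entries (gen_mat 2) \<union> entries (gen_mat 3)"
proof -
  have "(\<lambda>x. x $ (k, i, j)) \<in> entries (gen_mat 1) \<union> entries (gen_mat 2) \<union> entries (gen_mat 3)"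
    for k :: 3 and i j :: 2
    using exhaust_3[of k] exhaust_2[of i] exhaust_2[of j] by (elim disjE) (simp_all add: entries_def)
  then show ?thesis by (auto simp: entries_def)
qed

text \<open>Four pieces: on three of them one matrix is a root of an expression in the other two, which
  are unconstrained (3 + 3), and on the last all three matrices have one of finitely many traces
  (2 + 2 + 2).\<close>

lemma growth_relation_set:
  assumes "P \<ge> 2" "Q \<ge> 2" "T \<ge> 2"
  shows "growth (relation_set P Q T) coordinates 6"
proof -
  let ?R = "relation_set P Q T"
  let ?u = "\<lambda>n k x. poly (cheb n) (trace (gen_mat k x))"
  have det: "det (gen_mat k x) = 1" if "x \<in> ?R" for k x using that by (simp add: relation_set_def)
  have cyc: "gen_mat 1 x [^]\<^bsub>SL2C\<^esub> P = (mat (trace (gen_mat 2 x [^]\<^bsub>SL2C\<^esub> Q)) - gen_mat 2 x [^]\<^bsub>SL2C\<^esub> Q) **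
        (mat (trace (gen_mat 3 x [^]\<^bsub>SL2C\<^esub> T)) - gen_mat 3 x [^]\<^bsub>SL2C\<^esub> T)"
      "gen_mat 2 x [^]\<^bsub>SL2C\<^esub> Q = (mat (trace (gen_mat 3 x [^]\<^bsub>SL2C\<^esub> T)) - gen_mat 3 x [^]\<^bsub>SL2C\<^esub> T) **
        (mat (trace (gen_mat 1 x [^]\<^bsub>SL2C\<^esub> P)) - gen_mat 1 x [^]\<^bsub>SL2C\<^esub> P)"
      "gen_mat 3 x [^]\<^bsub>SL2C\<^esub> T = (mat (trace (gen_mat 1 x [^]\<^bsub>SL2C\<^esub> P)) - gen_mat 1 x [^]\<^bsub>SL2C\<^esub> P) **
        (mat (trace (gen_mat 2 x [^]\<^bsub>SL2C\<^esub> Q)) - gen_mat 2 x [^]\<^bsub>SL2C\<^esub> Q)"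
    if "x \<in> ?R" for x
    by (intro SL2C_cyclic det_SL2C_pow det[OF that]; use that in \<open>simp add: relation_set_def\<close>)+
  have free: "growth V (entries (gen_mat j) \<union> entries (gen_mat k)) 6" if "V \<subseteq> ?R" for V j k
  proof -
    have "growth V (({} \<union> entries (gen_mat j)) \<union> entries (gen_mat k)) (0 + 3 + 3)"
      by (intro growth_entries_free growth_empty) (use det that in auto)
    then show ?thesis by simp
  qed
  have N: "poly_matrix (entries (gen_mat j) \<union> entries (gen_mat k))
     (\<lambda>x. (mat (trace (gen_mat j x [^]\<^bsub>SL2C\<^esub> m)) - gen_mat j x [^]\<^bsub>SL2C\<^esub> m) **
       (mat (trace (gen_mat k x [^]\<^bsub>SL2C\<^esub> n)) - gen_mat k x [^]\<^bsub>SL2C\<^esub> n))" for j k and m n :: nat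
    by (intro poly_matrix_mult poly_matrix_inverse poly_matrix_pow poly_matrix_entries) auto
  have 1: "growth {x\<in>?R. ?u P 1 x \<noteq> 0} coordinates 6"
  proof -
    have "growth {x\<in>?R. ?u P 1 x \<noteq> 0}
        ((entries (gen_mat 2) \<union> entries (gen_mat 3)) \<union> entries (gen_mat 1)) 6"
      by (rule growth_entries_root[OF free _ _ _ _ N[of 2 3 Q T], where n = P])
        (use assms det cyc(1) in auto)
    then show ?thesis by (rule growth_mono) (auto simp: coordinates_eq_entries)
  qed
  have 2: "growth {x\<in>?R. ?u Q 2 x \<noteq> 0} coordinates 6"
  proof -
    have "growth {x\<in>?R. ?u Q 2 x \<noteq> 0}
        ((entries (gen_mat 3) \<union> entries (gen_mat 1)) \<union> entries (gen_mat 2)) 6"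
      by (rule growth_entries_root[OF free _ _ _ _ N[of 3 1 T P], where n = Q])
        (use assms det cyc(2) in auto)
    then show ?thesis by (rule growth_mono) (auto simp: coordinates_eq_entries)
  qed
  have 3: "growth {x\<in>?R. ?u T 3 x \<noteq> 0} coordinates 6"
  proof -
    have "growth {x\<in>?R. ?u T 3 x \<noteq> 0}
        ((entries (gen_mat 1) \<union> entries (gen_mat 2)) \<union> entries (gen_mat 3)) 6"
      by (rule growth_entries_root[OF free _ _ _ _ N[of 1 2 P Q], where n = T])
        (use assms det cyc(3) in auto)
    then show ?thesis by (rule growth_mono) (auto simp: coordinates_eq_entries)
  qed
  have 4: "growth {x\<in>?R. ?u P 1 x = 0 \<and> ?u Q 2 x = 0 \<and> ?u T 3 x = 0} coordinates 6"
    (is "growth ?V _ _")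
  proof -
    have "growth ?V ({} \<union> entries (gen_mat 1)) (0 + 2)"
      by (rule growth_entries_finite_order[OF growth_empty, where n = P]) (use assms det in auto)
    then have "growth ?V ({} \<union> entries (gen_mat 1) \<union> entries (gen_mat 2)) (0 + 2 + 2)"
      by (rule growth_entries_finite_order[where n = Q]) (use assms det in auto)
    then have "growth ?V ({} \<union> entries (gen_mat 1) \<union> entries (gen_mat 2) \<union> entries (gen_mat 3)) (0 + 2 + 2 + 2)"
      by (rule growth_entries_finite_order[where n = T]) (use assms det in auto)
    then show ?thesis by (rule growth_mono) (auto simp: coordinates_eq_entries)
  qed
  show ?thesis
    by (rule growth_mono[OF growth_Un[OF growth_Un[OF 1 2] growth_Un[OF 3 4]]]) auto
qed

section \<open>Chains from holomorphic parametrizations\<close>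

lemma holomorphic_on_polynomial_fun:
  assumes "polynomial_fun f" "\<And>i. (\<lambda>z. \<gamma> z $ i) holomorphic_on D"
  shows "(\<lambda>z. f (\<gamma> z)) holomorphic_on D"
  using assms by (induction rule: polynomial_fun.induct) (auto intro!: holomorphic_intros)

text \<open>If \<open>f g = 0\<close> on \<open>W\<close> but \<open>f a \<noteq> 0\<close> and \<open>g b \<noteq> 0\<close>, then along an arc through \<open>a\<close> and \<open>b\<close> the
  function \<open>g\<close> vanishes on the nonempty open set where \<open>f\<close> does not, hence along the whole arc.\<close>

lemma irreducible_set_holomorphic_arcs:
  assumes "W \<noteq> {}"
    and arc: "\<And>a b. a \<in> W \<Longrightarrow> b \<in> W \<Longrightarrow> \<exists>\<gamma> D. open D \<and> connected D \<and>
      (\<forall>i. (\<lambda>z. \<gamma> z $ i) holomorphic_on D) \<and> \<gamma> ` D \<subseteq> W \<and> a \<in> \<gamma> ` D \<and> b \<in> \<gamma> ` D"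
  shows "irreducible_set W"
  unfolding irreducible_set_def
proof (intro conjI allI impI)
  fix f g :: "complex^'a \<Rightarrow> complex"
  assume f: "polynomial_fun f" and g: "polynomial_fun g" and fg: "\<forall>x\<in>W. f x * g x = 0"
  show "(\<forall>x\<in>W. f x = 0) \<or> (\<forall>x\<in>W. g x = 0)"
  proof (rule ccontr)
    assume "\<not> ?thesis"
    then obtain a b where ab: "a \<in> W" "f a \<noteq> 0" "b \<in> W" "g b \<noteq> 0" by blast
    obtain \<gamma> D where *: "open D \<and> connected D \<and> (\<forall>i. (\<lambda>z. \<gamma> z $ i) holomorphic_on D) \<and>
        \<gamma> ` D \<subseteq> W \<and> a \<in> \<gamma> ` D \<and> b \<in> \<gamma> ` D"
      using arc[OF ab(1,3)] by (elim exE)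
    then have D: "open D" "connected D" "\<And>i. (\<lambda>z. \<gamma> z $ i) holomorphic_on D" "\<gamma> ` D \<subseteq> W"
      by simp_all
    obtain z w where zw: "z \<in> D" "a = \<gamma> z" "w \<in> D" "b = \<gamma> w" using * by fast
    have hf: "(\<lambda>z. f (\<gamma> z)) holomorphic_on D" and hg: "(\<lambda>z. g (\<gamma> z)) holomorphic_on D"
      by (rule holomorphic_on_polynomial_fun[OF f D(3)], rule holomorphic_on_polynomial_fun[OF g D(3)])
    let ?s = "{z \<in> D. f (\<gamma> z) \<noteq> 0}"
    have "open (D \<inter> (\<lambda>z. f (\<gamma> z)) -` (- {0}))"
      by (intro continuous_open_preimage holomorphic_on_imp_continuous_on hf D) auto
    moreover have "D \<inter> (\<lambda>z. f (\<gamma> z)) -` (- {0}) = ?s" by auto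
    ultimately have "open ?s" by simp
    moreover have "?s \<noteq> {}" using zw ab by auto
    moreover have "g (\<gamma> u) = 0" if "u \<in> ?s" for u using that fg D(4) by auto
    ultimately have "g (\<gamma> w) = 0"
      using analytic_continuation_open[OF _ D(1) _ D(2) _ hg holomorphic_on_const _ zw(3), of ?s 0]
      by blast
    then show False using zw ab by simp
  qed
qed fact

text \<open>Parameters form a sequence whose entries beyond the first \<open>n\<close> are zero, so that polydiscs of
  different dimensions are nested.\<close>

definition polydisc :: "real \<Rightarrow> nat \<Rightarrow> (nat \<Rightarrow> complex) set" where
  "polydisc \<delta> n = {u. (\<forall>j\<ge>n. u j = 0) \<and> (\<forall>j. norm (u j) < \<delta>)}"

definition segment :: "(nat \<Rightarrow> complex) \<Rightarrow> (nat \<Rightarrow> complex) \<Rightarrow> complex \<Rightarrow> nat \<Rightarrow> complex" where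
  "segment a b z = (\<lambda>j. a j + z * (b j - a j))"

lemma polydisc_segment:
  assumes "a \<in> polydisc \<delta> n" "b \<in> polydisc \<delta> n" "\<delta> > 0"
  shows "open {z. segment a b z \<in> polydisc \<delta> n}" "connected {z. segment a b z \<in> polydisc \<delta> n}"
proof -
  let ?H = "\<lambda>j. (\<lambda>z. a j + z * (b j - a j)) -` ball 0 \<delta>"
  have eq: "{z. segment a b z \<in> polydisc \<delta> n} = (\<Inter>j\<in>{..<n}. ?H j)"
  proof (intro Set.set_eqI iffI)
    fix z assume z: "z \<in> (\<Inter>j\<in>{..<n}. ?H j)"
    have "norm (a j + z * (b j - a j)) < \<delta>" for j
      using assms z by (cases "j < n") (auto simp: polydisc_def)
    then show "z \<in> {z. segment a b z \<in> polydisc \<delta> n}"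
      using assms by (auto simp: polydisc_def segment_def)
  next
    fix z assume "z \<in> {z. segment a b z \<in> polydisc \<delta> n}"
    then have "norm (a j + z * (b j - a j)) < \<delta>" for j by (simp add: polydisc_def segment_def)
    then show "z \<in> (\<Inter>j\<in>{..<n}. ?H j)" by simp
  qed
  have "open (?H j)" for j
    by (intro open_vimage continuous_intros) auto
  then show "open {z. segment a b z \<in> polydisc \<delta> n}" unfolding eq by auto
  have "convex (?H j)" for j
  proof -
    have "dist 0 (a j + (u * x + v * y) * (b j - a j)) < \<delta>"
      if "x \<in> ?H j" "y \<in> ?H j" "0 \<le> u" "0 \<le> v" "u + v = 1" for x y :: complex and u v :: real
    proof -
      have "u *\<^sub>R (a j + x * (b j - a j)) + v *\<^sub>R (a j + y * (b j - a j)) \<in> ball 0 \<delta>"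
        by (rule convexD[OF convex_ball]) (use that in auto)
      moreover have "u *\<^sub>R (a j + x * (b j - a j)) + v *\<^sub>R (a j + y * (b j - a j)) =
          of_real (u + v) * a j + (u * x + v * y) * (b j - a j)"
        by (simp add: scaleR_conv_of_real algebra_simps)
      ultimately show ?thesis using that(5) by simp
    qed
    then show ?thesis unfolding convex_def by (simp add: scaleR_conv_of_real)
  qed
  then have "convex (\<Inter>j\<in>{..<n}. ?H j)" by (intro convex_INT) auto
  then show "connected {z. segment a b z \<in> polydisc \<delta> n}" unfolding eq by (rule convex_connected)
qed

text \<open>The polynomial \<open>F i\<close> detects the parameter with index \<open>i\<close>: it vanishes as long as only the
  earlier parameters are used and does not when this one is switched on. So the closures of the
  images of the polydiscs of dimensions \<open>0, \<dots>, n\<close> increase strictly.\<close>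

lemma chain_top_parametrization:
  assumes "\<delta> > 0" and R: "\<phi> ` polydisc \<delta> n \<subseteq> R"
    and hol: "\<And>a b i. a \<in> polydisc \<delta> n \<Longrightarrow> b \<in> polydisc \<delta> n \<Longrightarrow>
      (\<lambda>z. \<phi> (segment a b z) $ i) holomorphic_on {z. segment a b z \<in> polydisc \<delta> n}"
    and poly: "\<And>i. i < n \<Longrightarrow> polynomial_fun (F i)"
    and zero: "\<And>i u. i < n \<Longrightarrow> u \<in> polydisc \<delta> i \<Longrightarrow> F i (\<phi> u) = 0"
    and nonzero: "\<And>i. i < n \<Longrightarrow> F i (\<phi> (\<lambda>j. if j = i then of_real (\<delta> / 2) else 0)) \<noteq> 0"
  shows "chain_top R n (zariski_closure R (\<phi> ` polydisc \<delta> n))"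
proof -
  have mono: "polydisc \<delta> i \<subseteq> polydisc \<delta> j" if "i \<le> j" for i j
    using that by (auto simp: polydisc_def)
  have sub: "\<phi> ` polydisc \<delta> i \<subseteq> R" if "i \<le> n" for i using R mono[OF that] by blast
  have irr: "irreducible_set (\<phi> ` polydisc \<delta> i)" if i: "i \<le> n" for i
  proof (rule irreducible_set_holomorphic_arcs)
    have "(\<lambda>_. 0) \<in> polydisc \<delta> i" using assms(1) by (simp add: polydisc_def)
    then show "\<phi> ` polydisc \<delta> i \<noteq> {}" by blast
    fix x y assume "x \<in> \<phi> ` polydisc \<delta> i" "y \<in> \<phi> ` polydisc \<delta> i"
    then obtain a b where ab: "a \<in> polydisc \<delta> i" "b \<in> polydisc \<delta> i" "x = \<phi> a" "y = \<phi> b" by blast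
    then have ab': "a \<in> polydisc \<delta> n" "b \<in> polydisc \<delta> n" using mono[OF i] by auto
    let ?D = "{z. segment a b z \<in> polydisc \<delta> n}"
    have "segment a b z \<in> polydisc \<delta> i" if "z \<in> ?D" for z
      using that ab by (auto simp: polydisc_def segment_def)
    moreover have "segment a b 0 = a" "segment a b 1 = b" by (auto simp: segment_def)
    then have "0 \<in> ?D" "x = \<phi> (segment a b 0)" "1 \<in> ?D" "y = \<phi> (segment a b 1)"
      using ab ab' by auto
    ultimately show "\<exists>\<gamma> D. open D \<and> connected D \<and> (\<forall>i. (\<lambda>z. \<gamma> z $ i) holomorphic_on D) \<and>
        \<gamma> ` D \<subseteq> \<phi> ` polydisc \<delta> i \<and> x \<in> \<gamma> ` D \<and> y \<in> \<gamma> ` D"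
      using polydisc_segment[OF ab' assms(1)] hol[OF ab']
      by (intro exI[of _ "\<lambda>z. \<phi> (segment a b z)"] exI[of _ ?D]) blast
  qed
  let ?Z = "\<lambda>i. zariski_closure R (\<phi> ` polydisc \<delta> i)"
  have "?Z i \<subset> ?Z (Suc i)" if i: "i < n" for i
  proof -
    let ?u = "\<lambda>j. if j = i then of_real (\<delta> / 2) else 0 :: complex"
    have "?Z i \<subseteq> ?Z (Suc i)" using mono[of i "Suc i"] by (auto simp: zariski_closure_def)
    moreover have "?u \<in> polydisc \<delta> (Suc i)" using assms(1) by (auto simp: polydisc_def)
    then have "\<phi> ?u \<in> ?Z (Suc i)" using zariski_closure_superset[OF sub[of "Suc i"]] i by auto
    moreover have "\<phi> ?u \<notin> ?Z i"
    proof
      assume "\<phi> ?u \<in> ?Z i"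
      then have "F i (\<phi> ?u) = 0"
        by (rule zariski_closure_vanish[rotated 2]) (use poly zero i in auto)
      then show False using nonzero[OF i] by simp
    qed
    ultimately show ?thesis by blast
  qed
  moreover have "irreducible_set (?Z i)" if "i \<le> n" for i
    by (rule irreducible_set_zariski_closure[OF irr[OF that] sub[OF that]])
  ultimately show ?thesis unfolding chain_top_def
    by (intro exI[of _ ?Z]) (simp add: zariski_closure_idem)
qed

section \<open>Products of conjugacy classes\<close>

text \<open>The lower triangular matrix with eigenvalues \<open>\<mu>, 1/\<mu>\<close> and lower left entry \<open>y\<close>, conjugated by
  the unipotent matrix \<open>[[1, x], [0, 1]]\<close>.\<close>

definition class_matrix :: "complex \<Rightarrow> complex \<Rightarrow> complex \<Rightarrow> complex^2^2" where
  "class_matrix \<mu> x y = (\<chi> i j. if i = 1 then (if j = 1 then \<mu> + x * y else x * (1 / \<mu> - \<mu>) - x^2 * y)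
     else (if j = 1 then y else 1 / \<mu> - x * y))"

lemma class_matrix_nth:
  "class_matrix \<mu> x y $ 1 $ 1 = \<mu> + x * y"
  "class_matrix \<mu> x y $ 1 $ 2 = x * (1 / \<mu> - \<mu>) - x^2 * y"
  "class_matrix \<mu> x y $ 2 $ 1 = y"
  "class_matrix \<mu> x y $ 2 $ 2 = 1 / \<mu> - x * y"
  by (simp_all add: class_matrix_def)

lemma det_class_matrix: "\<mu> \<noteq> 0 \<Longrightarrow> det (class_matrix \<mu> x y) = 1"
  by (simp add: det_2 class_matrix_nth algebra_simps power2_eq_square)

lemma trace_class_matrix: "trace (class_matrix \<mu> x y) = \<mu> + 1 / \<mu>"
  by (simp add: trace_2 class_matrix_nth)

definition gen_offset :: "3 \<Rightarrow> nat" where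
  "gen_offset k = (if k = 1 then 0 else if k = 2 then 2 else 4)"

lemma polynomial_fun_trace: "polynomial_fun (\<lambda>x. trace (gen_mat k x))"
  unfolding trace_2 gen_mat_nth by (intro polynomial_fun.intros)

text \<open>For any parameters the \<open>N k\<close>-th power of the matrix with index \<open>k\<close> is the scalar \<open>\<epsilon> k\<close>, so the
  relation holds. The six off-diagonal entries detect the six parameters. The traces are constant on the
  image of the parametrization and therefore on its closure.\<close>

lemma chain_top_classes:
  fixes \<mu> \<epsilon> :: "3 \<Rightarrow> complex" and N :: "3 \<Rightarrow> nat"
  assumes "\<And>k. \<mu> k \<noteq> 0" "\<And>k. \<mu> k ^ 2 \<noteq> 1" "\<And>k. \<mu> k ^ N k = \<epsilon> k" "\<And>k. \<epsilon> k ^ 2 = 1"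
    "\<And>k. N k > 0" "\<epsilon> 1 * \<epsilon> 2 * \<epsilon> 3 = 1"
  shows "\<exists>W. chain_top (relation_set (N 1) (N 2) (N 3)) 6 W \<and>
    (\<forall>x\<in>W. \<forall>k. trace (gen_mat k x) = \<mu> k + 1 / \<mu> k)"
proof -
  let ?R = "relation_set (N 1) (N 2) (N 3)"
  define \<phi> :: "(nat \<Rightarrow> complex) \<Rightarrow> complex^(3 \<times> 2 \<times> 2)" where
    "\<phi> u = tuple_coords (\<lambda>k. class_matrix (\<mu> k) (u (gen_offset k)) (u (Suc (gen_offset k))))" for u
  have gen: "gen_mat k (\<phi> u) = class_matrix (\<mu> k) (u (gen_offset k)) (u (Suc (gen_offset k)))" for k u
    by (simp add: \<phi>_def)
  have coord: "\<phi> u $ (k, i, j) = class_matrix (\<mu> k) (u (gen_offset k)) (u (Suc (gen_offset k))) $ i $ j"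
    for k i j u
    using gen[of k u] by (metis gen_mat_nth)
  define F :: "nat \<Rightarrow> complex^(3 \<times> 2 \<times> 2) \<Rightarrow> complex" where
    "F i x = x $ ([(1, 1, 2), (1, 2, 1), (2, 1, 2), (2, 2, 1), (3, 1, 2), (3, 2, 1)] ! i)" for i x
  have less6: "i = 0 \<or> i = 1 \<or> i = 2 \<or> i = 3 \<or> i = 4 \<or> i = 5" if "i < 6" for i :: nat
    using that by linarith
  have ne: "1 / \<mu> k - \<mu> k \<noteq> 0" for k
    using assms(1,2)[of k] by (auto simp: field_simps power2_eq_square)
  have "chain_top ?R 6 (zariski_closure ?R (\<phi> ` polydisc 1 6))"
  proof (rule chain_top_parametrization)
    show "\<phi> ` polydisc 1 6 \<subseteq> ?R"
    proof (rule image_subsetI)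
      fix u
      have pow: "gen_mat k (\<phi> u) [^]\<^bsub>SL2C\<^esub> N k = mat (\<epsilon> k)" for k
        by (rule SL2C_pow_scalar[of _ "\<mu> k"])
          (use assms in \<open>auto simp: gen det_class_matrix trace_class_matrix\<close>)
      have "mat a ** mat b = (mat (a * b) :: complex^2^2)" for a b
        by (simp add: matrix_2_eq_iff matrix_mult_2_nth mat_def)
      then show "\<phi> u \<in> ?R"
        using assms(1,6) by (simp add: relation_set_def pow gen[symmetric] mult_ac)
          (simp add: gen det_class_matrix)
    qed
    show "(\<lambda>z. \<phi> (segment a b z) $ i) holomorphic_on {z. segment a b z \<in> polydisc 1 6}" for a b i
    proof -
      obtain k j l where i: "i = (k, j, l)" by (cases i)
      have "(j = 1 \<or> j = 2) \<and> (l = 1 \<or> l = 2)" using exhaust_2 by auto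
      then show ?thesis unfolding i coord segment_def
        by (elim conjE disjE) (auto simp: class_matrix_nth intro!: holomorphic_intros)
    qed
    show "polynomial_fun (F i)" if "i < 6" for i
      unfolding F_def by (rule polynomial_fun.coord)
    show "F i (\<phi> u) = 0" if "i < 6" "u \<in> polydisc 1 i" for i u
      using less6[OF that(1)] that(2)
      by (elim disjE) (simp_all add: F_def coord class_matrix_nth polydisc_def gen_offset_def)
    show "F i (\<phi> (\<lambda>j. if j = i then of_real (1 / 2) else 0)) \<noteq> 0" if "i < 6" for i
      using less6[OF that] ne
      by (elim disjE) (simp_all add: F_def coord class_matrix_nth polydisc_def gen_offset_def)
  qed simp
  moreover have "trace (gen_mat k x) = \<mu> k + 1 / \<mu> k"
    if "x \<in> zariski_closure ?R (\<phi> ` polydisc 1 6)" for k x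
  proof -
    have "trace (gen_mat k x) - (\<mu> k + 1 / \<mu> k) = 0"
      by (rule zariski_closure_vanish[OF _ _ that])
        (auto simp: gen trace_class_matrix intro!: polynomial_fun_diff polynomial_fun_trace polynomial_fun.const)
    then show ?thesis by simp
  qed
  ultimately show ?thesis by blast
qed

text \<open>Excluding \<open>j = 0\<close> and \<open>j = n\<close> keeps the root of unity off the real axis.\<close>

lemma cis_root:
  assumes "0 < j" "j < n"
  defines "\<mu> \<equiv> cis (pi * real j / real n)"
  shows "\<mu> \<noteq> 0" "\<mu> ^ 2 \<noteq> 1" "\<mu> ^ n = (-1) ^ j" "\<mu> + 1 / \<mu> = of_real (2 * cos (pi * real j / real n))"
proof -
  have \<theta>: "0 < pi * real j / real n" "pi * real j / real n < pi"
    using assms(1,2) by (auto simp: field_simps)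
  have "Im \<mu> > 0" using sin_gt_zero[OF \<theta>] by (simp add: \<mu>_def)
  then show "\<mu> ^ 2 \<noteq> 1" by (auto simp: power2_eq_1_iff)
  show "\<mu> \<noteq> 0" by (simp add: \<mu>_def)
  have "\<mu> ^ n = cis (real j * pi)" using assms(1,2) by (simp add: \<mu>_def Complex.DeMoivre mult.commute)
  also have "\<dots> = cis pi ^ j" by (simp only: Complex.DeMoivre)
  also have "\<dots> = (-1) ^ j" by simp
  finally show "\<mu> ^ n = (-1) ^ j" .
  show "\<mu> + 1 / \<mu> = of_real (2 * cos (pi * real j / real n))"
    by (simp add: \<mu>_def divide_inverse cis_inverse complex_eq_iff)
qed

lemma chain_top_cis_classes:
  fixes j N :: "3 \<Rightarrow> nat"
  assumes "\<And>k. 0 < j k" "\<And>k. j k < N k" "even (j 1 + j 2 + j 3)"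
  shows "\<exists>W. chain_top (relation_set (N 1) (N 2) (N 3)) 6 W \<and>
    (\<forall>x\<in>W. \<forall>k. trace (gen_mat k x) = of_real (2 * cos (pi * real (j k) / real (N k))))"
proof -
  have "(-1) ^ j 1 * (-1) ^ j 2 * (-1) ^ j 3 = (1::complex)"
    using assms(3) by (simp flip: power_add)
  then have "\<exists>W. chain_top (relation_set (N 1) (N 2) (N 3)) 6 W \<and>
    (\<forall>x\<in>W. \<forall>k. trace (gen_mat k x) = cis (pi * real (j k) / real (N k)) + 1 / cis (pi * real (j k) / real (N k)))"
    by (intro chain_top_classes[where \<epsilon> = "\<lambda>k. (-1) ^ j k"] cis_root assms)
      (use assms(2) in \<open>auto simp flip: power_mult simp: power_mult_distrib intro: le_less_trans\<close>)
  then show ?thesis using cis_root(4)[OF assms(1,2)] by simp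
qed

lemma trivial_in_relation_set: "tuple_coords (\<lambda>k. mat 1) \<in> relation_set P Q T"
proof -
  have "(mat 1 :: complex^2^2) [^]\<^bsub>SL2C\<^esub> (n::nat) = mat 1" for n
    using monoid.nat_pow_one[OF group.is_monoid[OF group_SL2C], of n] by (simp add: SL2C_simps)
  then show ?thesis by (simp add: relation_set_def)
qed

text \<open>The eigenvalues \<open>cis (\<pi>/n)\<close> make all three powers \<open>-1\<close>, with product \<open>-1\<close>. An exponent larger
  than 2 leaves room for \<open>cis (2\<pi>/n)\<close> at that place, whose power is \<open>1\<close>.\<close>

lemma chain_top_proper:
  assumes "P \<ge> 2" "Q \<ge> 2" "T \<ge> 2" "P > 2 \<or> Q > 2 \<or> T > 2"
  shows "\<exists>W. chain_top (relation_set P Q T) 6 W \<and> W \<noteq> relation_set P Q T"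
proof -
  define N :: "3 \<Rightarrow> nat" where "N k = (if k = 1 then P else if k = 2 then Q else T)" for k
  have N: "N 1 = P" "N 2 = Q" "N 3 = T" "N k \<ge> 2" for k using assms by (auto simp: N_def)
  obtain m where m: "N m > 2" using assms(4) N(1-3) by metis
  define j :: "3 \<Rightarrow> nat" where "j k = (if k = m then 2 else 1)" for k
  have "even (j 1 + j 2 + j 3)" using exhaust_3[of m] by (elim disjE) (simp_all add: j_def)
  moreover have "j k < N k" for k using m N(4)[of k] by (auto simp: j_def)
  ultimately obtain W where W: "chain_top (relation_set P Q T) 6 W"
      "\<forall>x\<in>W. \<forall>k. trace (gen_mat k x) = of_real (2 * cos (pi * real (j k) / real (N k)))"
    using chain_top_cis_classes[of j N] unfolding N(1-3) by (metis j_def zero_less_numeral zero_less_one)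
  have "tuple_coords (\<lambda>k. mat 1) \<notin> W"
  proof
    assume "tuple_coords (\<lambda>k. mat 1) \<in> W"
    then have "trace (mat 1 :: complex^2^2) = of_real (2 * cos (pi * real (j m) / real (N m)))"
      using W(2) by fastforce
    then have "of_real (2 * cos (pi * real (j m) / real (N m))) = (of_real 2 :: complex)"
      by (simp add: trace_2 mat_1_2_nth)
    then have "2 * cos (pi * real (j m) / real (N m)) = 2" by (simp only: of_real_eq_iff)
    moreover have "cos (pi * real (j m) / real (N m)) < cos 0"
      using m by (intro cos_monotone_0_pi) (auto simp: j_def field_simps)
    ultimately show False by simp
  qed
  then show ?thesis using W(1) trivial_in_relation_set by metis
qed

section \<open>A chain through the trivial representation\<close>

text \<open>Near the identity an element of \<open>SL\<^sub>2\<close> is determined by three of its entries.\<close>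

definition chart :: "complex \<Rightarrow> complex \<Rightarrow> complex \<Rightarrow> complex^2^2" where
  "chart x y z = (\<chi> i j. if i = 1 then (if j = 1 then 1 + x else y)
     else (if j = 1 then z else (1 + y * z) / (1 + x)))"

lemma chart_nth: "chart x y z $ 1 $ 1 = 1 + x" "chart x y z $ 1 $ 2 = y" "chart x y z $ 2 $ 1 = z"
   "chart x y z $ 2 $ 2 = (1 + y * z) / (1 + x)"
  by (simp_all add: chart_def)

lemma det_chart: "1 + x \<noteq> 0 \<Longrightarrow> det (chart x y z) = 1"
  by (simp add: det_2 chart_nth)

text \<open>By Cayley--Hamilton \<open>(N + 1)\<^sup>2 = (tr N + 2) N\<close> for \<open>N\<close> in \<open>SL\<^sub>2\<close>, so \<open>N + 1\<close>
  divided by a square root of \<open>tr N + 2\<close> is a square root of \<open>N\<close>. Here \<open>N = M\<^sup>-\<^sup>1 = tr M - M\<close>, with the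
  same trace as \<open>M\<close>.\<close>

definition square_root_inverse :: "complex^2^2 \<Rightarrow> complex^2^2" where
  "square_root_inverse M = (\<chi> i j. ((if i = j then trace M + 1 else 0) - M $ i $ j) / csqrt (trace M + 2))"

lemma square_root_inverse:
  assumes "det M = 1" "trace M + 2 \<noteq> 0"
  shows "det (square_root_inverse M) = 1"
    "M ** (square_root_inverse M ** square_root_inverse M) = mat 1"
proof -
  define r where "r = csqrt (trace M + 2)"
  have r: "r \<noteq> 0" "r * r = M $ 1 $ 1 + M $ 2 $ 2 + 2"
    using assms(2) power2_csqrt[of "trace M + 2"] by (auto simp: r_def trace_2 power2_eq_square)
  have det: "M $ 1 $ 1 * M $ 2 $ 2 = 1 + M $ 1 $ 2 * M $ 2 $ 1"
    using assms(1) by (simp add: det_2 algebra_simps)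
  have nth: "square_root_inverse M $ 1 $ 1 = (M $ 2 $ 2 + 1) / r"
      "square_root_inverse M $ 1 $ 2 = - M $ 1 $ 2 / r"
      "square_root_inverse M $ 2 $ 1 = - M $ 2 $ 1 / r"
      "square_root_inverse M $ 2 $ 2 = (M $ 1 $ 1 + 1) / r"
    by (simp_all add: square_root_inverse_def trace_2 r_def)
  have "det (square_root_inverse M) = ((M $ 2 $ 2 + 1) * (M $ 1 $ 1 + 1) - M $ 1 $ 2 * M $ 2 $ 1) / (r * r)"
    by (simp add: det_2 nth diff_divide_distrib)
  also have "(M $ 2 $ 2 + 1) * (M $ 1 $ 1 + 1) - M $ 1 $ 2 * M $ 2 $ 1 = r * r"
    using det unfolding r(2) by algebra
  finally show "det (square_root_inverse M) = 1" by (simp add: r(1))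
  have div: "x / (r * r) = y" if "x = y * (r * r)" for x y using that r(1) by simp
  have "(square_root_inverse M ** square_root_inverse M) $ 1 $ 1 =
      ((M $ 2 $ 2 + 1) * (M $ 2 $ 2 + 1) + M $ 1 $ 2 * M $ 2 $ 1) / (r * r)"
    by (simp only: matrix_mult_2_nth nth times_divide_times_eq minus_mult_minus flip: add_divide_distrib)
  also have "\<dots> = M $ 2 $ 2" by (rule div) (use det r(2) in algebra)
  finally have 11: "(square_root_inverse M ** square_root_inverse M) $ 1 $ 1 = M $ 2 $ 2" .
  have "(square_root_inverse M ** square_root_inverse M) $ 1 $ 2 =
      (- ((M $ 2 $ 2 + 1) * M $ 1 $ 2) - M $ 1 $ 2 * (M $ 1 $ 1 + 1)) / (r * r)"
    by (simp add: matrix_mult_2_nth nth diff_divide_distrib)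
  also have "\<dots> = - M $ 1 $ 2" by (rule div) (use r(2) in algebra)
  finally have 12: "(square_root_inverse M ** square_root_inverse M) $ 1 $ 2 = - M $ 1 $ 2" .
  have "(square_root_inverse M ** square_root_inverse M) $ 2 $ 1 =
      (- (M $ 2 $ 1 * (M $ 2 $ 2 + 1)) - (M $ 1 $ 1 + 1) * M $ 2 $ 1) / (r * r)"
    by (simp add: matrix_mult_2_nth nth diff_divide_distrib)
  also have "\<dots> = - M $ 2 $ 1" by (rule div) (use r(2) in algebra)
  finally have 21: "(square_root_inverse M ** square_root_inverse M) $ 2 $ 1 = - M $ 2 $ 1" .
  have "(square_root_inverse M ** square_root_inverse M) $ 2 $ 2 =
      (M $ 2 $ 1 * M $ 1 $ 2 + (M $ 1 $ 1 + 1) * (M $ 1 $ 1 + 1)) / (r * r)"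
    by (simp only: matrix_mult_2_nth nth times_divide_times_eq minus_mult_minus flip: add_divide_distrib)
  also have "\<dots> = M $ 1 $ 1" by (rule div) (use det r(2) in algebra)
  finally have 22: "(square_root_inverse M ** square_root_inverse M) $ 2 $ 2 = M $ 1 $ 1" .
  then have "square_root_inverse M ** square_root_inverse M = mat (trace M) - M"
    by (simp add: matrix_2_eq_iff 11 12 21 22 mat_def trace_2)
  then show "M ** (square_root_inverse M ** square_root_inverse M) = mat 1"
    using SL2C_inverse(1)[OF assms(1)] by simp
qed

definition charted_product :: "(nat \<Rightarrow> complex) \<Rightarrow> complex^2^2" where
  "charted_product u = (chart (u 3) (u 4) (u 5) ** chart (u 3) (u 4) (u 5)) **
     (chart (u 0) (u 1) (u 2) ** chart (u 0) (u 1) (u 2))"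

text \<open>At the parameter 0 the product is the identity and \<open>tr + 2 = 4\<close>; staying in the right half-plane
  keeps \<open>csqrt\<close> holomorphic.\<close>

lemma charted_product_trace_near_0:
  obtains \<delta> where "\<delta> > 0" "\<delta> < 1"
    "\<And>u. (\<And>j. norm (u j) < \<delta>) \<Longrightarrow> Re (trace (charted_product u) + 2) > 0"
proof (rule ccontr)
  assume "\<not> thesis"
  with that have "\<exists>u. (\<forall>j. norm (u j) < \<delta>) \<and> \<not> Re (trace (charted_product u) + 2) > 0"
    if "\<delta> > 0" "\<delta> < 1" for \<delta> using that by blast
  then have "\<exists>u. (\<forall>j. norm (u j) < 1 / real (n + 2)) \<and> \<not> Re (trace (charted_product u) + 2) > 0" for n
    by simp
  then obtain u where u: "\<And>n j. norm (u n j) < 1 / real (n + 2)"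
      "\<And>n. \<not> Re (trace (charted_product (u n)) + 2) > 0" by metis
  have lim: "(\<lambda>n. u n j) \<longlonglongrightarrow> 0" for j
  proof (rule Lim_null_comparison)
    show "\<forall>\<^sub>F n in sequentially. norm (u n j) \<le> 1 / real (n + 2)"
      by (intro always_eventually allI less_imp_le u(1))
    show "(\<lambda>n. 1 / real (n + 2)) \<longlonglongrightarrow> 0"
      using LIMSEQ_ignore_initial_segment[OF lim_inverse_n', of 2] by simp
  qed
  have "(\<lambda>n. Re (trace (charted_product (u n)) + 2)) \<longlonglongrightarrow> Re (trace (charted_product (\<lambda>_. 0)) + 2)"
    unfolding trace_2 charted_product_def matrix_mult_2_nth chart_nth
    by (intro tendsto_intros lim) auto
  moreover have "Re (trace (charted_product (\<lambda>_. 0)) + 2) = 4"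
    by (simp add: trace_2 charted_product_def matrix_mult_2_nth chart_nth)
  ultimately have "\<forall>\<^sub>F n in sequentially. Re (trace (charted_product (u n)) + 2) > 0"
    by (metis order_tendstoD(1) zero_less_numeral)
  then show False using u(2) by (auto simp: eventually_sequentially)
qed

lemma holomorphic_on_matrix_mult:
  fixes X Y :: "complex \<Rightarrow> complex^2^2"
  assumes "\<And>i j. (\<lambda>z. X z $ i $ j) holomorphic_on D" "\<And>i j. (\<lambda>z. Y z $ i $ j) holomorphic_on D"
  shows "(\<lambda>z. (X z ** Y z) $ i $ j) holomorphic_on D"
  unfolding matrix_mult_2_nth by (intro holomorphic_intros assms)

text \<open>With exponents 2, two of the matrices are free and the third is a square root. As both free
  matrices stay near the identity, the square root can be chosen holomorphically.\<close>

lemma chain_top_trivial_component: "\<exists>W. chain_top (relation_set 2 2 2) 6 W"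
proof -
  obtain \<delta> where \<delta>: "\<delta> > 0" "\<delta> < 1"
      "\<And>u. (\<And>j. norm (u j) < \<delta>) \<Longrightarrow> Re (trace (charted_product u) + 2) > 0"
    using charted_product_trace_near_0 by blast
  define \<phi> :: "(nat \<Rightarrow> complex) \<Rightarrow> complex^(3 \<times> 2 \<times> 2)" where
    "\<phi> u = tuple_coords (\<lambda>k. if k = 1 then chart (u 0) (u 1) (u 2) else if k = 2 then chart (u 3) (u 4) (u 5)
       else square_root_inverse (charted_product u))" for u
  have gen: "gen_mat 1 (\<phi> u) = chart (u 0) (u 1) (u 2)" "gen_mat 2 (\<phi> u) = chart (u 3) (u 4) (u 5)"
      "gen_mat 3 (\<phi> u) = square_root_inverse (charted_product u)" for u
    by (simp_all add: \<phi>_def)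
  have coord: "\<phi> u $ (k, i, j) = gen_mat k (\<phi> u) $ i $ j" for k i j u by simp
  have ne: "1 + u j \<noteq> 0" if "u \<in> polydisc \<delta> 6" for u j
  proof
    assume "1 + u j = 0"
    then have "norm (u j) = 1" by (metis add_eq_0_iff norm_minus_cancel norm_one)
    then show False using that \<delta>(2) by (auto simp: polydisc_def dest: spec[of _ j])
  qed
  have tr: "Re (trace (charted_product u) + 2) > 0" if "u \<in> polydisc \<delta> 6" for u
    using that by (intro \<delta>(3)) (auto simp: polydisc_def)
  have tr0: "trace (charted_product u) + 2 \<noteq> 0" if "u \<in> polydisc \<delta> 6" for u
    using tr[OF that] by (metis less_irrefl zero_complex.simps(1))
  define F :: "nat \<Rightarrow> complex^(3 \<times> 2 \<times> 2) \<Rightarrow> complex" where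
    "F i x = x $ ([(1, 1, 1), (1, 1, 2), (1, 2, 1), (2, 1, 1), (2, 1, 2), (2, 2, 1)] ! i)
       - (if i = 0 \<or> i = 3 then 1 else 0)" for i x
  have less6: "i = 0 \<or> i = 1 \<or> i = 2 \<or> i = 3 \<or> i = 4 \<or> i = 5" if "i < 6" for i :: nat
    using that by linarith
  let ?R = "relation_set 2 2 2"
  have "chain_top ?R 6 (zariski_closure ?R (\<phi> ` polydisc \<delta> 6))"
  proof (rule chain_top_parametrization)
    show "\<phi> ` polydisc \<delta> 6 \<subseteq> ?R"
    proof (rule image_subsetI)
      fix u assume u: "u \<in> polydisc \<delta> 6"
      have d: "det (chart (u 0) (u 1) (u 2)) = 1" "det (chart (u 3) (u 4) (u 5)) = 1"
        by (intro det_chart ne u)+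
      then have "det (charted_product u) = 1" by (simp add: charted_product_def det_mul)
      moreover have "trace (charted_product u) + 2 \<noteq> 0" by (rule tr0[OF u])
      ultimately have s: "det (square_root_inverse (charted_product u)) = 1"
          "charted_product u ** (square_root_inverse (charted_product u) ** square_root_inverse (charted_product u)) = mat 1"
        using square_root_inverse by blast+
      have "A [^]\<^bsub>SL2C\<^esub> (2::nat) = A ** A" for A
        using SL2C_pow_Suc[of A 1] SL2C_pow_Suc[of A 0] SL2C_pow_0[of A] by (simp add: numeral_2_eq_2)
      moreover have "det (gen_mat k (\<phi> u)) = 1" for k
        using exhaust_3[of k] d s by (elim disjE) (simp_all add: gen)
      ultimately show "\<phi> u \<in> ?R" using s(2) by (simp add: relation_set_def gen charted_product_def)
    qed
    fix a b and i :: "3 \<times> 2 \<times> 2" assume ab: "a \<in> polydisc \<delta> 6" "b \<in> polydisc \<delta> 6"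
    let ?D = "{z. segment a b z \<in> polydisc \<delta> 6}" and ?u = "segment a b"
    have u: "(\<lambda>z. ?u z j) holomorphic_on ?D" for j
      unfolding segment_def by (intro holomorphic_intros)
    have ij: "(i = 1 \<or> i = 2) \<and> (j = 1 \<or> j = 2)" for i j :: 2 using exhaust_2 by auto
    have ch: "(\<lambda>z. chart (?u z k) (?u z l) (?u z m) $ i $ j) holomorphic_on ?D" for i j k l m
      using ij[of i j] ne by (elim conjE disjE) (auto simp: chart_nth intro!: holomorphic_intros u)
    have M: "(\<lambda>z. charted_product (?u z) $ i $ j) holomorphic_on ?D" for i j
      unfolding charted_product_def by (intro holomorphic_on_matrix_mult ch)
    have T: "(\<lambda>z. trace (charted_product (?u z))) holomorphic_on ?D"
      unfolding trace_2 by (intro holomorphic_intros M)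
    have sq: "(\<lambda>z. csqrt (trace (charted_product (?u z)) + 2)) holomorphic_on ?D"
      by (intro holomorphic_on_csqrt' holomorphic_intros T)
        (use tr in \<open>force simp: complex_nonpos_Reals_iff\<close>)
    have S: "(\<lambda>z. square_root_inverse (charted_product (?u z)) $ i $ j) holomorphic_on ?D" for i j
      unfolding square_root_inverse_def vec_lambda_beta
      by (cases "i = j") (use tr0 in \<open>auto intro!: holomorphic_intros T M sq\<close>)
    obtain k j l where i: "i = (k, j, l)" by (cases i)
    show "(\<lambda>z. \<phi> (?u z) $ i) holomorphic_on ?D"
      unfolding i coord using exhaust_3[of k]
      by (elim disjE) (simp_all only: gen ch S)
  next
    show "polynomial_fun (F i)" if "i < 6" for i
      unfolding F_def by (intro polynomial_fun_diff polynomial_fun.coord polynomial_fun.const)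
    show "F i (\<phi> u) = 0" if "i < 6" "u \<in> polydisc \<delta> i" for i u
      using less6[OF that(1)] that(2)
      by (elim disjE) (simp_all add: F_def coord gen chart_nth polydisc_def del: gen_mat_nth)
    show "F i (\<phi> (\<lambda>j. if j = i then of_real (\<delta> / 2) else 0)) \<noteq> 0" if "i < 6" for i
      using less6[OF that] \<delta>(1)
      by (elim disjE) (simp_all add: F_def coord gen chart_nth del: gen_mat_nth)
  qed (fact \<delta>(1))
  then show ?thesis by blast
qed

lemma chain_top_relation_set:
  assumes "P \<ge> 2" "Q \<ge> 2" "T \<ge> 2"
  shows "\<exists>W. chain_top (relation_set P Q T) 6 W"
proof (cases "P > 2 \<or> Q > 2 \<or> T > 2")
  case True
  then show ?thesis using chain_top_proper assms by blast
next
  case False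
  then have "P = 2" "Q = 2" "T = 2" using assms by auto
  then show ?thesis using chain_top_trivial_component by simp
qed

section \<open>Counting components of maximal dimension\<close>

lemma irreducible_set_prod_nonzero:
  assumes "irreducible_set Z" "finite I" "\<And>i. i \<in> I \<Longrightarrow> polynomial_fun (f i)"
    and "\<And>i. i \<in> I \<Longrightarrow> \<exists>x\<in>Z. f i x \<noteq> 0"
  shows "\<exists>x\<in>Z. (\<Prod>i\<in>I. f i x) \<noteq> 0"
  using assms(2-4)
proof (induction I rule: finite_induct)
  case empty
  then show ?case using assms(1) by (auto simp: irreducible_set_def)
next
  case (insert i I)
  then obtain y where y: "y \<in> Z" "(\<Prod>i\<in>I. f i y) \<noteq> 0" by auto
  obtain x where x: "x \<in> Z" "f i x \<noteq> 0" using insert.prems by blast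
  show ?case
  proof (rule ccontr)
    assume "\<not> ?thesis"
    then have *: "f i z * (\<Prod>i\<in>I. f i z) = 0" if "z \<in> Z" for z using that insert.hyps by auto
    have "polynomial_fun (f i)" "polynomial_fun (\<lambda>z. \<Prod>i\<in>I. f i z)"
      using insert.prems by (auto intro: polynomial_fun_prod)
    from irreducible_setD[OF assms(1) this _ x y(1)] * have "(\<Prod>i\<in>I. f i y) = 0" by blast
    then show False using y by simp
  qed
qed

lemma alg_indep_open_subset:
  assumes "irreducible_set Z" "alg_indep Z fs" "\<And>f. f \<in> set fs \<Longrightarrow> polynomial_fun f"
    and "polynomial_fun h" "y \<in> Z" "h y \<noteq> 0"
  shows "alg_indep {x\<in>Z. h x \<noteq> 0} fs"
  unfolding alg_indep_def
proof (intro allI impI ballI)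
  fix S c \<alpha>
  assume S: "finite S" "\<forall>\<alpha>\<in>S. length \<alpha> = length fs" "\<alpha> \<in> S"
    and eq: "\<forall>x\<in>{x \<in> Z. h x \<noteq> 0}. (\<Sum>\<alpha>\<in>S. c \<alpha> * power_product fs \<alpha> x) = 0"
  let ?g = "\<lambda>x. \<Sum>\<alpha>\<in>S. c \<alpha> * power_product fs \<alpha> x"
  have "polynomial_fun ?g"
    by (intro polynomial_fun_sum polynomial_fun.mult polynomial_fun.const polynomial_fun_power_product assms)
  moreover have "h x * ?g x = 0" if "x \<in> Z" for x using eq that by auto
  ultimately have "?g x = 0" if "x \<in> Z" for x
    by (rule irreducible_setD[OF assms(1,4) _ _ assms(5,6) that])
  then show "c \<alpha> = 0" using alg_indepD[OF assms(2) S(1) _ _ S(3)] S(2) by blast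
qed

text \<open>A dependence that involves \<open>f\<close> is a polynomial equation for \<open>f\<close> over \<open>fs\<close>. Its leading coefficient \<open>h\<close>
  is not identically zero because \<open>fs\<close> is independent.\<close>

lemma alg_dependent_relation:
  assumes "alg_indep Z fs" "\<not> alg_indep Z (f # fs)"
  shows "\<exists>n h a e. poly_deg_le (set fs) e h \<and> (\<exists>x\<in>Z. h x \<noteq> 0) \<and> (\<forall>j. poly_deg_le (set fs) e (a j)) \<and>
    (\<forall>x\<in>Z. h x * f x ^ n = (\<Sum>j<n. a j x * f x ^ j))"
proof -
  obtain S c \<alpha>\<^sub>0 where S: "finite S" "\<forall>\<alpha>\<in>S. length \<alpha> = Suc (length fs)"
      "\<forall>x\<in>Z. (\<Sum>\<alpha>\<in>S. c \<alpha> * power_product (f # fs) \<alpha> x) = 0" "\<alpha>\<^sub>0 \<in> S" "c \<alpha>\<^sub>0 \<noteq> 0"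
    using assms(2) unfolding alg_indep_def by auto
  define T where "T = {\<alpha>\<in>S. c \<alpha> \<noteq> 0}"
  have T: "finite T" "T \<noteq> {}" using S by (auto simp: T_def)
  define n where "n = Max (hd ` T)"
  have n: "hd \<alpha> \<le> n" if "\<alpha> \<in> T" for \<alpha> using T that by (simp add: n_def)
  have "n \<in> hd ` T" unfolding n_def using T by (intro Max_in) auto
  then obtain \<beta> where \<beta>: "\<beta> \<in> T" "hd \<beta> = n" by blast
  have len: "\<alpha> = hd \<alpha> # tl \<alpha>" "length (tl \<alpha>) = length fs" if "\<alpha> \<in> T" for \<alpha>
    using that S(2) by (cases \<alpha>; auto simp: T_def)+
  define b where "b j x = (\<Sum>\<alpha> | \<alpha> \<in> T \<and> hd \<alpha> = j. c \<alpha> * power_product fs (tl \<alpha>) x)" for j x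
  define m where "m = (\<Sum>\<alpha>\<in>T. sum_list \<alpha>)"
  have b: "poly_deg_le (set fs) (length fs * (m * 1)) (b j)" for j
    unfolding b_def
  proof (rule poly_deg_le_sum)
    fix \<alpha> assume "\<alpha> \<in> {\<alpha> \<in> T. hd \<alpha> = j}"
    then have \<alpha>: "\<alpha> \<in> T" by simp
    have "i \<le> m" if "i \<in> set (tl \<alpha>)" for i
    proof -
      have "i \<in> set \<alpha>" using that by (metis list.set_sel(2) list.sel(2))
      then have "i \<le> sum_list \<alpha>" by (intro member_le_sum_list) auto
      also have "\<dots> \<le> m" unfolding m_def using T \<alpha> by (intro member_le_sum) auto
      finally show ?thesis .
    qed
    then have "poly_deg_le (set fs) (length fs * (m * 1)) (power_product fs (tl \<alpha>))"
      using len(2)[OF \<alpha>] poly_deg_le.gen[of _ "set fs" 0] by (intro poly_deg_le_power_product) auto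
    from poly_deg_le.mult[OF poly_deg_le.const[of _ 0 "c \<alpha>"] this]
    show "poly_deg_le (set fs) (length fs * (m * 1)) (\<lambda>x. c \<alpha> * power_product fs (tl \<alpha>) x)" by simp
  qed
  have rel: "(\<Sum>j\<le>n. b j x * f x ^ j) = 0" if "x \<in> Z" for x
  proof -
    have "(\<Sum>j\<le>n. b j x * f x ^ j) = (\<Sum>j\<le>n. \<Sum>\<alpha> | \<alpha> \<in> T \<and> hd \<alpha> = j. c \<alpha> * power_product (f # fs) \<alpha> x)"
      unfolding b_def sum_distrib_right by (intro sum.cong HOL.refl) auto
    also have "\<dots> = (\<Sum>\<alpha>\<in>T. c \<alpha> * power_product (f # fs) \<alpha> x)"
      by (rule sum.group) (use T n in auto)
    also have "\<dots> = (\<Sum>\<alpha>\<in>S. c \<alpha> * power_product (f # fs) \<alpha> x)"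
      using S(1) by (intro sum.mono_neutral_left) (auto simp: T_def)
    finally show ?thesis using S(3) that by simp
  qed
  have "\<exists>x\<in>Z. b n x \<noteq> 0"
  proof (rule ccontr)
    assume *: "\<not> ?thesis"
    let ?T = "{\<alpha> \<in> T. hd \<alpha> = n}"
    have inj: "inj_on tl ?T" using len(1) by (intro inj_onI) (metis (mono_tags, lifting) mem_Collect_eq)
    have "c (n # tl \<beta>) = 0"
    proof (rule alg_indepD[OF assms(1), where S = "tl ` ?T" and c = "\<lambda>\<gamma>. c (n # \<gamma>)"])
      show "tl \<beta> \<in> tl ` ?T" using \<beta> by auto
      show "length \<gamma> = length fs" if "\<gamma> \<in> tl ` ?T" for \<gamma> using that len by auto
      fix x assume x: "x \<in> Z"
      have "(\<Sum>\<gamma>\<in>tl ` ?T. c (n # \<gamma>) * power_product fs \<gamma> x) =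
          (\<Sum>\<alpha>\<in>?T. c (n # tl \<alpha>) * power_product fs (tl \<alpha>) x)"
        by (rule sum.reindex_cong[OF inj]) auto
      also have "\<dots> = b n x"
        unfolding b_def by (intro sum.cong HOL.refl) (use len(1) in force)
      finally show "(\<Sum>\<gamma>\<in>tl ` ?T. c (n # \<gamma>) * power_product fs \<gamma> x) = 0" using * x by auto
    qed (use T in auto)
    then show False using \<beta> len(1)[OF \<beta>(1)] by (auto simp: T_def)
  qed
  moreover have "b n x * f x ^ n = (\<Sum>j<n. (- b j x) * f x ^ j)" if "x \<in> Z" for x
    using rel[OF that] by (simp add: lessThan_Suc_atMost[symmetric] sum_negf add_eq_0_iff)
  moreover have "poly_deg_le (set fs) (length fs * (m * 1)) (\<lambda>x. - b j x)" for j
    using poly_deg_le_diff[OF poly_deg_le.const b, of 0 j] by simp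
  ultimately show ?thesis using b by (intro exI[of _ n] exI[of _ "b n"] exI[of _ "\<lambda>j x. - b j x"] exI) blast
qed

text \<open>The \<open>k\<close> independent functions can be chosen among the coordinates. For a longest independent list
  \<open>fs\<close> of coordinates all coordinates are algebraic over \<open>fs\<close>, hence integral over it where the
  leading coefficients of the equations do not vanish. That open part of \<open>Z\<close> then has growth \<open>length fs\<close>, yet
  carries \<open>k\<close> independent functions.\<close>

lemma chain_top_coordinates:
  assumes V: "growth V coordinates k" and Z: "chain_top V k Z"
  shows "\<exists>fs. length fs = k \<and> set fs \<subseteq> coordinates \<and> alg_indep Z fs"
proof -
  note irr = chain_topD(1)[OF Z]
  have coord: "polynomial_fun f" if "f \<in> coordinates" for f :: "complex^'a \<Rightarrow> complex"
    using that by (auto intro: polynomial_fun.coord)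
  define P where "P fs \<longleftrightarrow> set fs \<subseteq> coordinates \<and> alg_indep Z fs" for fs
  have bound: "length fs \<le> k" if "P fs" for fs
  proof (rule growth_alg_indep_length[OF V])
    show "alg_indep V fs" using that alg_indep_superset chain_topD(3)[OF Z] by (auto simp: P_def)
    show "poly_deg_le coordinates 1 f" if "f \<in> set fs" for f
      using poly_deg_le.gen[of f coordinates 0] that \<open>P fs\<close> by (auto simp: P_def)
  qed
  obtain gs where gs: "length gs = k" "\<forall>f\<in>set gs. polynomial_fun f" "alg_indep Z gs"
    using chain_top_alg_indep[OF Z] by blast
  have "P []" using irr alg_indep_Nil[of Z] by (simp add: P_def irreducible_set_def)
  then have "\<exists>fs. P fs \<and> (\<forall>fs'. P fs' \<longrightarrow> length fs' \<le> length fs)"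
    using bound by (intro ex_has_greatest_nat[of P "[]" length "Suc k"]) (auto simp: less_Suc_eq_le)
  then obtain fs where fs: "P fs" and max: "\<And>fs'. P fs' \<Longrightarrow> length fs' \<le> length fs" by blast
  have fs': "set fs \<subseteq> coordinates" "alg_indep Z fs" using fs by (simp_all add: P_def)
  have "k \<le> length fs"
  proof -
    define Q where "Q f n h a e \<longleftrightarrow> poly_deg_le (set fs) e h \<and> (\<exists>x\<in>Z. h x \<noteq> 0) \<and>
        (\<forall>j. poly_deg_le (set fs) e (a j)) \<and> (\<forall>x\<in>Z. h x * f x ^ n = (\<Sum>j<n. a j x * f x ^ j))"
      for f :: "complex^'a \<Rightarrow> complex" and n :: nat and h :: "complex^'a \<Rightarrow> complex" and a and e :: nat
    have "\<exists>n h a e. Q f n h a e" if "f \<in> coordinates" for f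
      unfolding Q_def
    proof (rule alg_dependent_relation[OF fs'(2)])
      have "\<not> P (f # fs)" using max[of "f # fs"] by auto
      then show "\<not> alg_indep Z (f # fs)" using fs'(1) that by (simp add: P_def)
    qed
    then obtain n h a e where "\<And>f. f \<in> coordinates \<Longrightarrow> Q f (n f) (h f) (a f) (e f)" by metis
    then have rel: "\<And>f. f \<in> coordinates \<Longrightarrow> poly_deg_le (set fs) (e f) (h f)"
        "\<And>f. f \<in> coordinates \<Longrightarrow> \<exists>x\<in>Z. h f x \<noteq> 0"
        "\<And>f j. f \<in> coordinates \<Longrightarrow> poly_deg_le (set fs) (e f) (a f j)"
        "\<And>f x. f \<in> coordinates \<Longrightarrow> x \<in> Z \<Longrightarrow> h f x * f x ^ n f = (\<Sum>j<n f. a f j x * f x ^ j)"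
      unfolding Q_def by blast+
    define H where "H x = (\<Prod>f\<in>coordinates. h f x)" for x
    have hpoly: "polynomial_fun (h f)" if "f \<in> coordinates" for f
      using rel(1)[OF that] by (rule poly_deg_le_imp_polynomial_fun) (use fs' coord in auto)
    have H: "polynomial_fun H" unfolding H_def by (intro polynomial_fun_prod hpoly)
    have "finite (coordinates :: (complex^'a \<Rightarrow> complex) set)" by simp
    from irreducible_set_prod_nonzero[OF irr, of coordinates h, OF this hpoly rel(2)]
    obtain y where y: "y \<in> Z" "H y \<noteq> 0" unfolding H_def by blast
    let ?Z = "{x\<in>Z. H x \<noteq> 0}"
    have h0: "h f x \<noteq> 0" if "f \<in> coordinates" "x \<in> ?Z" for f x
      using that by (auto simp: H_def)
    have free: "growth ?Z (set gs) (length gs)" for gs :: "(complex^'a \<Rightarrow> complex) list"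
      by (induction gs) (auto intro: growth_empty growth_insert_free)
    have "\<exists>F. X \<subseteq> F \<and> set fs \<subseteq> F \<and> growth ?Z F (length fs)" if "finite X" "X \<subseteq> coordinates" for X
      using that
    proof (induction X rule: finite_induct)
      case empty
      then show ?case using free[of fs] by blast
    next
      case (insert f X)
      then obtain F where F: "X \<subseteq> F" "set fs \<subseteq> F" "growth ?Z F (length fs)" by blast
      have f: "f \<in> coordinates" using insert by simp
      let ?y = "\<lambda>x. inverse (h f x)"
      have "growth ?Z (insert ?y F) (length fs)"
      proof (rule growth_insert_inverse[OF F(3)])
        show "poly_deg_le F (e f) (h f)" by (rule poly_deg_le_mono[OF rel(1)[OF f] order_refl F(2)])
        show "h f x * inverse (h f x) = 1" if "x \<in> ?Z" for x using h0[OF f that] by simp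
      qed
      then have "growth ?Z (insert f (insert ?y F)) (length fs)"
      proof (rule growth_insert_integral)
        fix j
        have "poly_deg_le (insert ?y F) (e f) (a f j)" using rel(3)[OF f] by (rule poly_deg_le_mono) (use F in auto)
        moreover have "poly_deg_le (insert ?y F) (Suc 0) ?y" by (intro poly_deg_le.gen) simp
        ultimately show "poly_deg_le (insert ?y F) (e f + Suc 0) (\<lambda>x. a f j x * ?y x)" by (rule poly_deg_le.mult)
      next
        fix x assume x: "x \<in> ?Z"
        have "f x ^ n f = (h f x * f x ^ n f) * ?y x" using h0[OF f x] by simp
        also have "\<dots> = (\<Sum>j<n f. a f j x * ?y x * f x ^ j)"
          using rel(4)[OF f, of x] x by (simp add: sum_distrib_left mult_ac)
        finally show "f x ^ n f = (\<Sum>j<n f. a f j x * ?y x * f x ^ j)" .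
      qed
      then show ?case using F by (intro exI[of _ "insert f (insert ?y F)"]) auto
    qed
    from this[of coordinates] obtain F where F: "coordinates \<subseteq> F" "growth ?Z F (length fs)" by auto
    then have "growth ?Z coordinates (length fs)" using growth_mono by blast
    moreover have "alg_indep ?Z gs"
      by (rule alg_indep_open_subset[OF irr gs(3) _ H y]) (use gs in auto)
    moreover obtain d where "\<And>f. f \<in> set gs \<Longrightarrow> poly_deg_le coordinates d f"
      using finite_common_degree[of "set gs"] gs by auto
    ultimately show ?thesis using growth_alg_indep_length gs(1) by blast
  qed
  then show ?thesis using fs' bound[OF fs] by (intro exI[of _ fs]) auto
qed

text \<open>Members of top dimension do not contain each other, so each has a polynomial that
  vanishes on all the others but not on it. Multiplied by the power products of its independent
  coordinates, these give linearly independent functions on \<open>V\<close>, about \<open>d\<^sup>k\<close> of them for each member. The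
  coordinates have degree 1 on every member, so the growth constant of \<open>V\<close> bounds the number of members
  uniformly.\<close>

lemma finite_chain_tops:
  fixes V :: "(complex^'m) set"
  assumes V: "growth V coordinates k"
  shows "finite {Z. chain_top V k Z}"
proof -
  obtain K where K: "\<forall>d. \<exists>B. finite B \<and> card B \<le> K * (d + 1) ^ k \<and>
     (\<forall>f. poly_deg_le (coordinates :: (complex^'m \<Rightarrow> complex) set) d f \<longrightarrow> spanned_on V B f)"
    using V unfolding growth_def by blast
  have coord: "polynomial_fun f" if "f \<in> coordinates" for f :: "complex^'m \<Rightarrow> complex"
    using that by (auto intro: polynomial_fun.coord)
  have "card \<Z> \<le> K * (k + 1) ^ k" if \<Z>: "finite \<Z>" "\<Z> \<subseteq> {Z. chain_top V k Z}" for \<Z>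
  proof -
    have top: "chain_top V k Z" if "Z \<in> \<Z>" for Z using that \<Z> by blast
    have "\<exists>fs. length fs = k \<and> set fs \<subseteq> coordinates \<and> alg_indep Z fs" if "Z \<in> \<Z>" for Z
      using chain_top_coordinates[OF V top[OF that]] .
    then obtain fs where fs: "\<And>Z. Z \<in> \<Z> \<Longrightarrow> length (fs Z) = k"
        "\<And>Z. Z \<in> \<Z> \<Longrightarrow> set (fs Z) \<subseteq> coordinates" "\<And>Z. Z \<in> \<Z> \<Longrightarrow> alg_indep Z (fs Z)" by metis
    have "\<exists>g. polynomial_fun g \<and> (\<forall>x\<in>Z'. g x = 0) \<and> (\<exists>x\<in>Z. g x \<noteq> 0)"
      if ZZ: "Z \<in> \<Z>" "Z' \<in> \<Z>" "Z \<noteq> Z'" for Z Z'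
    proof -
      have "\<not> Z \<subseteq> Z'"
      proof
        assume "Z \<subseteq> Z'"
        then have "chain_top V (Suc k) Z'"
          using chain_top_Suc[OF top[OF ZZ(1)]] chain_topD[OF top[OF ZZ(2)]] ZZ(3) by blast
        then show False using growth_chain_top_le[OF V] by fastforce
      qed
      then obtain x where x: "x \<in> Z" "x \<notin> Z'" by blast
      then have "x \<in> V" "x \<notin> zariski_closure V Z'"
        using chain_topD[OF top[OF ZZ(1)]] chain_topD[OF top[OF ZZ(2)]] by auto
      then show ?thesis using x(1) unfolding zariski_closure_def by blast
    qed
    then obtain g where g: "\<And>Z Z'. Z \<in> \<Z> \<Longrightarrow> Z' \<in> \<Z> \<Longrightarrow> Z \<noteq> Z' \<Longrightarrow>
        polynomial_fun (g Z Z') \<and> (\<forall>x\<in>Z'. g Z Z' x = 0) \<and> (\<exists>x\<in>Z. g Z Z' x \<noteq> 0)" by metis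
    define E where "E Z x = (\<Prod>Z'\<in>\<Z> - {Z}. g Z Z' x)" for Z x
    have Epoly: "polynomial_fun (E Z)" if "Z \<in> \<Z>" for Z
      unfolding E_def by (intro polynomial_fun_prod) (use g that in blast)
    have Enz: "\<exists>x\<in>Z. E Z x \<noteq> 0" if "Z \<in> \<Z>" for Z
      unfolding E_def
      by (rule irreducible_set_prod_nonzero[OF chain_topD(1)[OF top[OF that]]]) (use g that \<Z> in auto)
    have Ez: "E Z x = 0" if "Z \<in> \<Z>" "Z' \<in> \<Z>" "Z \<noteq> Z'" "x \<in> Z'" for Z Z' x
      unfolding E_def using that g[of Z Z'] \<Z> by (intro prod_zero) auto
    obtain D where "\<And>f. f \<in> E ` \<Z> \<Longrightarrow> poly_deg_le coordinates D f"
      by (rule finite_common_degree[of "E ` \<Z>"]) (use \<Z> Epoly in auto)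
    then have D: "\<And>Z. Z \<in> \<Z> \<Longrightarrow> poly_deg_le coordinates D (E Z)" by blast
    \<comment> \<open>exponents up to \<open>D\<close> suffice: the degrees \<open>D\<close> of the separating polynomials then only
      change the constant\<close>
    obtain B where B: "finite B" "card B \<le> K * (D + k * (D * 1) + 1) ^ k"
        "\<And>f. poly_deg_le coordinates (D + k * (D * 1)) f \<Longrightarrow> spanned_on V B f"
      using K by blast
    let ?I = "\<Z> \<times> exponents k D"
    let ?F = "\<lambda>(Z, \<alpha>) x. E Z x * power_product (fs Z) \<alpha> x"
    have "card ?I \<le> card B"
    proof (rule ccontr)
      assume "\<not> ?thesis"
      then have less: "card B < card ?I" by simp
      have span: "spanned_on V B (?F i)" if "i \<in> ?I" for i
      proof -
        obtain Z \<alpha> where i: "i = (Z, \<alpha>)" "Z \<in> \<Z>" "\<alpha> \<in> exponents k D" using \<open>i \<in> ?I\<close> by blast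
        have "poly_deg_le coordinates (length (fs Z) * (D * 1)) (power_product (fs Z) \<alpha>)"
        proof (rule poly_deg_le_power_product)
          show "poly_deg_le coordinates 1 f" if "f \<in> set (fs Z)" for f
            using poly_deg_le.gen[of f coordinates 0] fs(2)[OF i(2)] that by auto
        qed (use i fs(1) in \<open>auto simp: exponents_def\<close>)
        then have "poly_deg_le coordinates (D + k * (D * 1)) (\<lambda>x. E Z x * power_product (fs Z) \<alpha> x)"
          using D[OF i(2)] fs(1)[OF i(2)] by (intro poly_deg_le.mult) auto
        then show ?thesis using B(3) i(1) by simp
      qed
      have "finite ?I" using \<Z> by simp
      from spanned_on_dependence[OF B(1) this less span]
      obtain c where "(\<exists>i\<in>?I. c i \<noteq> 0) \<and> (\<forall>x\<in>V. (\<Sum>i\<in>?I. c i * ?F i x) = 0)" by (rule exE)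
      then obtain Z \<alpha> where Z: "Z \<in> \<Z>" "\<alpha> \<in> exponents k D" "c (Z, \<alpha>) \<noteq> 0"
        and c: "\<And>x. x \<in> V \<Longrightarrow> (\<Sum>i\<in>?I. c i * ?F i x) = 0" by blast
      let ?g = "\<lambda>x. \<Sum>\<alpha>\<in>exponents k D. c (Z, \<alpha>) * power_product (fs Z) \<alpha> x"
      have "E Z x * ?g x = 0" if x: "x \<in> Z" for x
      proof -
        have "(\<Sum>i\<in>?I. c i * ?F i x) = (\<Sum>Z'\<in>\<Z>. \<Sum>\<alpha>\<in>exponents k D. c (Z', \<alpha>) * (E Z' x * power_product (fs Z') \<alpha> x))"
          by (simp add: sum.cartesian_product case_prod_unfold)
        also have "\<dots> = (\<Sum>\<alpha>\<in>exponents k D. c (Z, \<alpha>) * (E Z x * power_product (fs Z) \<alpha> x))"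
          using Z(1) \<Z>(1) Ez[OF _ Z(1) _ x] by (subst sum.remove[of _ Z]) (auto intro!: sum.neutral)
        also have "\<dots> = E Z x * ?g x" by (simp add: sum_distrib_left mult_ac)
        finally show ?thesis using c[of x] chain_topD(3)[OF top[OF Z(1)]] x by auto
      qed
      moreover have "polynomial_fun ?g"
        by (intro polynomial_fun_sum polynomial_fun.mult polynomial_fun.const polynomial_fun_power_product)
          (use fs(2)[OF Z(1)] coord in auto)
      moreover obtain y where "y \<in> Z" "E Z y \<noteq> 0" using Enz[OF Z(1)] by blast
      ultimately have g0: "?g x = 0" if "x \<in> Z" for x
        using irreducible_setD[OF chain_topD(1)[OF top[OF Z(1)]] Epoly[OF Z(1)] _ _ _ _ that] by blast
      have "\<And>\<alpha>. \<alpha> \<in> exponents k D \<Longrightarrow> length \<alpha> = length (fs Z)"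
        using fs(1)[OF Z(1)] by (simp add: exponents_def)
      from alg_indepD[OF fs(3)[OF Z(1)] finite_exponents this g0 Z(2)] show False using Z(3) by simp
    qed
    also have "\<dots> \<le> K * ((k + 1) * (D + 1)) ^ k"
    proof -
      have "D + k * (D * 1) + 1 \<le> (k + 1) * (D + 1)" by simp
      then have "(D + k * (D * 1) + 1) ^ k \<le> ((k + 1) * (D + 1)) ^ k" by (rule power_mono) simp
      then show ?thesis using B(2) by (meson le_trans mult_le_mono2)
    qed
    finally have "card \<Z> * (D + 1) ^ k \<le> K * (k + 1) ^ k * (D + 1) ^ k"
      by (simp only: card_cartesian_product card_exponents power_mult_distrib mult.assoc)
    then show ?thesis by simp
  qed
  then show ?thesis using infinite_arbitrarily_large by (metis Suc_n_not_le_n)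
qed

section \<open>Invariance under isomorphism\<close>

lemma polynomial_fun_compose:
  "polynomial_fun h \<Longrightarrow> polynomial_map g \<Longrightarrow> polynomial_fun (\<lambda>x. h (g x))"
  by (induction rule: polynomial_fun.induct) (auto intro: polynomial_fun.intros simp: polynomial_map_def)

lemma chain_top_image:
  assumes fg: "polynomial_map f" "polynomial_map g" "f ` V \<subseteq> W" "g ` W \<subseteq> V"
    "\<And>x. x \<in> V \<Longrightarrow> g (f x) = x" "\<And>y. y \<in> W \<Longrightarrow> f (g y) = y"
    and Z: "chain_top V n Z"
  shows "chain_top W n (f ` Z)"
proof -
  obtain C where C: "\<forall>i\<le>n. zariski_closure V (C i) = C i \<and> irreducible_set (C i)" "\<forall>i<n. C i \<subset> C (Suc i)" "C n = Z"
    using Z unfolding chain_top_def by blast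
  have sub: "C i \<subseteq> V" if "i \<le> n" for i using C(1) that by (auto simp: zariski_closure_def)
  have "zariski_closure W (f ` C i) = f ` C i" if i: "i \<le> n" for i
  proof (intro equalityI subsetI)
    fix y assume y: "y \<in> zariski_closure W (f ` C i)"
    then have yW: "y \<in> W" by (simp add: zariski_closure_def)
    have "h (g y) = 0" if h: "polynomial_fun h" "\<forall>x\<in>C i. h x = 0" for h
    proof (rule zariski_closure_vanish[OF polynomial_fun_compose[OF h(1) fg(2)] _ y])
      fix w assume "w \<in> f ` C i"
      then show "h (g w) = 0" using h(2) fg(5) sub[OF i] by auto
    qed
    then have "g y \<in> zariski_closure V (C i)" using yW fg(4) by (auto simp: zariski_closure_def)
    then have "g y \<in> C i" using C(1) i by auto
    then show "y \<in> f ` C i" using fg(6)[OF yW] by (metis imageI)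
  next
    fix y assume "y \<in> f ` C i"
    then show "y \<in> zariski_closure W (f ` C i)"
      using zariski_closure_superset[of "f ` C i" W] fg(3) sub[OF i] by blast
  qed
  moreover have "irreducible_set (f ` C i)" if i: "i \<le> n" for i
    unfolding irreducible_set_def
  proof (intro conjI allI impI)
    show "f ` C i \<noteq> {}" using C(1) i by (auto simp: irreducible_set_def)
    fix u v :: "complex^'b \<Rightarrow> complex"
    assume uv: "polynomial_fun u" "polynomial_fun v" "\<forall>y\<in>f ` C i. u y * v y = 0"
    then show "(\<forall>y\<in>f ` C i. u y = 0) \<or> (\<forall>y\<in>f ` C i. v y = 0)"
      using C(1) i polynomial_fun_compose[OF uv(1) fg(1)] polynomial_fun_compose[OF uv(2) fg(1)]
      unfolding irreducible_set_def by simp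
  qed
  moreover have "f ` C i \<subset> f ` C (Suc i)" if i: "i < n" for i
  proof -
    have "inj_on f (C (Suc i))" using fg(5) sub[of "Suc i"] i by (intro inj_onI) (metis Suc_leI subsetD)
    then show ?thesis using C(2) i by (intro image_strict_mono) auto
  qed
  ultimately show ?thesis unfolding chain_top_def using C(3) by (intro exI[of _ "\<lambda>i. f ` C i"]) auto
qed

lemma variety_iso_card_chain_tops:
  assumes "variety_iso V W"
  shows "card {Z. chain_top V n Z} = card {Z. chain_top W n Z}"
proof -
  obtain f g where fg: "polynomial_map f" "polynomial_map g" "f ` V \<subseteq> W" "g ` W \<subseteq> V"
    "\<And>x. x \<in> V \<Longrightarrow> g (f x) = x" "\<And>y. y \<in> W \<Longrightarrow> f (g y) = y"
    using assms unfolding variety_iso_def by blast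
  have "bij_betw (image f) {Z. chain_top V n Z} {Z. chain_top W n Z}"
  proof (rule bij_betw_byWitness[where f' = "image g"])
    have "g ` f ` Z = Z" if "chain_top V n Z" for Z
      using chain_topD(3)[OF that] fg(5) by (force simp: image_iff)
    then show "\<forall>Z\<in>{Z. chain_top V n Z}. g ` f ` Z = Z" by simp
    have "f ` g ` Z = Z" if "chain_top W n Z" for Z
      using chain_topD(3)[OF that] fg(6) by (force simp: image_iff)
    then show "\<forall>Z\<in>{Z. chain_top W n Z}. f ` g ` Z = Z" by simp
    show "image f ` {Z. chain_top V n Z} \<subseteq> {Z. chain_top W n Z}"
      using chain_top_image[OF fg] by blast
    show "image g ` {Z. chain_top W n Z} \<subseteq> {Z. chain_top V n Z}"
      using chain_top_image[OF fg(2,1,4,3,6,5)] by blast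
  qed
  then show ?thesis by (rule bij_betw_same_card)
qed

text \<open>With exponents \<open>2 m + 2\<close> the first matrix can have any of the \<open>m\<close> different traces
  \<open>2 cos (2 \<pi> i / (2 m + 2))\<close> for \<open>i = 1, \<dots>, m\<close>, and its power is \<open>1\<close>; the other two have power \<open>-1\<close>.\<close>

lemma card_chain_tops_unbounded: "\<exists>n\<ge>2. card {W. chain_top (relation_set n n n) 6 W} \<ge> m"
proof -
  let ?n = "2 * m + 2"
  let ?R = "relation_set ?n ?n ?n"
  define j :: "nat \<Rightarrow> 3 \<Rightarrow> nat" where "j i k = (if k = 1 then 2 * i else 1)" for i k
  let ?\<theta> = "\<lambda>i. pi * real (2 * i) / real ?n"
  have "\<exists>W. chain_top ?R 6 W \<and> (\<forall>x\<in>W. trace (gen_mat 1 x) = of_real (2 * cos (?\<theta> i)))"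
    if "i \<in> {1..m}" for i
  proof -
    have "\<exists>W. chain_top ?R 6 W \<and> (\<forall>x\<in>W. \<forall>k. trace (gen_mat k x) = of_real (2 * cos (pi * real (j i k) / real ?n)))"
      using that by (intro chain_top_cis_classes[of "j i" "\<lambda>_. ?n"]) (auto simp: j_def)
    then obtain W where W: "chain_top ?R 6 W"
        "\<And>x k. x \<in> W \<Longrightarrow> trace (gen_mat k x) = of_real (2 * cos (pi * real (j i k) / real ?n))" by blast
    have "trace (gen_mat 1 x) = of_real (2 * cos (?\<theta> i))" if "x \<in> W" for x
      using W(2)[OF that, of 1] by (simp add: j_def)
    then show ?thesis using W(1) by blast
  qed
  then obtain W where W: "\<And>i. i \<in> {1..m} \<Longrightarrow> chain_top ?R 6 (W i)"
      "\<And>i x. i \<in> {1..m} \<Longrightarrow> x \<in> W i \<Longrightarrow> trace (gen_mat 1 x) = of_real (2 * cos (?\<theta> i))" by metis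
  have "inj_on W {1..m}"
  proof (rule inj_onI)
    fix i i' assume ii: "i \<in> {1..m}" "i' \<in> {1..m}" "W i = W i'"
    obtain x where "x \<in> W i" using chain_topD(1)[OF W(1)[OF ii(1)]] by (auto simp: irreducible_set_def)
    then have "of_real (2 * cos (?\<theta> i)) = (of_real (2 * cos (?\<theta> i')) :: complex)"
      using W(2)[OF ii(1)] W(2)[OF ii(2)] ii(3) by metis
    then have "cos (?\<theta> i) = cos (?\<theta> i')" by (simp only: of_real_eq_iff)
    moreover have "0 \<le> ?\<theta> l \<and> ?\<theta> l \<le> pi" if "l \<in> {1..m}" for l
    proof -
      have "pi * (real (2 * l) / real ?n) \<le> pi * 1" using that by (intro mult_left_mono) auto
      then show ?thesis by simp
    qed
    ultimately have "?\<theta> i = ?\<theta> i'" using cos_inj_pi ii by blast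
    then show "i = i'" by (simp add: field_simps)
  qed
  then have "m = card (W ` {1..m})" by (simp add: card_image)
  also have "\<dots> \<le> card {W. chain_top ?R 6 W}"
    by (intro card_mono finite_chain_tops growth_relation_set) (use W(1) in auto)
  finally show ?thesis by (intro exI[of _ ?n]) auto
qed

section \<open>Distinguishing the groups\<close>

text \<open>A homomorphism is only meaningful on the carrier; extensionality makes counting possible.\<close>

definition normalized_hom :: "('a, 'c) monoid_scheme \<Rightarrow> ('b, 'd) monoid_scheme \<Rightarrow> ('a \<Rightarrow> 'b) set" where
  "normalized_hom G H = {h \<in> hom G H. h \<in> extensional (carrier G)}"

lemma normalized_hom_pullback:
  assumes "group A" "f \<in> hom A B" "h \<in> normalized_hom B H"
  shows "restrict (h \<circ> f) (carrier A) \<in> normalized_hom A H"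
proof -
  have "x \<otimes>\<^bsub>A\<^esub> y \<in> carrier A" if "x \<in> carrier A" "y \<in> carrier A" for x y
    using monoid.m_closed[OF group.is_monoid[OF assms(1)] that] .
  moreover have "h \<circ> f \<in> hom A H"
    using assms(2,3) by (auto simp: normalized_hom_def intro: hom_compose)
  ultimately show ?thesis by (auto simp: normalized_hom_def hom_def)
qed

lemma iso_card_normalized_hom:
  assumes "group G" "group G'" "G \<cong> G'"
  shows "card (normalized_hom G H) = card (normalized_hom G' H)"
proof -
  obtain \<phi> where \<phi>: "\<phi> \<in> iso G G'" using assms(3) by (auto simp: is_iso_def)
  define \<psi> where "\<psi> = inv_into (carrier G) \<phi>"
  have \<psi>: "\<psi> \<in> iso G' G" unfolding \<psi>_def using group.iso_set_sym[OF assms(1) \<phi>] .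
  have hom: "\<phi> \<in> hom G G'" "\<psi> \<in> hom G' G" using \<phi> \<psi> by (simp_all add: iso_def)
  have mem: "\<phi> x \<in> carrier G'" if "x \<in> carrier G" for x using hom(1) that by (rule hom_in_carrier)
  have mem': "\<psi> y \<in> carrier G" if "y \<in> carrier G'" for y using hom(2) that by (rule hom_in_carrier)
  have bij: "bij_betw \<phi> (carrier G) (carrier G')" using \<phi> by (simp add: iso_def)
  have inv: "\<psi> (\<phi> x) = x" if "x \<in> carrier G" for x
    using bij that unfolding \<psi>_def by (rule bij_betw_inv_into_left)
  have inv': "\<phi> (\<psi> y) = y" if "y \<in> carrier G'" for y
    using bij that unfolding \<psi>_def by (rule bij_betw_inv_into_right)
  have "bij_betw (\<lambda>h. restrict (h \<circ> \<psi>) (carrier G')) (normalized_hom G H) (normalized_hom G' H)"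
  proof (rule bij_betw_byWitness[where f' = "\<lambda>h. restrict (h \<circ> \<phi>) (carrier G)"])
    show "\<forall>h\<in>normalized_hom G H. restrict (restrict (h \<circ> \<psi>) (carrier G') \<circ> \<phi>) (carrier G) = h"
      by (auto simp: fun_eq_iff restrict_def mem inv normalized_hom_def extensional_def)
    show "\<forall>h\<in>normalized_hom G' H. restrict (restrict (h \<circ> \<phi>) (carrier G) \<circ> \<psi>) (carrier G') = h"
      by (auto simp: fun_eq_iff restrict_def mem' inv' normalized_hom_def extensional_def)
  qed (use normalized_hom_pullback assms(1,2) hom in blast)+
  then show ?thesis by (rule bij_betw_same_card)
qed

lemma presented_group_hom_card:
  assumes "group H"
  shows "card (normalized_hom (presented_group E) H) =
    card {a. range a \<subseteq> carrier H \<and> (\<forall>(u, v)\<in>E. word_eval H a u = word_eval H a v)}"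
proof -
  interpret H: group H by fact
  let ?P = "presented_group E"
  let ?T = "{a. range a \<subseteq> carrier H \<and> (\<forall>(u, v)\<in>E. word_eval H a u = word_eval H a v)}"
  have "bij_betw (\<lambda>h k. h (presented_gen E k)) (normalized_hom ?P H) ?T"
    unfolding bij_betw_def
  proof (intro conjI inj_onI equalityI subsetI)
    fix h h' assume h: "h \<in> normalized_hom ?P H" "h' \<in> normalized_hom ?P H"
      and eq: "(\<lambda>k. h (presented_gen E k)) = (\<lambda>k. h' (presented_gen E k))"
    have "h A = h' A" if A: "A \<in> carrier ?P" for A
    proof -
      obtain w where "A = word_class E w" using A by (auto simp: presented_group_def)
      then show ?thesis using H.hom_presented_group[of h E w] H.hom_presented_group[of h' E w] h eq
        by (simp add: normalized_hom_def)
    qed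
    then show "h = h'" using h by (intro extensionalityI[of _ "carrier ?P"]) (auto simp: normalized_hom_def)
  next
    fix a assume "a \<in> (\<lambda>h k. h (presented_gen E k)) ` normalized_hom ?P H"
    then obtain h where h: "h \<in> hom ?P H" and a: "a = (\<lambda>k. h (presented_gen E k))"
      by (auto simp: normalized_hom_def)
    have "h (presented_gen E k) \<in> carrier H" for k
      by (rule hom_in_carrier[OF h]) (simp add: presented_gen_def presented_group_def)
    moreover have "word_class E u = word_class E v" if "(u, v) \<in> E" for u v
      using that by (simp add: word_class_eq_iff pres_eq.relation)
    ultimately show "a \<in> ?T" by (auto simp: a H.hom_presented_group[OF h, symmetric])
  next
    fix a assume a: "a \<in> ?T"
    then obtain h where h: "h \<in> hom ?P H" "\<And>x. h (presented_gen E x) = a x"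
      using H.presented_group_hom_exists[of a E] by blast
    have gen: "presented_gen E x \<in> carrier ?P" for x
      by (simp add: presented_gen_def presented_group_def)
    have "monoid.mult ?P A B \<in> carrier ?P" if "A \<in> carrier ?P" "B \<in> carrier ?P" for A B
      using monoid.m_closed[OF group.is_monoid[OF group_presented_group]] that by blast
    then have "restrict h (carrier ?P) \<in> normalized_hom ?P H"
      using h(1) by (auto simp: normalized_hom_def hom_def)
    moreover have "a = (\<lambda>k. restrict h (carrier ?P) (presented_gen E k))"
      using h(2) gen by auto
    ultimately show "a \<in> (\<lambda>h k. h (presented_gen E k)) ` normalized_hom ?P H" by blast
  qed
  then show ?thesis by (rule bij_betw_same_card)
qed

text \<open>The assignments of generators in \<open>\<int>/m\<close> that respect \<open>-n a\<^sub>1 - n a\<^sub>2 = n a\<^sub>3\<close>.\<close>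

definition cyclic_solutions :: "nat \<Rightarrow> nat \<Rightarrow> (3 \<Rightarrow> int) set" where
  "cyclic_solutions n m = {a. range a \<subseteq> {0..<int m} \<and>
     int m dvd int n * (a 1 + a 2 + a 3)}"

lemma card_hom_Gpqt:
  assumes "m > 0"
  shows "card (normalized_hom (Gpqt (- int n) (- int n) (int n)) (integer_mod_group m)) =
    card (cyclic_solutions n m)"
proof -
  let ?H = "integer_mod_group m"
  interpret H: group ?H by simp
  have "(range a \<subseteq> carrier ?H \<and> (\<forall>(u, v)\<in>Gpqt_relations (- int n) (- int n) (int n).
      word_eval ?H a u = word_eval ?H a v)) \<longleftrightarrow> a \<in> cyclic_solutions n m" for a
  proof -
    have "word_eval ?H a (power_word 1 (- int n) @ power_word 2 (- int n)) = word_eval ?H a (power_word 3 (int n)) \<longleftrightarrow>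
        int m dvd int n * (a 1 + a 2 + a 3)" if "range a \<subseteq> carrier ?H"
    proof -
      have "word_eval ?H a (power_word 1 (- int n) @ power_word 2 (- int n)) =
          (- int n * a 1 + - int n * a 2) mod int m"
        by (simp add: H.word_eval_append[OF that] H.word_eval_power_word[OF that] int_pow_integer_mod_group mod_add_eq)
      moreover have "word_eval ?H a (power_word 3 (int n)) = (int n * a 3) mod int m"
        by (simp only: H.word_eval_power_word[OF that] int_pow_integer_mod_group)
      moreover have "(- int n * a 1 + - int n * a 2) - int n * a 3 = - (int n * (a 1 + a 2 + a 3))"
        by (simp add: algebra_simps)
      ultimately show ?thesis by (simp only: mod_eq_dvd_iff dvd_minus_iff)
    qed
    then show ?thesis using assms
      by (auto simp: cyclic_solutions_def Gpqt_relations_def carrier_integer_mod_group)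
  qed
  then show ?thesis unfolding Gpqt_def presented_group_hom_card[OF H.group_axioms]
    by (intro arg_cong[where f = card]) blast
qed

text \<open>Modulo \<open>n\<close>, every triple solves the equation with coefficient \<open>n\<close>. If the equation with
  coefficient \<open>n'\<close> has as many solutions, then \<open>(1, 0, 0)\<close> is one of them.\<close>

lemma cyclic_solutions_dvd:
  assumes "n \<ge> 2" "card (cyclic_solutions n n) = card (cyclic_solutions n' n)"
  shows "n dvd n'"
proof -
  let ?A = "{a :: 3 \<Rightarrow> int. range a \<subseteq> {0..<int n}}"
  have "?A = PiE UNIV (\<lambda>_. {0..<int n})" by (auto simp: PiE_def)
  then have "finite ?A" by (simp add: finite_PiE)
  moreover have "cyclic_solutions n n = ?A" by (auto simp: cyclic_solutions_def)
  moreover have "cyclic_solutions n' n \<subseteq> ?A" by (auto simp: cyclic_solutions_def)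
  ultimately have "cyclic_solutions n' n = ?A" using assms(2) by (metis card_subset_eq)
  moreover have "(\<lambda>k. if k = 1 then 1 else 0) \<in> ?A" using assms(1) by auto
  ultimately have "(\<lambda>k. if k = 1 then 1 else 0) \<in> cyclic_solutions n' n" by blast
  then have "int n dvd int n'" by (simp add: cyclic_solutions_def)
  then show ?thesis by simp
qed

lemma Gpqt_not_iso:
  assumes "n \<ge> 2" "n' \<ge> 2" "Gpqt (- int n) (- int n) (int n) \<cong> Gpqt (- int n') (- int n') (int n')"
  shows "n = n'"
proof -
  have "group (Gpqt p q t)" for p q t unfolding Gpqt_def by (rule group_presented_group)
  then have "card (cyclic_solutions n m) = card (cyclic_solutions n' m)" if "m > 0" for m
    using iso_card_normalized_hom[OF _ _ assms(3), of "integer_mod_group m"] that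
    by (simp add: card_hom_Gpqt)
  then have "n dvd n'" "n' dvd n" using cyclic_solutions_dvd assms(1,2) by auto
  then show ?thesis by (rule dvd_antisym)
qed

section \<open>Dimension, reducibility and infinitely many varieties\<close>

theorem theorem1p1:
  shows "(\<forall>p q t. p \<le> -2 \<and> q \<le> -2 \<and> t \<ge> 2 \<longrightarrow> variety_dim (R_Gpqt p q t) = 6)
    \<and> (\<forall>p q t. p \<le> -2 \<and> q \<le> -2 \<and> t \<ge> 2 \<and> (\<bar>p\<bar> > 2 \<or> \<bar>q\<bar> > 2 \<or> \<bar>t\<bar> > 2)
          \<longrightarrow> \<not> irreducible_variety (R_Gpqt p q t))
    \<and> (\<exists>(S :: (int \<times> int \<times> int) set) S\<^sub>2.
          infinite S
        \<and> (\<forall>(p, q, t)\<in>S. p \<le> -2 \<and> q \<le> -2 \<and> t \<ge> 2)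
        \<and> S\<^sub>2 = {Gpqt p q t | p q t. (p, q, t) \<in> S}
        \<and> infinite (S\<^sub>2 // {(G, H). G \<cong> H})
        \<and> (\<forall>(p, q, t)\<in>S. \<forall>(p', q', t')\<in>S. p \<noteq> p' \<and> q \<noteq> q' \<and> t \<noteq> t'
              \<longrightarrow> \<not> variety_iso (R_Gpqt p q t) (R_Gpqt p' q' t')))"
proof (intro conjI allI impI)
  fix p q t :: int
  assume pqt: "p \<le> -2 \<and> q \<le> -2 \<and> t \<ge> 2"
  then have R: "R_Gpqt p q t = relation_set (nat (- p)) (nat (- q)) (nat t)"
    by (intro R_Gpqt_eq_relation_set) auto
  have ge: "nat (- p) \<ge> 2" "nat (- q) \<ge> 2" "nat t \<ge> 2" using pqt by auto
  obtain W where "chain_top (R_Gpqt p q t) 6 W" unfolding R using chain_top_relation_set[OF ge] by blast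
  then show "variety_dim (R_Gpqt p q t) = 6"
    using variety_dim_eqI growth_relation_set[OF ge] unfolding R by (metis numeral_eq_enat)
next
  fix p q t :: int
  assume pqt: "p \<le> -2 \<and> q \<le> -2 \<and> t \<ge> 2 \<and> (\<bar>p\<bar> > 2 \<or> \<bar>q\<bar> > 2 \<or> \<bar>t\<bar> > 2)"
  then have R: "R_Gpqt p q t = relation_set (nat (- p)) (nat (- q)) (nat t)"
    by (intro R_Gpqt_eq_relation_set) auto
  have ge: "nat (- p) \<ge> 2" "nat (- q) \<ge> 2" "nat t \<ge> 2" using pqt by auto
  have "nat (- p) > 2 \<or> nat (- q) > 2 \<or> nat t > 2" using pqt by auto
  then obtain W where "chain_top (R_Gpqt p q t) 6 W" "W \<noteq> R_Gpqt p q t"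
    unfolding R using chain_top_proper[OF ge] by blast
  then show "\<not> irreducible_variety (R_Gpqt p q t)"
    using not_irreducible_varietyI growth_relation_set[OF ge] unfolding R by blast
next
  define N where "N n = card {W. chain_top (relation_set n n n) 6 W}" for n
  have "infinite (N ` {2..})"
    unfolding infinite_nat_iff_unbounded_le
    using card_chain_tops_unbounded by (force simp: N_def)
  \<comment> \<open>one exponent for every value of the invariant\<close>
  moreover obtain X where X: "X \<subseteq> {2..}" "inj_on N X" "N ` X = N ` {2..}"
    using subset_image_inj[of "N ` {2..}" N "{2..}"] by blast
  ultimately have "infinite X" by (metis finite_imageI)
  let ?s = "\<lambda>n. (- int n, - int n, int n)" and ?G = "\<lambda>n. Gpqt (- int n) (- int n) (int n)"
  let ?S = "?s ` X" and ?S2 = "?G ` X"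
  let ?r = "{(G, H). G \<cong> H} :: (3 word set monoid \<times> 3 word set monoid) set"
  have inj: "inj_on ?s X" by (auto intro: inj_onI)
  have grp: "inj_on (\<lambda>n. ?r `` {?G n}) X"
  proof (rule inj_onI)
    fix n n' assume n: "n \<in> X" "n' \<in> X" "?r `` {?G n} = ?r `` {?G n'}"
    have "?G n' \<in> ?r `` {?G n'}" by (auto intro: iso_refl)
    then have "?G n' \<in> ?r `` {?G n}" by (simp only: n(3))
    then have "?G n \<cong> ?G n'" by simp
    then show "n = n'" using Gpqt_not_iso n(1,2) X(1) by (meson atLeast_iff subsetD)
  qed
  have var: "\<not> variety_iso (R_Gpqt (- int n) (- int n) (int n)) (R_Gpqt (- int n') (- int n') (int n'))"
    if n: "n \<in> X" "n' \<in> X" "n \<noteq> n'" for n n'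
  proof
    assume *: "variety_iso (R_Gpqt (- int n) (- int n) (int n)) (R_Gpqt (- int n') (- int n') (int n'))"
    have "R_Gpqt (- int l) (- int l) (int l) = relation_set l l l" if "l \<in> X" for l
      using R_Gpqt_eq_relation_set[of "- int l" "- int l" "int l"] that X(1) by auto
    then have "N n = N n'" using variety_iso_card_chain_tops[OF *, of 6] n by (simp add: N_def)
    then show False using X(2) n by (auto dest: inj_onD)
  qed
  show "\<exists>(S :: (int \<times> int \<times> int) set) S\<^sub>2.
          infinite S
        \<and> (\<forall>(p, q, t)\<in>S. p \<le> -2 \<and> q \<le> -2 \<and> t \<ge> 2)
        \<and> S\<^sub>2 = {Gpqt p q t | p q t. (p, q, t) \<in> S}
        \<and> infinite (S\<^sub>2 // {(G, H). G \<cong> H})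
        \<and> (\<forall>(p, q, t)\<in>S. \<forall>(p', q', t')\<in>S. p \<noteq> p' \<and> q \<noteq> q' \<and> t \<noteq> t'
              \<longrightarrow> \<not> variety_iso (R_Gpqt p q t) (R_Gpqt p' q' t'))"
  proof (intro exI conjI)
    show "infinite ?S" using \<open>infinite X\<close> inj finite_imageD by blast
    show "\<forall>(p, q, t)\<in>?S. p \<le> -2 \<and> q \<le> -2 \<and> t \<ge> 2" using X(1) by auto
    show "?S2 = {Gpqt p q t | p q t. (p, q, t) \<in> ?S}" by auto
    have "infinite ((\<lambda>n. ?r `` {?G n}) ` X)" using \<open>infinite X\<close> finite_imageD[OF _ grp] by blast
    moreover have "?S2 // ?r = (\<lambda>n. ?r `` {?G n}) ` X" by (auto simp: quotient_def)
    ultimately show "infinite (?S2 // ?r)" by (simp only: not_False_eq_True)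
    show "\<forall>(p, q, t)\<in>?S. \<forall>(p', q', t')\<in>?S. p \<noteq> p' \<and> q \<noteq> q' \<and> t \<noteq> t'
        \<longrightarrow> \<not> variety_iso (R_Gpqt p q t) (R_Gpqt p' q' t')" using var by auto
  qed
qed

end
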